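(* Let $r\in\mathbb{N}$ and $q=e^{-\pi\sqrt r}$, and define the class invariants $g_r=2^{-1/4}q^{-1/24}\prod_{n\ge0}(1-q^{2n+1})$ and $G_r=2^{-1/4}q^{-1/24}\prod_{n\ge0}(1+q^{2n+1})$. Then \[ m\left(8i\,g_r^8G_r^4\right)=\frac{16\sqrt r}{\pi^2}\sum_{n=1}^{\infty}\frac{b_n}{n^2}, \] where the coefficients $b_n$ are defined by the formal identity \[ \sum_{n=1}^{\infty}b_nq^n=q\,\frac{\prod_{j\ge1}(1-q^{8j})^3\,\prod_{j\ge1}(1-q^{4rj})^2}{\prod_{j\ge1}(1-q^{8rj})}. \] Moreover, $8g_r^8G_r^4$ takes the following values, and the sequence $(b_n)$ is multiplicative (i.e. $b_{mn}=b_mb_n$ whenever $\gcd(m,n)=1$) exactly as indicated: $r=1$: $4$, multiplicative; $r=2$: $4\sqrt{2+2\sqrt2}$, not multiplicative; $r=3$: $4(2+\sqrt3)$, not multiplicative; $r=7$: $4(8+3\sqrt7)$, not multiplicative; $r=9$: $4(7+4\sqrt[4]{12}+2\sqrt[4]{12^2}+\sqrt[4]{12^3})$, not multiplicative; $r=15$: $4(28+16\sqrt3+12\sqrt5+7\sqrt{15})$, not multiplicative.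
   Context: For $k\in\mathbb{C}$, $m(k)$ denotes the Mahler measure of $k+y+y^{-1}+z+z^{-1}$, i.e. $\int_0^1\int_0^1\log|k+2\cos(2\pi s)+2\cos(2\pi t)|\,ds\,dt$. *)

theory Defs
  imports "HOL-Analysis.Analysis" "HOL-Computational_Algebra.Computational_Algebra"
begin

text \<open>The (logarithmic) Mahler measure of a Laurent polynomial in two variables, given by its
  evaluation map on the torus.\<close>

definition mahler_measure2 :: "(complex \<Rightarrow> complex \<Rightarrow> complex) \<Rightarrow> real" where
  "mahler_measure2 P =
     integral {0..1} (\<lambda>s. integral {0..1} (\<lambda>t. ln (norm (P (cis (2 * pi * s)) (cis (2 * pi * t))))))"

definition mahler_m :: "complex \<Rightarrow> real" where
  "mahler_m k = mahler_measure2 (\<lambda>y z. k + y + inverse y + z + inverse z)"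

lemma mahler_m_eq:
  "mahler_m k = integral {0..1} (\<lambda>s. integral {0..1} (\<lambda>t.
     ln (norm (k + of_real (2 * cos (2 * pi * s)) + of_real (2 * cos (2 * pi * t))))))"
proof -
  have "k + cis a + inverse (cis a) + cis b + inverse (cis b) =
        k + of_real (2 * cos a) + of_real (2 * cos b)" for a b
    by (simp add: complex_eq_iff)
  then show ?thesis
    by (simp only: mahler_m_def mahler_measure2_def)
qed

definition nome :: "nat \<Rightarrow> real" where
  "nome r = exp (- pi * sqrt (real r))"

definition class_g :: "nat \<Rightarrow> real" where
  "class_g r = 2 powr (- 1 / 4) * nome r powr (- 1 / 24) * (\<Prod>n. 1 - nome r ^ (2 * n + 1))"

definition class_G :: "nat \<Rightarrow> real" where
  "class_G r = 2 powr (- 1 / 4) * nome r powr (- 1 / 24) * (\<Prod>n. 1 + nome r ^ (2 * n + 1))"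

text \<open>The formal product of \<open>1 - q^(d j)\<close> over \<open>j \<ge> 1\<close>, for \<open>d \<ge> 1\<close>; the infinite product is
  taken in the library's (X-adic) metric on formal power series.\<close>

definition euler_fps :: "nat \<Rightarrow> real fps" where
  "euler_fps d = (\<Prod>j. 1 - fps_X ^ (d * Suc j))"

definition b_coeff :: "nat \<Rightarrow> nat \<Rightarrow> real" where
  "b_coeff r n =
     fps_nth (fps_X * (euler_fps 8 ^ 3 * euler_fps (4 * r) ^ 2 / euler_fps (8 * r))) n"

text \<open>For sequences indexed from 1: the value at 0 is irrelevant.\<close>

definition multiplicative_seq :: "(nat \<Rightarrow> real) \<Rightarrow> bool" where
  "multiplicative_seq b \<longleftrightarrow> (\<forall>m\<ge>1. \<forall>n\<ge>1. coprime m n \<longrightarrow> b (m * n) = b m * b n)"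

end

theory Submission
  imports Defs
begin

text \<open>Let \<open>\<kappa> = \<theta>\<^sub>4^2 / \<theta>\<^sub>2^2\<close> at the nome \<open>q = exp (- \<pi> \<surd>r)\<close>. By the triple product,
  \<open>8 g^8 G^4 = 4 \<kappa>\<close>. The Mahler measure of \<open>4 i \<kappa>\<close> is a single integral over an angle; substituting
  the Jacobi amplitude turns the integrand into the logarithm of a quotient of theta functions, whose
  Fourier series is explicit, and orthogonality yields
  \<open>\<pi> \<surd>r / 2 + (\<Sum>n\<ge>1. (-1)^n tanh (n \<pi> \<surd>r) / (n cosh (n \<pi> \<surd>r)))\<close>. The partial fractions of
  \<open>tanh x / cosh x\<close> (reflection for the trigamma function) identify this with the lattice sum of
  \<open>(-1)^(j+m) (2j+1) / ((2j+1)^2 + 4 r m^2)^2\<close> over \<open>j \<ge> 0\<close> and all integers \<open>m\<close>, and the identities of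
  Jacobi and Gauss for \<open>\<Prod>(1-x^j)^3\<close> and \<open>\<Prod>(1-x^j)^2/(1-x^(2j))\<close> show that \<open>b\<^sub>n\<close> collects the
  lattice points with \<open>(2j+1)^2 + 4 r m^2 = n\<close>.

  For \<open>r = 1\<close>, \<open>b\<^sub>n\<close> is the sum of the primary Gaussian integers of norm \<open>n\<close>, hence multiplicative;
  for \<open>r = 2, 3, 7, 9, 15\<close> multiplicativity fails at \<open>n = 33, 21, 77, 45, 69\<close>. The values of \<open>\<kappa>\<close> come from
  the inversion \<open>y \<mapsto> 1 / y\<close>, which exchanges \<open>\<theta>\<^sub>2\<close> and \<open>\<theta>\<^sub>4\<close> up to a common factor, combined with
  modular equations evaluated at a point that the inversion maps to the other argument.\<close>

subsection \<open>Theta series\<close>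

text \<open>An imaginary argument keeps the Laurent polynomial away from 0 on the torus, so all
  integrals are over continuous functions. The lattice sum is the hinge: its terms have degree 1
  over degree 4 in two variables, so it converges absolutely and may be grouped in two ways, by rows
  (fixed m), which yields the hyperbolic terms, or by the values n of the form, which yields b_n /
  n^2. On the analytic side the constant terms of the Fourier computation disappear because ln (4
  kappa) is itself a combination of Lambert series. The relations from the modular equations are
  homogeneous, so the common factor of the inversion drops out and an algebraic equation for
  theta3^2 / (theta2 theta4) remains. It fixes kappa only up to kappa -> 1 / kappa; for r = 3, 7, 9,
  15 the root is selected by the strict monotonicity of kappa in the nome and its value 1 at r = 1.
  Multiplicativity fails where the index is a product of two coprime factors such that b vanishes at
  one of them but not at the product.\<close>

lemma summable_on_int:
  fixes f :: "int \<Rightarrow> real"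
  assumes "\<And>n. f n \<ge> 0" "summable (\<lambda>n. f (int n))" "summable (\<lambda>n. f (- int n))"
  shows "f summable_on UNIV"
proof -
  have a: "(f \<circ> int) summable_on UNIV" "(f \<circ> (\<lambda>n. - int n)) summable_on UNIV"
    using assms by (auto intro!: summable_nonneg_imp_summable_on simp: o_def)
  have "f summable_on range int" "f summable_on range (\<lambda>n. - int n)"
    using a summable_on_reindex[of int UNIV f] summable_on_reindex[of "\<lambda>n. - int n" UNIV f]
    by (auto simp: inj_on_def)
  then have "f summable_on (range int \<union> range (\<lambda>n. - int n))"
    by (rule summable_on_union)
  moreover have "range int \<union> range (\<lambda>n. - int n) = UNIV"
    by (auto simp: image_iff) (metis int_cases2)
  ultimately show ?thesis by simp
qed

lemma summable_gauss_nat: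
  fixes x c :: real
  assumes "0 < x" "x < 1" "c > 0"
  shows "summable (\<lambda>n. x ^ (n^2) * c ^ n)"
proof -
  have "(\<lambda>n. x ^ n * c) \<longlonglongrightarrow> 0 * c"
    using assms by (intro tendsto_intros LIMSEQ_power_zero) auto
  then have "eventually (\<lambda>n. x ^ n * c < 1/2) sequentially"
    by (intro order_tendstoD) auto
  then have "eventually (\<lambda>n. norm (x ^ (n^2) * c ^ n) \<le> (1/2) ^ n) sequentially"
  proof eventually_elim
    case (elim n)
    have "x ^ (n^2) * c ^ n = (x ^ n * c) ^ n"
      by (simp add: power_mult_distrib power_mult power2_eq_square)
    also have "\<dots> \<le> (1/2) ^ n"
      using elim assms by (intro power_mono) auto
    finally show ?case using assms by simp
  qed
  then show ?thesis
    by (rule summable_comparison_test_ev) (auto intro: summable_geometric)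
qed

lemma summable_on_gauss:
  fixes x c :: real
  assumes "0 < x" "x < 1" "c > 0"
  shows "(\<lambda>n::int. x powi (n^2) * c powi n) summable_on UNIV"
proof (rule summable_on_int)
  show "summable (\<lambda>n. x powi (int n)\<^sup>2 * c powi int n)"
    using summable_gauss_nat[OF assms]
    by (simp add: power_int_def nat_power_eq)
  show "summable (\<lambda>n. x powi (- int n)\<^sup>2 * c powi - int n)"
  proof -
    have "x powi (- int n)\<^sup>2 = x ^ (n\<^sup>2)" for n
      by (metis power2_minus of_nat_power power_int_of_nat)
    then show ?thesis
      using summable_gauss_nat[OF assms(1,2), of "inverse c"] assms
      by (simp add: power_int_minus power_inverse)
  qed
qed (use assms in auto)

text \<open>Bilateral series in the nome and a Laurent variable: w = 1, -1 and q give Jacobi's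
  theta_3, theta_4 and q^(-1/4) theta_2. The type is general because the products are needed on the
  unit circle and the special values on the real line.\<close>

definition theta :: "'a::{real_normed_field,banach} \<Rightarrow> 'a \<Rightarrow> 'a" where
  "theta q w = (\<Sum>\<^sub>\<infinity>n::int. q powi (n^2) * w powi n)"

lemma abs_summable_theta:
  fixes q w :: "'a::{real_normed_field,banach}"
  assumes "q \<noteq> 0" "norm q < 1" "w \<noteq> 0"
  shows "(\<lambda>n::int. norm (q powi (n^2) * w powi n)) summable_on UNIV"
  using summable_on_gauss[of "norm q" "norm w"] assms
  by (simp add: norm_mult norm_power_int)

lemma has_sum_theta:
  fixes q w :: "'a::{real_normed_field,banach}"
  assumes "q \<noteq> 0" "norm q < 1" "w \<noteq> 0"
  shows "((\<lambda>n::int. q powi (n^2) * w powi n) has_sum theta q w) UNIV"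
  unfolding theta_def
  using abs_summable_summable[OF abs_summable_theta[OF assms]] by (rule has_sum_infsum)

lemma has_sum_product:
  fixes f :: "'b \<Rightarrow> 'a::{real_normed_field,banach}" and g :: "'c \<Rightarrow> 'a"
  assumes "(f has_sum a) A" "(\<lambda>x. norm (f x)) summable_on A"
    and "(g has_sum b) B" "(\<lambda>x. norm (g x)) summable_on B"
  shows "((\<lambda>(x,y). f x * g y) has_sum a * b) (A \<times> B)"
proof (rule has_sum_SigmaI)
  show "((\<lambda>y. case (x, y) of (x, y) \<Rightarrow> f x * g y) has_sum f x * b) B" for x
    using assms by (auto intro: has_sum_cmult_right)
  show "((\<lambda>x. f x * b) has_sum a * b) A"
    using assms by (auto intro: has_sum_cmult_left)
  have "(\<lambda>(x,y). norm (f x) * norm (g y)) summable_on A \<times> B"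
    by (rule summable_on_SigmaI[where g = "\<lambda>x. norm (f x) * infsum (\<lambda>y. norm (g y)) B"])
       (auto intro!: has_sum_cmult_right has_sum_infsum summable_on_cmult_left assms)
  then have "(\<lambda>x. norm ((\<lambda>(x,y). f x * g y) x)) summable_on A \<times> B"
    by (simp add: case_prod_unfold norm_mult)
  then show "(\<lambda>(x,y). f x * g y) summable_on A \<times> B"
    by (rule abs_summable_summable)
qed

lemma has_sum_theta_mult:
  fixes p q a b :: "'a::{real_normed_field,banach}"
  assumes "p \<noteq> 0" "norm p < 1" "q \<noteq> 0" "norm q < 1" "a \<noteq> 0" "b \<noteq> 0"
  shows "((\<lambda>(m,n). p powi (m^2) * a powi m * (q powi (n^2) * b powi n))
            has_sum theta p a * theta q b) (UNIV :: (int \<times> int) set)"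
  unfolding UNIV_Times_UNIV[symmetric]
  by (rule has_sum_product) (auto intro!: has_sum_theta abs_summable_theta assms)

lemma theta_inverse:
  fixes q w :: "'a::{real_normed_field,banach}"
  shows "theta q (inverse w) = theta q w"
  unfolding theta_def
  by (rule infsum_reindex_bij_witness[of _ uminus uminus])
     (auto simp: power_int_minus power_int_inverse)

lemma theta_shift:
  fixes q w :: "'a::{real_normed_field,banach}"
  assumes "q \<noteq> 0" "w \<noteq> 0"
  shows "theta q (q^2 * w) = theta q w / (q * w)"
proof -
  have "theta q (q^2 * w) = (\<Sum>\<^sub>\<infinity>n::int. (q powi (n^2) * w powi n) * (1 / (q * w)))"
    unfolding theta_def
  proof (rule infsum_reindex_bij_witness[of _ "\<lambda>n. n - 1" "\<lambda>n. n + 1"])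
    fix n :: int
    have "(q^2) powi n = q powi (2*n)" by (simp add: power_int_power)
    moreover have "q powi ((n+1)^2) = q powi (n^2) * q powi (2*n) * q"
    proof -
      have "(n+1)^2 = n^2 + 2*n + 1" by (simp add: power2_eq_square algebra_simps)
      then show ?thesis using assms by (simp add: power_int_add power_int_add_1)
    qed
    moreover have "w powi (n+1) = w powi n * w"
      using assms by (simp add: power_int_add_1)
    ultimately show "q powi (n+1)\<^sup>2 * w powi (n+1) * (1 / (q * w)) = q powi n\<^sup>2 * (q\<^sup>2 * w) powi n"
      using assms by (simp add: power_int_mult_distrib field_simps)
  qed auto
  also have "\<dots> = theta q w * (1 / (q * w))"
    unfolding theta_def by (rule infsum_cmult_left')
  finally show ?thesis by simp
qed

text \<open>The substitution m = s + t, n = s - t diagonalises m^2 + n^2 into 2 s^2 + 2 t^2 but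
  reaches only pairs of equal parity; the others are m = s + t + 1, n = s - t. The quadratic
  relations between theta values used later are specialisations.\<close>

lemma theta_mult_theta:
  fixes q a b :: "'a::{real_normed_field,banach}"
  assumes q: "q \<noteq> 0" "norm q < 1" and ab: "a \<noteq> 0" "b \<noteq> 0"
  shows "theta q a * theta q b = theta (q^2) (a*b) * theta (q^2) (a/b)
           + q * a * (theta (q^2) (q^2*a*b) * theta (q^2) (q^2*a/b))"
proof -
  define F where "F = (\<lambda>(m::int,n::int). q powi (m^2) * a powi m * (q powi (n^2) * b powi n))"
  have q2: "q^2 \<noteq> 0" "norm (q^2) < 1"
    using q by (auto simp: norm_power power_less_one_iff)
  have pw: "(q^2) powi k = q powi (2*k)" for k by (simp add: power_int_power)
  have F: "(F has_sum theta q a * theta q b) UNIV"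
    unfolding F_def by (rule has_sum_theta_mult) (use assms in auto)
  have even: "(F has_sum theta (q^2) (a*b) * theta (q^2) (a/b)) {(m,n). even (m+n)}"
  proof (subst has_sum_reindex_bij_witness[of _ "\<lambda>(s,t). (s+t,s-t)" "\<lambda>(m,n). ((m+n) div 2,(m-n) div
      2)"
            UNIV "\<lambda>(s,t). (q^2) powi (s^2) * (a*b) powi s * ((q^2) powi (t^2) * (a/b) powi t)" F])
    show "((\<lambda>(s,t). (q^2) powi (s^2) * (a*b) powi s * ((q^2) powi (t^2) * (a/b) powi t)) has_sum
             theta (q^2) (a*b) * theta (q^2) (a/b)) UNIV"
      by (rule has_sum_theta_mult) (use q2 ab in auto)
    fix x :: "int \<times> int"
    assume "x \<in> {(m,n). even (m+n)}"
    then obtain m n where x: "x = (m,n)" "even (m+n)" by blast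
    from x(2) obtain k where "m + n = 2*k" by (rule evenE)
    with x obtain s t where x: "x = (s+t,s-t)" by (intro that[of k "k-n"]) auto
    have "q powi ((s+t)^2) * q powi ((s-t)^2) = q powi (2 * s^2) * q powi (2*t^2)"
      using q by (simp add: power_int_add[symmetric] power2_eq_square algebra_simps)
    then show "(case (case x of (m, n) \<Rightarrow> ((m + n) div 2, (m - n) div 2)) of (s,t) \<Rightarrow>
           (q^2) powi (s^2) * (a*b) powi s * ((q^2) powi (t^2) * (a/b) powi t)) = F x"
      using ab by (simp add: x F_def pw power_int_mult_distrib power_int_divide_distrib
            power_int_add power_int_diff field_simps)
  qed (auto, presburger+)
  have odd: "(F has_sum q * a * (theta (q^2) (q^2*a*b) * theta (q^2) (q^2*a/b))) {(m,n). odd (m+n)}"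
  proof (subst has_sum_reindex_bij_witness[of _ "\<lambda>(s,t). (s+t+1,s-t)" "\<lambda>(m,n). ((m+n) div 2,(m-n)
      div 2)"
            UNIV "\<lambda>x. q * a * (case x of (s,t) \<Rightarrow> (q^2) powi (s^2) * (q^2*a*b) powi s * ((q^2) powi
                (t^2) * (q^2*a/b) powi t))" F])
    show "((\<lambda>x. q * a * (case x of (s,t) \<Rightarrow> (q^2) powi (s^2) * (q^2*a*b) powi s * ((q^2) powi (t^2)
        * (q^2*a/b) powi t))) has_sum
             q * a * (theta (q^2) (q^2*a*b) * theta (q^2) (q^2*a/b))) UNIV"
      by (intro has_sum_cmult_right has_sum_theta_mult) (use q2 ab q in auto)
    fix x :: "int \<times> int"
    assume "x \<in> {(m,n). odd (m+n)}"
    then obtain m n where x: "x = (m,n)" "odd (m+n)" by blast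
    from x(2) obtain k where "m + n = 2*k+1" by (rule oddE)
    with x obtain s t where x: "x = (s+t+1,s-t)" by (intro that[of k "k-n"]) auto
    have "q powi ((s+t+1)^2) * q powi ((s-t)^2) = q powi (2 * s^2+2 * s+(2*t^2+2*t)+1)"
      using q by (simp add: power_int_add[symmetric] power2_eq_square algebra_simps)
    also have "\<dots> = q powi (2 * s^2) * q powi (2 * s) * (q powi (2*t^2) * q powi (2*t)) * q"
      using q by (simp add: power_int_add)
    finally have "q powi ((s+t+1)^2) * q powi ((s-t)^2) =
        q powi (2 * s^2) * q powi (2 * s) * (q powi (2*t^2) * q powi (2*t)) * q" .
    moreover have "(s + t + 1 + (s - t)) div 2 = s" "(s + t + 1 - (s - t)) div 2 = t" by auto
    ultimately show "q * a * (case (case x of (m, n) \<Rightarrow> ((m + n) div 2, (m - n) div 2)) of (s,t) \<Rightarrow>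
           (q^2) powi (s^2) * (q^2*a*b) powi s * ((q^2) powi (t^2) * (q^2*a/b) powi t)) = F x"
      using ab q by (simp add: x F_def pw power_int_mult_distrib power_int_divide_distrib
            power_int_add power_int_diff field_simps)
  qed (auto, presburger+)
  have "(F has_sum (theta (q^2) (a*b) * theta (q^2) (a/b) + q * a * (theta (q^2) (q^2*a*b) * theta
      (q^2) (q^2*a/b))))
          ({(m,n). even (m+n)} \<union> {(m,n). odd (m+n)})"
    by (rule has_sum_Un_disjoint[OF even odd]) auto
  moreover have "{(m,n). even (m+n)} \<union> {(m,n). odd (m+n)} = (UNIV :: (int\<times>int) set)" by auto
  ultimately show ?thesis using F by (metis has_sum_unique)
qed

subsection \<open>The finite triple product\<close>

text \<open>Gaussian binomial coefficients by the q-Pascal rule: no division occurs, so the same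
  identities serve for complex numbers, polynomials and formal power series.\<close>

fun gbin :: "'a::comm_ring_1 \<Rightarrow> nat \<Rightarrow> nat \<Rightarrow> 'a" where
  "gbin q n 0 = 1"
| "gbin q 0 (Suc k) = 0"
| "gbin q (Suc n) (Suc k) = gbin q n k + q ^ Suc k * gbin q n (Suc k)"

definition qfac :: "'a::comm_ring_1 \<Rightarrow> nat \<Rightarrow> 'a" where
  "qfac q n = (\<Prod>i<n. 1 - q ^ Suc i)"

lemma gbin_eq_0: "n < k \<Longrightarrow> gbin q n k = 0"
  by (induction q n k rule: gbin.induct) auto

text \<open>Splitting off the factor with i = 0 leaves the same product for x q, hence the induction
  over arbitrary x. The homogenising variable a will be a power of q, which moves the centre of the
  exponents.\<close>

lemma qbinomial:
  "(\<Prod>i<n. a + x * q ^ i) = (\<Sum>k\<le>n. q ^ (k choose 2) * gbin q n k * x ^ k * a ^ (n - k))"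
proof (induction n arbitrary: x)
  case (Suc n)
  define u where "u = (\<lambda>k. q ^ (Suc k choose 2) * gbin q n k * x ^ k * a ^ (Suc n - k))"
  define t where "t = (\<lambda>k. q ^ (Suc k choose 2) * gbin q n k * x ^ k * a ^ (n - k))"
  have "(\<Prod>i<Suc n. a + x * q ^ i) = (a + x) * (\<Prod>i<n. a + (x * q) * q ^ i)"
    by (simp only: prod.lessThan_Suc_shift) (simp add: o_def mult_ac)
  also have "(\<Prod>i<n. a + (x * q) * q ^ i) = (\<Sum>k\<le>n. t k)"
    by (subst Suc.IH) (simp add: t_def power_mult_distrib power_add numeral_2_eq_2 mult_ac)
  also have "(a + x) * (\<Sum>k\<le>n. t k) = (\<Sum>k\<le>n. a * t k) + (\<Sum>k\<le>n. x * t k)"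
    by (simp add: distrib_right sum_distrib_left sum.distrib)
  also have "(\<Sum>k\<le>n. a * t k) = (\<Sum>k\<le>n. u k)"
    by (intro sum.cong refl) (simp add: u_def t_def Suc_diff_le mult_ac)
  also have "(\<Sum>k\<le>n. u k) = (\<Sum>k\<le>Suc n. u k)"
    by (simp add: u_def gbin_eq_0)
  also have "\<dots> = u 0 + (\<Sum>k\<le>n. u (Suc k))"
    by (rule sum.atMost_Suc_shift)
  also have "u 0 + (\<Sum>k\<le>n. u (Suc k)) + (\<Sum>k\<le>n. x * t k) =
               u 0 + (\<Sum>k\<le>n. u (Suc k) + x * t k)"
    by (simp add: sum.distrib)
  also have "\<dots> = (\<Sum>k\<le>Suc n. q ^ (k choose 2) * gbin q (Suc n) k * x ^ k * a ^ (Suc n - k))"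
    by (subst sum.atMost_Suc_shift, intro arg_cong2[where f = "(+)"] sum.cong)
       (simp_all add: u_def t_def algebra_simps power_add numeral_2_eq_2)
  finally show ?case .
qed (auto simp: numeral_2_eq_2)

lemma qfac_0 [simp]: "qfac q 0 = 1"
  by (simp add: qfac_def)

lemma qfac_Suc: "qfac q (Suc n) = qfac q n * (1 - q ^ Suc n)"
  by (simp add: qfac_def)

lemma gbin_mult_qfac:
  "k \<le> n \<Longrightarrow> gbin q n k * qfac q k * qfac q (n - k) = qfac q n"
proof (induction q n k rule: gbin.induct)
  case (3 q n k)
  show ?case
  proof (cases "k = n")
    case True
    then show ?thesis using 3 by (simp add: gbin_eq_0 qfac_Suc flip: mult.assoc)
  next
    case False
    then have *: "Suc k \<le> n" using 3 by auto
    define m where "m = n - Suc k"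
    have n: "n = m + Suc k" using * by (simp add: m_def)
    have 1: "gbin q n k * qfac q k * qfac q (Suc m) = qfac q n"
      using 3 * by (simp add: n Suc_diff_le)
    have 2: "gbin q n (Suc k) * qfac q (Suc k) * qfac q m = qfac q n"
      using 3(2) * by (simp add: n)
    have "gbin q (Suc n) (Suc k) * qfac q (Suc k) * qfac q (Suc n - Suc k) =
          gbin q n k * qfac q k * qfac q (Suc m) * (1 - q ^ Suc k) +
          q ^ Suc k * (gbin q n (Suc k) * qfac q (Suc k) * qfac q m) * (1 - q ^ Suc m)"
      by (simp add: n Suc_diff_le qfac_Suc algebra_simps)
    also have "\<dots> = qfac q n * (1 - q ^ Suc n)"
      by (simp only: 1 2) (simp add: algebra_simps n power_add)
    finally show ?thesis by (simp add: qfac_Suc)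
  qed
qed (auto simp: qfac_def)

lemma two_choose_two: "2 * (k choose 2) = k * (k - 1)"
  by (cases k) (simp_all add: choose_two)

text \<open>The q-binomial theorem with base q^2, 2 n factors and a = q^(2n-1): with this exponent
  the lower n factors are powers of q times z + q^(2i+1), in reverse order, and the upper n are
  powers of q times 1 + z q^(2i+1).\<close>

lemma finite_jacobi_triple:
  fixes q z :: "'a::idom"
  assumes "q \<noteq> 0"
  shows "(\<Prod>k<n. (1 + z * q ^ (2*k+1)) * (z + q ^ (2*k+1))) =
         (\<Sum>k\<le>2*n. gbin (q^2) (2*n) k * q ^ nat ((int k - int n)^2) * z ^ k)"
proof (cases n)
  case (Suc m)
  \<comment> \<open>Completing the square in k leaves (k - n)^2 plus a constant, and the constant
    matches the powers of q extracted from the product.\<close>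
  have exp: "2 * (k choose 2) + (2*n-1) * (2*n-k) = n*m + (2*n-1)*n + nat ((int k - int n)^2)"
    if "k \<le> 2*n" for k
  proof -
    have "int (2 * (k choose 2)) = int k * (int k - 1)"
      unfolding two_choose_two by (cases k) (auto simp: algebra_simps)
    moreover have "int (2*n-1) = 2 * int n - 1" "int (2*n-k) = 2 * int n - int k"
      using that Suc by auto
    ultimately have "int (2 * (k choose 2) + (2*n-1) * (2*n-k)) =
          int k * (int k - 1) + (2 * int n - 1) * (2 * int n - int k)"
      by (simp only: of_nat_add of_nat_mult)
    also have "\<dots> = int n * (int n - 1) + (2 * int n - 1) * int n + (int k - int n)^2"
      by (simp add: power2_eq_square algebra_simps)
    also have "\<dots> = int (n*m + (2*n-1)*n + nat ((int k - int n)^2))"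
      using Suc by (simp add: of_nat_diff algebra_simps)
    finally show ?thesis by linarith
  qed
  have "(\<Prod>i<2*n. q^(2*n-1) + z * (q^2)^i) =
        (\<Prod>i<n. q^(2*n-1) + z * (q^2)^i) * (\<Prod>i<n. q^(2*n-1) + z * (q^2)^(n+i))"
    using prod.atLeastLessThan_concat[of 0 n "2*n" "\<lambda>i. q^(2*n-1) + z * (q^2)^i", symmetric]
      prod.shift_bounds_nat_ivl[of "\<lambda>i. q^(2*n-1) + z * (q^2)^i" 0 n n]
    by (simp add: lessThan_atLeast0 mult_2 add_ac)
  also have "(\<Prod>i<n. q^(2*n-1) + z * (q^2)^(n+i)) = (\<Prod>i<n. q^(2*n-1) * (1 + z * q^(2*i+1)))"
  proof (intro prod.cong refl)
    fix i
    have "(q^2)^(n+i) = q^(2*n-1) * q^(2*i+1)"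
      using Suc by (simp add: power_mult[symmetric] power_add[symmetric])
    then show "q^(2*n-1) + z * (q^2)^(n+i) = q^(2*n-1) * (1 + z * q^(2*i+1))"
      by (simp add: algebra_simps)
  qed
  also have "\<dots> = q^((2*n-1)*n) * (\<Prod>i<n. 1 + z * q^(2*i+1))"
    by (simp add: prod.distrib power_mult)
  also have "(\<Prod>i<n. q^(2*n-1) + z * (q^2)^i) = (\<Prod>i<n. q^(2*n-1) + z * (q^2)^(n - Suc i))"
    by (rule prod.nat_diff_reindex[symmetric])
  also have "\<dots> = (\<Prod>i<n. (q^2)^(n - Suc i) * (z + q^(2*i+1)))"
  proof (intro prod.cong refl)
    fix i assume "i \<in> {..<n}"
    then have "2*n-1 = 2*(n - Suc i) + (2*i+1)" by auto
    then have "q^(2*n-1) = (q^2)^(n - Suc i) * q^(2*i+1)"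
      by (simp only: power_mult[symmetric] power_add[symmetric])
    then show "q^(2*n-1) + z * (q^2)^(n - Suc i) = (q^2)^(n - Suc i) * (z + q^(2*i+1))"
      by (simp add: algebra_simps)
  qed
  also have "\<dots> = (\<Prod>i<n. (q^2)^(n - Suc i)) * (\<Prod>i<n. z + q^(2*i+1))"
    by (rule prod.distrib)
  also have "(\<Prod>i<n. (q^2)^(n - Suc i)) = (\<Prod>i<n. (q^2)^i)"
    by (rule prod.nat_diff_reindex)
  also have "\<dots> = q ^ (n*m)"
  proof -
    have "(\<Prod>i<n. (q^2)^i) = (q^2) ^ (\<Sum>i<n. i)" by (simp add: power_sum)
    also have "(\<Sum>i<n. i) = (n choose 2)" by (simp add: choose_two Sum_Ico_nat lessThan_atLeast0)
    also have "(q^2) ^ (n choose 2) = q ^ (n * m)"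
      unfolding power_mult[symmetric] two_choose_two by (simp add: Suc)
    finally show ?thesis .
  qed
  finally have 1: "(\<Prod>i<2*n. q^(2*n-1) + z * (q^2)^i) =
      q ^ (n*m + (2*n-1)*n) * (\<Prod>k<n. (1 + z * q ^ (2*k+1)) * (z + q ^ (2*k+1)))"
    by (simp add: power_add prod.distrib mult_ac)
  have "(\<Prod>i<2*n. q^(2*n-1) + z * (q^2)^i) =
         (\<Sum>k\<le>2*n. (q^2) ^ (k choose 2) * gbin (q^2) (2*n) k * z ^ k * (q^(2*n-1)) ^ (2*n - k))"
    by (rule qbinomial)
  also have "\<dots> = (\<Sum>k\<le>2*n. q ^ (n*m + (2*n-1)*n) *
                (gbin (q^2) (2*n) k * q ^ nat ((int k - int n)^2) * z ^ k))"
  proof (intro sum.cong refl)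
    fix k assume "k \<in> {..2*n}"
    then have "(q^2) ^ (k choose 2) * (q^(2*n-1)) ^ (2*n - k) =
        q ^ (n*m + (2*n-1)*n) * q ^ nat ((int k - int n)^2)"
      unfolding power_mult[symmetric] power_add[symmetric] by (subst exp) auto
    then show "(q^2) ^ (k choose 2) * gbin (q^2) (2*n) k * z ^ k * (q^(2*n-1)) ^ (2*n - k) =
        q ^ (n*m + (2*n-1)*n) * (gbin (q^2) (2*n) k * q ^ nat ((int k - int n)^2) * z ^ k)"
      by (simp add: mult_ac)
  qed
  finally show ?thesis
    unfolding 1 sum_distrib_left[symmetric] using assms by simp
qed (auto simp: numeral_2_eq_2)

subsection \<open>Jacobi's triple product\<close>

text \<open>The Lambert series of \<open>- (\<Sum>k. ln (1 - a * x ^ k))\<close>; its term for \<open>n = 0\<close> is a division by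
  zero and vanishes.\<close>

definition LS :: "'a::{real_normed_field,banach} \<Rightarrow> 'a \<Rightarrow> 'a" where
  "LS a x = (\<Sum>n. a ^ n / (of_nat n * (1 - x ^ n)))"

text \<open>The factor \<open>b\<close> lets one geometric majorant serve for \<open>LS\<close>
  itself and, with b = 1 - x^(nN), for the logarithms of the partial products.\<close>

lemma norm_LS_term:
  fixes a b x :: "'a::{real_normed_field,banach}"
  assumes "norm x < 1" "norm b \<le> B"
  shows "norm (b * (a ^ n / (of_nat n * (1 - x ^ n)))) \<le> B / (1 - norm x) * norm a ^ n"
proof (cases "n = 0")
  case False
  have "0 \<le> B" using order.trans[OF norm_ge_zero assms(2)] .
  have "1 - norm x \<le> 1 - norm (x ^ n)"
    using False assms power_decreasing[of 1 n "norm x"] by (simp add: norm_power)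
  also have "\<dots> \<le> norm (1 - x ^ n)"
    using norm_triangle_ineq2[of 1 "x^n"] by simp
  finally have 1: "1 - norm x \<le> norm (1 - x ^ n)" .
  have "1 * (1 - norm x) \<le> real n * norm (1 - x ^ n)"
    using False 1 assms by (intro mult_mono) auto
  then have "norm b * norm a ^ n / (real n * norm (1 - x ^ n)) \<le> B * norm a ^ n / (1 - norm x)"
    using assms \<open>0 \<le> B\<close>
    by (intro frac_le mult_right_mono mult_nonneg_nonneg) (auto intro: order.trans)
  then show ?thesis by (simp add: norm_mult norm_divide norm_power)
next
  case True
  then show ?thesis using assms order.trans[OF norm_ge_zero assms(2)] by simp
qed

lemma summable_norm_LS:
  fixes a x :: "'a::{real_normed_field,banach}"
  assumes "norm a < 1" "norm x < 1"
  shows "summable (\<lambda>n. norm (a ^ n / (of_nat n * (1 - x ^ n))))"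
proof (rule summable_comparison_test'[where N = 0])
  show "summable (\<lambda>n. 1 / (1 - norm x) * norm a ^ n)"
    using assms by (intro summable_mult summable_geometric) auto
  show "norm (norm (a ^ n / (of_nat n * (1 - x ^ n)))) \<le> 1 / (1 - norm x) * norm a ^ n" for n
    using norm_LS_term[OF assms(2), of 1 1 a n] by simp
qed

lemma summable_LS:
  fixes a x :: "'a::{real_normed_field,banach}"
  assumes "norm a < 1" "norm x < 1"
  shows "summable (\<lambda>n. a ^ n / (of_nat n * (1 - x ^ n)))"
  by (rule summable_norm_cancel[OF summable_norm_LS[OF assms]])

lemma LS_of_real:
  fixes a x :: real
  assumes "\<bar>a\<bar> < 1" "\<bar>x\<bar> < 1"
  shows "LS (complex_of_real a) (of_real x) = of_real (LS a x)"
  unfolding LS_def using summable_LS[of a x] assms by (simp add: suminf_of_real)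

text \<open>The finite sum over k is exchanged with the logarithm series; as a geometric sum it
  produces the factor 1 - x^(nN).\<close>

lemma ln_prod_sums:
  assumes "norm (a::complex) < 1" "norm (x::complex) < 1"
  shows "(\<lambda>n. (1 - x ^ (n * N)) * (a ^ n / (of_nat n * (1 - x ^ n)))) sums (- (\<Sum>k<N. ln (1 - a * x
      ^ k)))"
proof -
  have "(\<lambda>n. (\<Sum>k<N. (a * x ^ k) ^ n / of_nat n)) sums (\<Sum>k<N. - ln (1 - a * x ^ k))"
  proof (rule sums_sum)
    fix k
    have "norm (a * x ^ k) \<le> norm a * 1"
      unfolding norm_mult using assms by (intro mult_left_mono) (auto simp: norm_power power_le_one)
    then have "norm (- (a * x ^ k)) < 1" using assms by auto
    from sums_minus[OF Ln_series'[OF this]]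
    show "(\<lambda>n. (a * x ^ k) ^ n / of_nat n) sums - ln (1 - a * x ^ k)" by simp
  qed
  moreover have "(\<Sum>k<N. (a * x ^ k) ^ n / of_nat n) = (1 - x ^ (n * N)) * (a ^ n / (of_nat n * (1 -
      x ^ n)))" for n
  proof (cases "n = 0")
    case False
    have "norm (x ^ n) < 1" using False assms by (simp add: norm_power power_less_one_iff)
    then have "x ^ n \<noteq> 1" by auto
    have "(\<Sum>k<N. (a * x ^ k) ^ n / of_nat n) = a ^ n / of_nat n * (\<Sum>k<N. (x ^ n) ^ k)"
      by (simp add: sum_distrib_left power_mult_distrib mult.commute flip: power_mult)
    also have "(\<Sum>k<N. (x ^ n) ^ k) = (1 - x ^ (n * N)) / (1 - x ^ n)"
      using \<open>x ^ n \<noteq> 1\<close> by (simp add: geometric_sum power_mult divide_simps) (simp add: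
          algebra_simps)
    finally show ?thesis by (simp add: field_simps)
  qed auto
  ultimately show ?thesis by (simp add: sum_negf)
qed

lemma prod_tendsto_exp_LS:
  assumes "norm (a::complex) < 1" "norm (x::complex) < 1"
  shows "(\<lambda>N. \<Prod>k<N. 1 - a * x ^ k) \<longlonglongrightarrow> exp (- LS a x)"
proof -
  let ?f = "\<lambda>n. a ^ n / (of_nat n * (1 - x ^ n))"
  have nz: "1 - a * x ^ k \<noteq> 0" for k
  proof -
    have "norm (a * x ^ k) \<le> norm a * 1"
      unfolding norm_mult using assms by (intro mult_left_mono) (auto simp: norm_power power_le_one)
    then show ?thesis using assms by auto
  qed
  have exp: "(\<Prod>k<N. 1 - a * x ^ k) = exp (- (\<Sum>n. (1 - x ^ (n * N)) * ?f n))" for N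
    using nz unfolding sums_unique[OF ln_prod_sums[OF assms], of N, symmetric]
    by (simp add: exp_sum)
  have "(\<lambda>N. (\<Sum>n. (1 - x ^ (n * N)) * ?f n)) \<longlonglongrightarrow> (\<Sum>n. ?f n)"
  proof (rule tannerys_theorem[THEN conjunct2, THEN conjunct2])
    fix n
    show "(\<lambda>N. (1 - x ^ (n * N)) * ?f n) \<longlonglongrightarrow> ?f n"
    proof (cases "n = 0")
      case False
      then have "norm (x ^ n) < 1" using assms by (simp add: norm_power power_less_one_iff)
      then have "(\<lambda>N. (1 - (x ^ n) ^ N) * ?f n) \<longlonglongrightarrow> (1 - 0) * ?f n"
        by (intro tendsto_intros LIMSEQ_power_zero)
      then show ?thesis by (simp add: power_mult)
    qed auto
  next
    have "norm (1 - x ^ (n * N)) \<le> 2" for n N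
    proof -
      have "norm (1 - x ^ (n*N)) \<le> norm (1 :: complex) + norm (x ^ (n*N))"
          by (rule norm_triangle_ineq4)
      also have "\<dots> \<le> 1 + 1" using assms by (intro add_mono) (auto simp: norm_power power_le_one)
      finally show ?thesis by simp
    qed
    from norm_LS_term[OF assms(2) this]
    show "\<forall>\<^sub>F (n, N) in sequentially \<times>\<^sub>F sequentially. norm ((1 - x ^ (n * N)) * ?f n) \<le>
        2 / (1 - norm x) * norm a ^ n"
      by (intro always_eventually) auto
    show "summable (\<lambda>n. 2 / (1 - norm x) * norm a ^ n)"
      using assms by (intro summable_mult summable_geometric) auto
  qed auto
  then show ?thesis unfolding exp LS_def by (intro tendsto_intros)
qed

text \<open>Tannery's theorem for sequences, carried over to the integers along the bijection
  \<open>int_decode\<close>.\<close>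

lemma tannery_int:
  fixes f :: "nat \<Rightarrow> int \<Rightarrow> 'a::{real_normed_algebra,banach}"
  assumes lim: "\<And>j. (\<lambda>n. f n j) \<longlonglongrightarrow> g j" and bound: "\<And>n j. norm (f n j) \<le> h j"
    and h: "h summable_on UNIV"
  shows "(\<lambda>n. \<Sum>\<^sub>\<infinity>j. f n j) \<longlonglongrightarrow> (\<Sum>\<^sub>\<infinity>j. g j)"
proof -
  have h': "(h \<circ> int_decode) summable_on UNIV"
    using h summable_on_reindex_bij_betw[OF bij_int_decode, of h] by (simp add: o_def)
  have eq: "infsum F UNIV = (\<Sum>k. F (int_decode k))" if "\<And>j. norm (F j) \<le> h j" for F :: "int \<Rightarrow> 'a"
  proof -
    have "(\<lambda>j. norm (F j)) summable_on UNIV"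
      by (rule summable_on_comparison_test[OF h]) (use that in auto)
    then have "F summable_on UNIV" by (rule abs_summable_summable)
    then have "((F \<circ> int_decode) has_sum infsum F UNIV) UNIV"
      using has_sum_reindex_bij_betw[OF bij_int_decode, of F] by (simp add: o_def has_sum_infsum)
    then show ?thesis using sums_unique[OF has_sum_imp_sums] by (fastforce simp: o_def)
  qed
  have g: "norm (g j) \<le> h j" for j
    by (rule tendsto_upperbound[OF tendsto_norm[OF lim]]) (use bound in auto)
  have "(\<lambda>n. \<Sum>k. f n (int_decode k)) \<longlonglongrightarrow> (\<Sum>k. g (int_decode k))"
    by (rule tannerys_theorem[OF lim _ summable_on_imp_summable[OF h'], THEN conjunct2, THEN
        conjunct2])
       (auto intro: bound always_eventually)
  then show ?thesis using bound g by (simp add: eq)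
qed

lemma infsum_nat_shift_int:
  fixes F :: "int \<Rightarrow> 'a::{real_normed_field,banach}"
  assumes "\<And>j. \<bar>j\<bar> > int n \<Longrightarrow> F j = 0"
  shows "(\<Sum>k\<le>2*n. F (int k - int n)) = (\<Sum>\<^sub>\<infinity>j. F j)"
proof -
  have "(\<Sum>k\<le>2*n. F (int k - int n)) = sum F {-int n..int n}"
    by (rule sum.reindex_bij_witness[of _ "\<lambda>j. nat (j + int n)" "\<lambda>k. int k - int n"]) auto
  also have "\<dots> = infsum F {-int n..int n}" by (rule infsum_finite[symmetric]) auto
  also have "\<dots> = infsum F UNIV"
    by (rule infsum_cong_neutral) (use assms in auto)
  finally show ?thesis .
qed

lemma qfac_tendsto:
  assumes "norm (Q::complex) < 1"
  shows "(\<lambda>n. qfac Q n) \<longlonglongrightarrow> exp (- LS Q Q)"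
  using prod_tendsto_exp_LS[of Q Q] assms by (simp add: qfac_def)

lemma qfac_nonzero:
  assumes "norm (Q::complex) < 1"
  shows "qfac Q n \<noteq> 0"
proof -
  have "norm (Q ^ Suc i) < 1" for i
    unfolding norm_power using assms by (subst power_less_one_iff) auto
  then have "1 - Q ^ Suc i \<noteq> 0" for i
    by (metis eq_iff_diff_eq_0 norm_one order_less_irrefl)
  then show ?thesis by (simp add: qfac_def del: power_Suc)
qed

text \<open>Factors with even and with odd k are collected separately. Exponentials are compared
  because complex logarithms would give the identity only modulo 2 pi i.\<close>

lemma exp_LS_split:
  fixes a x :: complex
  assumes "norm a < 1" "norm x < 1"
  shows "exp (- LS a x) = exp (- LS a (x^2)) * exp (- LS (a * x) (x^2))"
proof -
  have "norm (x^2) < 1" "norm (a * x) < 1"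
    using assms by (auto simp: norm_power power_less_one_iff norm_mult intro: le_less_trans[OF
        mult_left_le])
  then have "(\<lambda>N. (\<Prod>k<N. 1 - a * (x^2) ^ k) * (\<Prod>k<N. 1 - a * x * (x^2) ^ k)) \<longlonglongrightarrow> exp (- LS a (x^2)) *
      exp (- LS (a * x) (x^2))"
    using assms by (intro tendsto_mult prod_tendsto_exp_LS) auto
  moreover have "(\<Prod>k<N. 1 - a * (x^2) ^ k) * (\<Prod>k<N. 1 - a * x * (x^2) ^ k) =
      (\<Prod>k<2*N. 1 - a * x ^ k)" for N
    by (induction N) (auto simp flip: power_mult simp: mult_ac)
  moreover have "(\<lambda>N. \<Prod>k<2*N. 1 - a * x ^ k) \<longlonglongrightarrow> exp (- LS a x)"
    using LIMSEQ_subseq_LIMSEQ[OF prod_tendsto_exp_LS[OF assms], of "\<lambda>N. 2 * N"]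
    by (simp add: strict_mono_def o_def)
  ultimately show ?thesis by (simp add: LIMSEQ_unique)
qed

lemma exp_LS_mult_uminus:
  fixes a x :: complex
  assumes "norm a < 1" "norm x < 1"
  shows "exp (- LS a x) * exp (- LS (- a) x) = exp (- LS (a^2) (x^2))"
proof -
  have "(\<lambda>N. (\<Prod>k<N. 1 - a * x ^ k) * (\<Prod>k<N. 1 - (- a) * x ^ k)) \<longlonglongrightarrow> exp (- LS a x) * exp (- LS (- a)
      x)"
    using assms by (intro tendsto_mult prod_tendsto_exp_LS) auto
  moreover have "(\<Prod>k<N. 1 - a * x ^ k) * (\<Prod>k<N. 1 - (- a) * x ^ k) =
      (\<Prod>k<N. 1 - a^2 * (x^2) ^ k)" for N
    unfolding prod.distrib[symmetric]
    by (intro prod.cong refl) (simp add: algebra_simps power2_eq_square power_mult_distrib)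
  moreover have "(\<lambda>N. \<Prod>k<N. 1 - a^2 * (x^2) ^ k) \<longlonglongrightarrow> exp (- LS (a^2) (x^2))"
    using assms by (intro prod_tendsto_exp_LS) (auto simp: norm_power power_less_one_iff)
  ultimately show ?thesis by (simp add: LIMSEQ_unique)
qed

text \<open>The finite identity is multiplied by \<open>qfac Q n\<close> and divided by w^n. Its
  coefficients then tend to 1 and are uniformly bounded, so the sum converges termwise to the theta
  series.\<close>

theorem jacobi_triple:
  fixes q w :: complex
  assumes q: "q \<noteq> 0" "norm q < 1" and w: "w \<noteq> 0" "norm (q * w) < 1" "norm (q / w) < 1"
  shows "theta q w = exp (- LS (q^2) (q^2) - LS (- q * w) (q^2) - LS (- q / w) (q^2))"
proof -
  define Q where "Q = q^2"
  have Q: "norm Q < 1" using q by (simp add: Q_def norm_power power_less_one_iff)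
  define L where "L = exp (- LS Q Q)"
  have L: "L \<noteq> 0" by (simp add: L_def)
  \<comment> \<open>This is \<open>qfac Q n\<close> times the Gaussian binomial of 2 n over n + j;
    all four factorials tend to the same nonzero limit.\<close>
  define c where "c = (\<lambda>n j. if \<bar>j\<bar> \<le> int n then
     qfac Q (2*n) * qfac Q n / (qfac Q (nat (int n + j)) * qfac Q (nat (int n - j))) else 0)"
  have Bs: "Bseq (\<lambda>n. qfac Q n)" "Bseq (\<lambda>n. inverse (qfac Q n))"
    using qfac_tendsto[OF Q] by (auto intro!: convergent_imp_Bseq convergentI tendsto_inverse)
  obtain B where B: "B > 0" "\<And>n. norm (qfac Q n) \<le> B" using Bs(1) by (auto elim!: BseqE)
  obtain B' where B': "B' > 0" "\<And>n. norm (inverse (qfac Q n)) \<le> B'" using Bs(2)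
      by (auto elim!: BseqE)
  have cb: "norm (c n j) \<le> (B * B) * (B' * B')" for n j
  proof (cases "\<bar>j\<bar> \<le> int n")
    case True
    then have "norm (c n j) = (norm (qfac Q (2*n)) * norm (qfac Q n)) *
        (norm (inverse (qfac Q (nat (int n + j)))) * norm (inverse (qfac Q (nat (int n - j)))))"
      by (simp add: c_def norm_mult norm_divide norm_inverse divide_inverse)
    also have "\<dots> \<le> (B * B) * (B' * B')"
      using B B' by (intro mult_mono) (auto intro: order.strict_implies_order)
    finally show ?thesis .
  qed (use B B' in \<open>auto simp: c_def\<close>)
  have cl: "(\<lambda>n. c n j) \<longlonglongrightarrow> 1" for j
  proof -
    have 1: "filterlim (\<lambda>n::nat. nat (int n + j)) at_top sequentially"
      "filterlim (\<lambda>n::nat. nat (int n - j)) at_top sequentially"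
      "filterlim (\<lambda>n::nat. 2 * n) at_top sequentially"
      unfolding filterlim_at_top eventually_sequentially
    proof safe
      fix Z :: nat
      show "\<exists>N. \<forall>n\<ge>N. Z \<le> nat (int n + j)" "\<exists>N. \<forall>n\<ge>N. Z \<le> nat (int n - j)" "\<exists>N. \<forall>n\<ge>N. Z \<le> 2 * n"
        by (rule exI[of _ "nat (\<bar>j\<bar> + int Z)"], force)+
    qed
    note lims = 1[THEN filterlim_compose[OF qfac_tendsto[OF Q]]]
    have "(\<lambda>n. qfac Q (2*n) * qfac Q n / (qfac Q (nat (int n + j)) * qfac Q (nat (int n - j)))) \<longlonglongrightarrow> L
        * L / (L * L)"
      unfolding L_def by (intro tendsto_intros lims qfac_tendsto[OF Q]) auto
    moreover have "eventually (\<lambda>n. c n j = qfac Q (2*n) * qfac Q n / (qfac Q (nat (int n + j)) *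
        qfac Q (nat (int n - j)))) sequentially"
      by (rule eventually_sequentiallyI[of "nat \<bar>j\<bar>"]) (auto simp: c_def)
    ultimately show ?thesis using L by (subst tendsto_cong) auto
  qed
  let ?P = "\<lambda>n. qfac Q n * ((\<Prod>k<n. 1 - (-q*w) * Q^k) * (\<Prod>k<n. 1 - (-q/w) * Q^k))"
  have "(\<lambda>n. \<Sum>\<^sub>\<infinity>j. c n j * (q powi (j^2) * w powi j)) \<longlonglongrightarrow> (\<Sum>\<^sub>\<infinity>j. q powi (j^2) * w powi j)"
  proof (rule tannery_int)
    show "(\<lambda>n. c n j * (q powi (j^2) * w powi j)) \<longlonglongrightarrow> q powi (j^2) * w powi j" for j
      using tendsto_mult[OF cl[of j] tendsto_const[of "q powi (j^2) * w powi j"]] by simp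
    show "norm (c n j * (q powi (j^2) * w powi j)) \<le> (B * B) * (B' * B') * norm (q powi (j^2) * w
        powi j)" for n j
      unfolding norm_mult[of "c n j"] by (intro mult_right_mono cb) auto
    show "(\<lambda>j. (B * B) * (B' * B') * norm (q powi (j^2) * w powi j)) summable_on UNIV"
      by (intro summable_on_cmult_right abs_summable_theta) (use q w in auto)
  qed
  moreover have "(\<Sum>\<^sub>\<infinity>j. c n j * (q powi (j^2) * w powi j)) = ?P n" for n
  proof -
    have "(\<Sum>\<^sub>\<infinity>j. c n j * (q powi (j^2) * w powi j)) =
            (\<Sum>k\<le>2*n. c n (int k - int n) * (q powi ((int k - int n)^2) * w powi (int k - int n)))"
      by (rule infsum_nat_shift_int[symmetric]) (auto simp: c_def)
    also have "\<dots> = (\<Sum>k\<le>2*n. qfac Q n * (gbin Q (2*n) k * q ^ nat ((int k - int n)^2) * w ^ k) / w ^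
        n)"
    proof (intro sum.cong refl)
      fix k assume "k \<in> {..2*n}"
      then have k: "k \<le> 2*n" by simp
      have "c n (int k - int n) = qfac Q n * (qfac Q (2*n) / (qfac Q k * qfac Q (2*n-k)))"
        proof -
        have e: "nat (int n + (int k - int n)) = k" "nat (int n - (int k - int n)) = 2*n-k"
          using k by auto
        show ?thesis using k unfolding c_def e by auto
      qed
      also have "qfac Q (2*n) / (qfac Q k * qfac Q (2*n-k)) = gbin Q (2*n) k"
        using gbin_mult_qfac[OF k, of Q] qfac_nonzero[OF Q] by (simp add: field_simps)
      finally have "c n (int k - int n) = qfac Q n * gbin Q (2*n) k" .
      then show "c n (int k - int n) * (q powi ((int k - int n)^2) * w powi (int k - int n)) =
         qfac Q n * (gbin Q (2*n) k * q ^ nat ((int k - int n)^2) * w ^ k) / w ^ n"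
        using w by (simp add: power_int_diff power_int_nonneg_exp)
    qed
    also have "\<dots> = qfac Q n * (\<Prod>k<n. (1 + w * q ^ (2*k+1)) * (w + q ^ (2*k+1))) / w ^ n"
      unfolding finite_jacobi_triple[OF q(1)] Q_def by (simp add: sum_distrib_left
          sum_divide_distrib)
    also have "(\<Prod>k<n. (1 + w * q ^ (2*k+1)) * (w + q ^ (2*k+1))) =
               (\<Prod>k<n. w * ((1 - (-q*w) * Q^k) * (1 - (-q/w) * Q^k)))"
    proof (intro prod.cong refl)
      fix k
      have *: "q ^ (2*k+1) = q * Q ^ k" by (simp add: Q_def power_mult)
      show "(1 + w * q ^ (2*k+1)) * (w + q ^ (2*k+1)) = w * ((1 - (-q*w) * Q^k) * (1 - (-q/w) *
          Q^k))"
        unfolding * using w(1) by (simp add: field_simps)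
    qed
    also have "\<dots> = w ^ n * ((\<Prod>k<n. 1 - (-q*w) * Q^k) * (\<Prod>k<n. 1 - (-q/w) * Q^k))"
      by (simp add: prod.distrib)
    finally show ?thesis using w by simp
  qed
  moreover have "?P \<longlonglongrightarrow> exp (- LS Q Q) * (exp (- LS (- q * w) Q) * exp (- LS (- q / w) Q))"
    by (intro tendsto_intros qfac_tendsto prod_tendsto_exp_LS) (use Q w in \<open>auto simp: norm_mult
        norm_divide\<close>)
  ultimately have "theta q w = exp (- LS Q Q) * (exp (- LS (- q * w) Q) * exp (- LS (- q / w) Q))"
    unfolding theta_def by (simp add: LIMSEQ_unique)
  then show ?thesis by (simp only: Q_def exp_add[symmetric] diff_conv_add_uminus add.assoc)
qed

lemma theta_of_real:
  fixes q w :: real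
  assumes "q \<noteq> 0" "\<bar>q\<bar> < 1" "w \<noteq> 0"
  shows "theta (complex_of_real q) (of_real w) = of_real (theta q w)"
proof -
  have "((\<lambda>n::int. complex_of_real (q powi (n^2) * w powi n)) has_sum of_real (theta q w)) UNIV"
    by (intro has_sum_of_real has_sum_theta) (use assms in auto)
  moreover have "((\<lambda>n::int. (complex_of_real q) powi (n^2) * (of_real w) powi n) has_sum theta
      (of_real q) (of_real w)) UNIV"
    by (intro has_sum_theta) (use assms in auto)
  ultimately show ?thesis by (simp add: has_sum_unique)
qed

context
  fixes q w :: "'a::{real_normed_field,banach}"
  assumes q: "q \<noteq> 0" "norm q < 1" and w: "w \<noteq> 0"
begin

lemma theta_q4: "theta (q^2) (q^4 * w) = theta (q^2) w / (q^2 * w)"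
  using theta_shift[of "q^2" w] q w by (simp flip: power_mult)

lemma theta_minus_mult:
  "theta q (-w) * theta q (-1) = theta (q^2) w ^ 2 - q * w * theta (q^2) (q^2*w) ^ 2"
  using theta_mult_theta[OF q, of "-w" "-1"] w by (simp add: power2_eq_square)

lemma theta_q_mult:
  "theta q (q*w) * theta q q = 2 * theta (q^2) (q^2*w) * theta (q^2) w"
proof -
  have eqs: "q*w*q = q^2*w" "q*w/q = w" "q^2*(q*w)*q = q^4*w" "q^2*(q*w)/q = q^2*w" "q*(q*w) =
      q^2*w"
    using q by (auto simp: power4_eq_xxxx power2_eq_square)
  have "q * w \<noteq> 0" using q w by simp
  from theta_mult_theta[OF q this q(1)]
  have "theta q (q*w) * theta q q = theta (q^2) (q^2*w) * theta (q^2) w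
      + q^2 * w * (theta (q^2) (q^4*w) * theta (q^2) (q^2*w))"
    unfolding eqs .
  also have "\<dots> = 2 * theta (q^2) (q^2*w) * theta (q^2) w"
    unfolding theta_q4 using q w by simp
  finally show ?thesis .
qed

lemma theta_qw_inverse: "theta (q^2) (- (q^3) * w) = theta (q^2) (-q/w) / (- q * w)"
proof -
  have "theta (q^2) (- (q^3) * w) = theta (q^2) ((q^2)^2 * (- w / q))"
    using q by (intro arg_cong2[where f = theta] refl) (simp add: field_simps power2_eq_square
        power3_eq_cube)
  also have "\<dots> = theta (q^2) (- w / q) / (q^2 * (- w / q))"
    by (rule theta_shift) (use q w in auto)
  also have "theta (q^2) (- w / q) = theta (q^2) (-q/w)"
    using theta_inverse[of "q^2" "-q/w"] by simp
  finally show ?thesis using q w by (simp add: power2_eq_square)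
qed

end

context
  fixes q w :: "'a::{real_normed_field,banach}"
  assumes q: "q \<noteq> 0" "norm q < 1" and w: "w \<noteq> 0"
begin

text \<open>The even and the odd half of the product formula coincide here, by one quasi-period and
  inversion of the argument. With the next lemma it evaluates a product and a sum of the two theta
  values whose quotient is, up to a factor, the exponential of the amplitude.\<close>

lemma theta_mult_q:
  "theta q q * theta q (-w) = 2 * theta (q^2) (-q*w) * theta (q^2) (-q/w)"
proof -
  have "theta q q * theta q (-w) = theta (q^2) (-q*w) * theta (q^2) (-q/w) +
          q^2 * (theta (q^2) (-(q^3)*w) * theta (q^2) (-(q^3)*inverse w))"
    using theta_mult_theta[OF q, of q "-w"] q w by (simp add: field_simps power2_eq_square
        power3_eq_cube)
  also have "\<dots> = 2 * theta (q^2) (-q*w) * theta (q^2) (-q/w)"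
  proof -
    have "inverse w \<noteq> 0" "- q / inverse w = - q * w" using w by (auto simp: field_simps)
    then show ?thesis
      unfolding theta_qw_inverse[OF q w] theta_qw_inverse[OF q \<open>inverse w \<noteq> 0\<close>]
      using q w by (simp add: field_simps power2_eq_square)
  qed
  finally show ?thesis .
qed

lemma theta_square_add:
  "theta (q^2) (-q*w) ^ 2 + theta (q^2) (-q/w) ^ 2 / w = theta q (-1) * theta q (q*w)"
proof -
  have "theta q (q*w) * theta q (-1) = theta (q^2) (-q*w) ^ 2 + q^2 * w * theta (q^2) (-(q^3)*w) ^
      2"
    using theta_mult_theta[OF q, of "q*w" "-1"] q w by (simp add: field_simps power2_eq_square
        power3_eq_cube)
  also have "\<dots> = theta (q^2) (-q*w) ^ 2 + theta (q^2) (-q/w) ^ 2 / w"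
    unfolding theta_qw_inverse[OF q w] using q w by (simp add: field_simps power2_eq_square)
  finally show ?thesis by (simp add: mult.commute)
qed

end

lemma theta_one_mult_minus_one:
  fixes q :: "'a::{real_normed_field,banach}"
  assumes q: "q \<noteq> 0" "norm q < 1"
  shows "theta q 1 * theta q (-1) = theta (q^2) (-1) ^ 2"
proof -
  \<comment> \<open>Quasi-periodicity combined with w -> 1 / w makes this value its own negative,
    which removes the odd half of the product formula.\<close>
  have "theta (q^2) (-(q^2)) = 0"
  proof -
    have "theta (q^2) ((q^2)^2 * (-1/q^2)) = theta (q^2) (-1/q^2) / (q^2 * (-1/q^2))"
      by (rule theta_shift) (use q in auto)
    moreover have "theta (q^2) (-1/q^2) = theta (q^2) (-(q^2))"
      using theta_inverse[of "q^2" "-(q^2)"] by (simp add: field_simps)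
    moreover have "(q^2)^2 * (-1/q^2) = - (q^2)" using q by (simp add: power2_eq_square)
    ultimately have "theta (q^2) (-(q^2)) = - theta (q^2) (-(q^2))" using q by simp
    then have "2 * theta (q^2) (-(q^2)) = 0" by (metis add.right_inverse mult_2)
    then show ?thesis by simp
  qed
  then show ?thesis using theta_mult_theta[OF q, of 1 "-1"] by (simp add: power2_eq_square)
qed

lemma theta_pos:
  fixes q w :: real
  assumes "0 < q" "q < 1" "w > 0"
  shows "theta q w > 0"
proof -
  have "((\<lambda>n::int. q powi (n^2) * w powi n) has_sum theta q w) UNIV"
    by (rule has_sum_theta) (use assms in auto)
  then have "theta q w \<ge> (\<Sum>n\<in>{0::int}. q powi (n^2) * w powi n)"
    by (intro finite_sum_le_has_sum) (use assms in auto)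
  then show ?thesis by simp
qed

lemma theta_eq_exp_real:
  fixes q w :: real
  assumes q: "q \<noteq> 0" "\<bar>q\<bar> < 1" and w: "w \<noteq> 0" "\<bar>q * w\<bar> < 1" "\<bar>q / w\<bar> < 1"
  shows "theta q w = exp (- LS (q^2) (q^2) - LS (- q * w) (q^2) - LS (- q / w) (q^2))"
proof -
  have q2: "\<bar>q^2\<bar> < 1" using q by (simp add: abs_square_less_1)
  have "complex_of_real (theta q w) = theta (of_real q) (of_real w)"
    using assms by (subst theta_of_real) auto
  also have "\<dots> = exp (- LS ((of_real q)^2) ((of_real q)^2) - LS (- of_real q * of_real w) ((of_real
      q)^2)
        - LS (- of_real q / of_real w) ((of_real q)^2))"
    using w q by (intro jacobi_triple) (auto simp: norm_mult norm_divide abs_mult)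
  also have "\<dots> = exp (of_real (- LS (q^2) (q^2) - LS (- q * w) (q^2) - LS (- q / w) (q^2)))"
    using LS_of_real[of "q^2" "q^2"] LS_of_real[of "-q*w" "q^2"] LS_of_real[of "-q/w" "q^2"] q2 w
    by (simp add: abs_mult)
  also have "\<dots> = of_real (exp (- LS (q^2) (q^2) - LS (- q * w) (q^2) - LS (- q / w) (q^2)))"
    by (rule exp_of_real)
  finally show ?thesis by (simp only: of_real_eq_iff)
qed

subsection \<open>The amplitude and the Mahler measure\<close>

text \<open>In the notation of elliptic functions, the next three constants are \<open>k' / k\<close> for the nome \<open>q\<close>,
  the coefficients \<open>1 / cosh (n \<pi> y)\<close> for \<open>q = exp (- \<pi> y)\<close>, and the amplitude \<open>am (2 K z / \<pi>)\<close>.\<close>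

definition modulus_ratio :: "real \<Rightarrow> real" where
  "modulus_ratio q = theta q (-1) ^ 2 / (sqrt q * theta q q ^ 2)"

definition sech_coeff :: "real \<Rightarrow> nat \<Rightarrow> real" where
  "sech_coeff q n = 2 * q ^ n / (1 + q ^ (2 * n))"

definition amplitude :: "real \<Rightarrow> real \<Rightarrow> real" where
  "amplitude q z = z + (\<Sum>n. sech_coeff q n * sin (2 * real n * z) / real n)"

text \<open>Cosine coefficients of the logarithm of theta(q^2, w)^2 / theta(q, -w) at w = cis t,
  apart from the constant term. At n = 0 the value is 0, by division by zero.\<close>

definition log_coeff :: "real \<Rightarrow> nat \<Rightarrow> real" where
  "log_coeff q n = 2 * (q ^ n / (real n * (1 - (q^2) ^ n))) - 4 * ((- (q^2)) ^ n / (real n * (1 -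
      (q^4) ^ n)))"

context
  fixes q :: real
  assumes q: "0 < q" "q < 1"
begin

lemma nome_powers: "q^2 < 1" "q^3 < 1" "q^4 < 1" "q ^ k \<le> 1"
  using q by (auto simp: power_less_one_iff intro: power_le_one)

lemma LS_sums_cis:
  assumes a: "0 < a" "a < 1" and x: "0 < x" "x < 1" and e: "e = 1 \<or> e = -1"
  shows "(\<lambda>n. of_real ((e * a) ^ n / (real n * (1 - x ^ n))) * cis (real n * t)) sums
           LS (of_real (e * a) * cis t) (of_real x)"
proof -
  have "norm (complex_of_real (e * a) * cis t) < 1" "norm (complex_of_real x) < 1"
    using a x e by (auto simp: norm_mult abs_mult simp del: of_real_mult)
  from summable_sums[OF summable_LS[OF this]]
  have "(\<lambda>n. (of_real (e * a) * cis t) ^ n / (of_nat n * (1 - (complex_of_real x) ^ n))) sums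
          LS (of_real (e * a) * cis t) (of_real x)" by (simp add: LS_def)
  moreover have "(of_real (e * a) * cis t) ^ n / (of_nat n * (1 - (complex_of_real x) ^ n)) =
       of_real ((e * a) ^ n / (real n * (1 - x ^ n))) * cis (real n * t)" for n
    by (simp add: power_mult_distrib Complex.DeMoivre)
  ultimately show ?thesis by (simp only:)
qed

lemma norm_nome_mult_cis:
  "norm (complex_of_real q * cis t) < 1" "norm (complex_of_real q / cis t) < 1"
  "norm ((complex_of_real q)^2 * cis t) < 1" "norm ((complex_of_real q)^2 / cis t) < 1"
  "norm ((complex_of_real q)^2 * (- complex_of_real q * cis t)) < 1"
  "norm ((complex_of_real q)^2 / (- complex_of_real q * cis t)) < 1"
proof -
  have "q^2 * q < 1" "q^2 / q < 1"
    using nome_powers(2) q by (simp_all add: power2_eq_square power3_eq_cube)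
  then show "norm (complex_of_real q * cis t) < 1" "norm (complex_of_real q / cis t) < 1"
    "norm ((complex_of_real q)^2 * cis t) < 1" "norm ((complex_of_real q)^2 / cis t) < 1"
    "norm ((complex_of_real q)^2 * (- complex_of_real q * cis t)) < 1"
    "norm ((complex_of_real q)^2 / (- complex_of_real q * cis t)) < 1"
    using q nome_powers by (auto simp: norm_mult norm_divide norm_power)
qed

lemma theta_eq_exp_amplitude:
  "theta ((complex_of_real q)^2) (- of_real q * cis t) =
     exp (- LS (of_real (q^4)) (of_real (q^4)) - LS (of_real (q^3) * cis t) (of_real (q^4))
          - LS (of_real q * cis (-t)) (of_real (q^4)))"
proof -
  have "theta ((complex_of_real q)^2) (- of_real q * cis t) =
     exp (- LS (((complex_of_real q)^2)^2) (((complex_of_real q)^2)^2)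
          - LS (- ((complex_of_real q)^2) * (- of_real q * cis t)) (((complex_of_real q)^2)^2)
          - LS (- ((complex_of_real q)^2) / (- of_real q * cis t)) (((complex_of_real q)^2)^2))"
    by (rule jacobi_triple) (use q nome_powers norm_nome_mult_cis[of t] in \<open>auto simp: norm_power\<close>)
  also have "((complex_of_real q)^2)^2 = of_real (q^4)" by simp
  also have "- ((complex_of_real q)^2) * (- of_real q * cis t) = of_real (q^3) * cis t"
    by (simp add: power2_eq_square power3_eq_cube)
  also have "- ((complex_of_real q)^2) / (- of_real q * cis t) = of_real q * cis (-t)"
    using q by (simp add: power2_eq_square cis_inverse[symmetric] field_simps)
  finally show ?thesis .
qed

text \<open>The logarithm of the theta quotient is a difference of complex conjugate Lambert series,
  hence purely imaginary; by (X - X^3) / (1 - X^4) = X / (1 + X^2) with X = q^n its terms are those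
  of \<open>amplitude q z - z\<close>.\<close>

lemma cis_amplitude:
  "cis (amplitude q z) * theta ((complex_of_real q)^2) (- of_real q / cis (2*z)) =
   cis z * theta ((complex_of_real q)^2) (- of_real q * cis (2*z))"
proof -
  let ?t = "2 * z"
  have q3: "0 < q^3" "q^3 < 1" "0 < q^4" "q^4 < 1" using q nome_powers by auto
  let ?g = "\<lambda>a n. complex_of_real (a ^ n / (real n * (1 - (q^4) ^ n)))"
  note S = LS_sums_cis[where e = 1, simplified, unfolded of_real_power[symmetric]
      of_real_mult[symmetric] mult_1]
  have "(\<lambda>n. ?g q n * cis (real n * ?t) - ?g q n * cis (real n * - ?t) +
         (?g (q^3) n * cis (real n * - ?t) - ?g (q^3) n * cis (real n * ?t))) sums
    (LS (of_real q * cis ?t) (of_real (q^4)) - LS (of_real q * cis (-?t)) (of_real (q^4)) +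
     (LS (of_real (q^3) * cis (-?t)) (of_real (q^4)) - LS (of_real (q^3) * cis ?t) (of_real
         (q^4))))"
    (is "_ sums ?D")
    by (intro sums_add sums_diff LS_sums_cis[where e = 1, unfolded mult_1] q q3) auto
  moreover have "?g q n * cis (real n * ?t) - ?g q n * cis (real n * - ?t) +
         (?g (q^3) n * cis (real n * - ?t) - ?g (q^3) n * cis (real n * ?t)) =
         \<i> * of_real (sech_coeff q n * sin (2 * real n * z) / real n)" for n
  proof (cases "n = 0")
    case False
    define X where "X = q ^ n"
    have X: "0 < X" "X < 1" using q False by (auto simp: X_def power_less_one_iff)
    have e: "(q^4)^n = X^4" "(q^3)^n = X^3" "q^(2*n) = X^2"
      by (simp_all add: X_def mult.commute flip: power_mult)
    have "X^4 < 1" using X by (simp add: power_less_one_iff)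
    moreover have "1 + X^2 \<noteq> 0" using zero_le_power2[of X] by linarith
    ultimately have "(X - X^3) / (1 - X^4) = X / (1 + X^2)"
      using X by (simp add: frac_eq_eq) (simp add: algebra_simps power2_eq_square power3_eq_cube
          power4_eq_xxxx)
    then have *: "X / (real n * (1 - X^4)) - X^3 / (real n * (1 - X^4)) = X / (1 + X^2) / real n"
    proof -
      assume "(X - X^3) / (1 - X^4) = X / (1 + X^2)"
      have "X / (real n * (1 - X^4)) - X^3 / (real n * (1 - X^4)) = (X - X^3) / (1 - X^4) / real n"
        by (simp add: diff_divide_distrib mult.commute)
      then show ?thesis by (simp only: \<open>(X - X^3) / (1 - X^4) = X / (1 + X^2)\<close>)
    qed
    have "2 * sin (real n * ?t) * (X / (real n * (1 - X^4)) - X^3 / (real n * (1 - X^4))) =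
         sech_coeff q n * sin (2 * real n * z) / real n"
      unfolding * sech_coeff_def e X_def[symmetric] by (simp add: mult_ac)
    then show ?thesis
      unfolding e X_def[symmetric] by (simp add: complex_eq_iff algebra_simps)
  qed (simp add: sech_coeff_def)
  ultimately have *: "(\<lambda>n. \<i> * of_real (sech_coeff q n * sin (2 * real n * z) / real n)) sums ?D"
    by simp
  then have "(\<lambda>n. Im (\<i> * of_real (sech_coeff q n * sin (2 * real n * z) / real n))) sums Im ?D"
    by (rule sums_Im)
  then have s: "(\<lambda>n. sech_coeff q n * sin (2 * real n * z) / real n) sums Im ?D" by simp
  have "(\<lambda>n. Re (\<i> * of_real (sech_coeff q n * sin (2 * real n * z) / real n))) sums Re ?D"
    using * by (rule sums_Re)
  then have "(\<lambda>n. 0::real) sums Re ?D" by simp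
  then have "Re ?D = 0" using sums_unique[of "\<lambda>n. 0::real"] by simp
  then have D: "?D = \<i> * of_real (amplitude q z - z)"
    using sums_unique[OF s] by (simp add: complex_eq_iff amplitude_def)
  have "theta ((complex_of_real q)^2) (- of_real q * cis ?t) =
      exp ?D * theta ((complex_of_real q)^2) (- of_real q * cis (- ?t))"
    unfolding theta_eq_exp_amplitude exp_add[symmetric] by (rule arg_cong[where f =
        exp]) (simp add: algebra_simps)
  also have "- of_real q * cis (- ?t) = - of_real q / cis ?t"
    by (simp add: cis_inverse[symmetric] field_simps)
  also have "exp ?D = cis (amplitude q z) / cis z"
    unfolding D cis_conv_exp[symmetric] by (simp add: cis_divide)
  finally show ?thesis by simp
qed

lemma norm_log_coeff: "\<bar>log_coeff q n\<bar> \<le> 6 / (1 - q) * q ^ n"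
proof -
  have q': "norm (q^2) < 1" "norm (q^4) < 1" "norm (1::real) \<le> 1"
    using nome_powers by auto
  have mono: "1 - q \<le> 1 - q^2" "1 - q \<le> 1 - q^4" "q^2 \<le> q"
    using q power_decreasing[of 1 2 q] power_decreasing[of 1 4 q] by auto
  have "\<bar>q ^ n / (real n * (1 - (q^2) ^ n))\<bar> \<le> 1 / (1 - q^2) * q ^ n"
    using norm_LS_term[OF q'(1) q'(3), of q n] q by simp
  also have "\<dots> \<le> 1 / (1 - q) * q ^ n"
    using q mono by (intro mult_right_mono divide_left_mono) auto
  finally have 1: "\<bar>q ^ n / (real n * (1 - (q^2) ^ n))\<bar> \<le> 1 / (1 - q) * q ^ n" .
  have "\<bar>(- (q^2)) ^ n / (real n * (1 - (q^4) ^ n))\<bar> \<le> 1 / (1 - q^4) * (q^2) ^ n"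
    using norm_LS_term[OF q'(2) q'(3), of "-(q^2)" n] q by simp
  also have "\<dots> \<le> 1 / (1 - q) * q ^ n"
    using q mono nome_powers by (intro mult_mono divide_left_mono power_mono) auto
  finally have 2: "\<bar>(- (q^2)) ^ n / (real n * (1 - (q^4) ^ n))\<bar> \<le> 1 / (1 - q) * q ^ n" .
  have "\<bar>log_coeff q n\<bar> \<le> 2 * \<bar>q ^ n / (real n * (1 - (q^2) ^ n))\<bar> + 4 * \<bar>(- (q^2)) ^ n / (real n *
      (1 - (q^4) ^ n))\<bar>"
    unfolding log_coeff_def by (rule order.trans[OF abs_triangle_ineq4]) (simp add: abs_mult)
  also have "\<dots> \<le> 2 * (1 / (1 - q) * q ^ n) + 4 * (1 / (1 - q) * q ^ n)"
    using 1 2 by (intro add_mono mult_left_mono) auto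
  also have "\<dots> = 6 / (1 - q) * q ^ n" by (simp add: field_simps)
  finally show ?thesis .
qed

lemma summable_log_coeff:
  assumes "\<And>n. \<bar>g n\<bar> \<le> B"
  shows "summable (\<lambda>n. log_coeff q n * g n)"
proof (rule summable_comparison_test'[where N = 0])
  show "summable (\<lambda>n. 6 / (1 - q) * B * q ^ n)"
    using q by (intro summable_mult summable_geometric) auto
  show "norm (log_coeff q n * g n) \<le> 6 / (1 - q) * B * q ^ n" for n
    using mult_mono[OF norm_log_coeff[of n] assms[of n]] q by (simp add: abs_mult mult_ac)
qed

lemma LS_sum_eq_log_coeff:
  "LS (of_real q * cis t) (of_real (q^2)) + LS (of_real q * cis (-t)) (of_real (q^2))
     - 2 * (LS (of_real (- (q^2)) * cis t) (of_real (q^4)) + LS (of_real (- (q^2)) * cis (-t))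
         (of_real (q^4)))
   = of_real (\<Sum>n. log_coeff q n * cos (real n * t))"
proof -
  have q2: "0 < q^2" "q^2 < 1" "0 < q^4" "q^4 < 1" using q nome_powers by auto
  let ?g = "\<lambda>n. complex_of_real (q ^ n / (real n * (1 - (q^2) ^ n)))"
  let ?h = "\<lambda>n. complex_of_real ((- (q^2)) ^ n / (real n * (1 - (q^4) ^ n)))"
  have "(\<lambda>n. ?g n * cis (real n * t) + ?g n * cis (real n * - t) -
        2 * (?h n * cis (real n * t) + ?h n * cis (real n * - t))) sums
     (LS (of_real q * cis t) (of_real (q^2)) + LS (of_real q * cis (-t)) (of_real (q^2))
     - 2 * (LS (of_real (- (q^2)) * cis t) (of_real (q^4)) + LS (of_real (- (q^2)) * cis (-t))
         (of_real (q^4))))"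
    using q q2 by (intro sums_add sums_diff sums_mult LS_sums_cis[where e = 1, unfolded mult_1]
       LS_sums_cis[where e = "-1", unfolded mult_minus1]) auto
  moreover have "?g n * cis (real n * t) + ?g n * cis (real n * - t) -
        2 * (?h n * cis (real n * t) + ?h n * cis (real n * - t)) =
            of_real (log_coeff q n * cos (real n * t))" for n
    by (simp add: complex_eq_iff log_coeff_def algebra_simps)
  moreover have "(\<lambda>n. complex_of_real (log_coeff q n * cos (real n * t))) sums of_real (\<Sum>n.
      log_coeff q n * cos (real n * t))"
    by (intro sums_of_real summable_sums summable_log_coeff[where B = 1]) auto
  ultimately show ?thesis by (simp add: sums_unique2)
qed

text \<open>The triple product gives the identity up to a factor independent of t. The factor is
  evaluated at t = pi, where \<open>theta_one_mult_minus_one\<close> applies; this is why (-1)^n =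
  cos (n pi) is subtracted from the cosines.\<close>

lemma theta_square_eq_exp:
  "theta ((complex_of_real q)^2) (cis t) ^ 2 = theta (of_real q) (-1) *
     exp (of_real (\<Sum>n. log_coeff q n * (cos (real n * t) - (-1) ^ n))) * theta (of_real q) (- cis
         t)"
proof -
  let ?Q = "complex_of_real q"
  have norm: "norm ?Q < 1" "norm (?Q^2) < 1" "?Q \<noteq> 0" "norm (-1 :: complex) = 1"
    using q nome_powers by (auto simp: norm_power)
  define C where "C = exp (LS (of_real (q^2)) (of_real (q^2)) - 2 * LS (complex_of_real (q^4))
      (of_real (q^4)))"
  define E where "E = (\<lambda>t. complex_of_real (\<Sum>n. log_coeff q n * cos (real n * t)))"
  have main: "theta (?Q^2) (cis t) ^ 2 = C * exp (E t) * theta ?Q (- cis t)" for t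
  proof -
    have "theta (?Q^2) (cis t) = exp (- LS ((?Q^2)^2) ((?Q^2)^2) - LS (- (?Q^2) * cis t) ((?Q^2)^2)
        - LS (- (?Q^2) / cis t) ((?Q^2)^2))"
      by (rule jacobi_triple) (use norm norm_nome_mult_cis[of t] in auto)
    also have "(?Q^2)^2 = of_real (q^4)" by simp
    also have "- (?Q^2) * cis t = of_real (- (q^2)) * cis t" by simp
    also have "- (?Q^2) / cis t = of_real (- (q^2)) * cis (-t)"
      by (simp add: cis_inverse[symmetric] field_simps)
    finally have 1: "theta (?Q^2) (cis t) = exp (- LS (of_real (q^4)) (of_real (q^4)) - LS (of_real
        (- (q^2)) * cis t) (of_real (q^4))
          - LS (of_real (- (q^2)) * cis (-t)) (of_real (q^4)))" .
    have "theta ?Q (- cis t) = exp (- LS (?Q^2) (?Q^2) - LS (- ?Q * (- cis t)) (?Q^2) - LS (- ?Q /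
        (- cis t)) (?Q^2))"
      by (rule jacobi_triple) (use norm norm_nome_mult_cis[of t] in \<open>auto\<close>)
    also have "?Q^2 = of_real (q^2)" by simp
    also have "- ?Q * (- cis t) = of_real q * cis t" by simp
    also have "- ?Q / (- cis t) = of_real q * cis (-t)"
        by (simp add: cis_inverse[symmetric] field_simps)
    finally have 2: "theta ?Q (- cis t) = exp (- LS (of_real (q^2)) (of_real (q^2)) - LS (of_real q
        * cis t) (of_real (q^2))
          - LS (of_real q * cis (-t)) (of_real (q^2)))" .
    have "C * exp (E t) * theta ?Q (- cis t) = exp (2 * (- LS (of_real (q^4)) (of_real (q^4)) - LS
        (of_real (- (q^2)) * cis t) (of_real (q^4))
          - LS (of_real (- (q^2)) * cis (-t)) (of_real (q^4))))"
      unfolding 2 C_def E_def LS_sum_eq_log_coeff[symmetric] exp_add[symmetric]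
      by (rule arg_cong[where f = exp]) (simp add: algebra_simps)
    then show ?thesis by (simp only: 1 exp_double)
  qed
  have pos: "theta q 1 > 0" by (rule theta_pos) (use q in auto)
  then have t1: "theta ?Q 1 \<noteq> 0"
    using theta_of_real[of q 1] q by simp
  have "cis pi = -1" by simp
  then have "C * exp (E pi) * theta ?Q 1 = theta ?Q (-1) * theta ?Q 1"
    using main[of pi] theta_one_mult_minus_one[OF norm(3,1)] by (auto simp: mult.commute)
  then have "C * exp (E pi) = theta ?Q (-1)" using t1 by simp
  then have C: "C = theta ?Q (-1) * exp (- E pi)" by (simp add: exp_minus field_simps)
  have E: "E t - E pi = of_real (\<Sum>n. log_coeff q n * (cos (real n * t) - (-1) ^ n))"
    unfolding E_def of_real_diff[symmetric]
    by (subst suminf_diff) (auto intro!: summable_log_coeff[where B =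
        1] simp: algebra_simps cos_npi2)
  show ?thesis unfolding main[of t] C E[symmetric] by (simp add: exp_diff exp_minus field_simps)
qed

end

section \<open>Fourier series of the integrand along the amplitude\<close>

lemma has_integral_suminf:
  fixes f :: "nat \<Rightarrow> real \<Rightarrow> real"
  assumes int: "\<And>n. (f n has_integral I n) {a..b}" and cont: "\<And>n. continuous_on {a..b} (f n)"
    and bound: "\<And>n x. x \<in> {a..b} \<Longrightarrow> \<bar>f n x\<bar> \<le> M n" and M: "summable M"
  shows "((\<lambda>x. \<Sum>n. f n x) has_integral (\<Sum>n. I n)) {a..b}"
proof -
  have u: "uniform_limit {a..b} (\<lambda>n x. \<Sum>i<n. f i x) (\<lambda>x. \<Sum>n. f n x) sequentially"
    by (rule Weierstrass_m_test[OF _ M]) (use bound in auto)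
  have "continuous_on {a..b} (\<lambda>x. \<Sum>i<n. f i x)" for n
    by (intro continuous_intros cont)
  from uniform_limit_integral[OF u this trivial_limit_sequentially]
  obtain I' J where J: "\<And>n. ((\<lambda>x. \<Sum>i<n. f i x) has_integral I' n) {a..b}"
    "((\<lambda>x. \<Sum>n. f n x) has_integral J) {a..b}" "I' \<longlonglongrightarrow> J"
    by blast
  have "((\<lambda>x. \<Sum>i<n. f i x) has_integral (\<Sum>i<n. I i)) {a..b}" for n
    by (intro has_integral_sum int) auto
  then have "I' n = (\<Sum>i<n. I i)" for n using J(1) by (blast intro: has_integral_unique)
  then have "I sums J" using J(3) unfolding sums_def by presburger
  then show ?thesis using J(2) sums_unique by blast
qed

text \<open>Terms of the Fourier series of dn, up to scale. At n = 0 the series for the amplitude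
  has the term 0 (division by zero), whereas the general formula would give 2.\<close>

definition amplitude_deriv :: "real \<Rightarrow> nat \<Rightarrow> real \<Rightarrow> real" where
  "amplitude_deriv q n z = (if n = 0 then 0 else 2 * sech_coeff q n * cos (2 * real n * z))"

context
  fixes q :: real
  assumes q: "0 < q" "q < 1"
begin

lemma theta_minus_one_pos: "theta q (-1) > 0"
  using q theta_eq_exp_real[of q "-1"] by simp

lemma theta_q_pos: "theta q q > 0"
  using q by (intro theta_pos) auto

lemma modulus_ratio_pos: "modulus_ratio q > 0"
  unfolding modulus_ratio_def using theta_minus_one_pos theta_q_pos q by simp

text \<open>The theta quotient for cn, obtained by adding cis (amplitude q z) and its inverse;
  squared, it involves only cis (2 z). The denominator does not vanish because it divides a product
  of two theta values that are exponentials.\<close>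

lemma cos_amplitude_square:
  "(complex_of_real (cos (amplitude q z)))^2 = cis (2*z) * (theta (of_real q) (-1) * theta (of_real
      q) (of_real q * cis (2*z)) /
     (theta (of_real q) (of_real q) * theta (of_real q) (- cis (2*z))))^2"
  "theta (complex_of_real q) (- cis (2*z)) \<noteq> 0"
proof -
  let ?Q = "complex_of_real q" and ?w = "cis (2*z)" and ?v = "cis z"
  have Q: "?Q \<noteq> 0" "norm ?Q < 1" using q by auto
  define f f' where "f = theta (?Q^2) (- ?Q * ?w)" "f' = theta (?Q^2) (- ?Q / ?w)"
  have "- ?Q / ?w = - ?Q * cis (- (2*z))" by (simp add: cis_inverse[symmetric] field_simps)
  then have nz: "f \<noteq> 0" "f' \<noteq> 0"
    using theta_eq_exp_amplitude[OF q, of "2*z"] theta_eq_exp_amplitude[OF q, of "-(2*z)"]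
    by (simp_all only: f_f'_def exp_not_eq_zero not_False_eq_True)
  define P t2 t4 D where "P = theta ?Q (?Q * ?w)" "t2 = theta ?Q ?Q" "t4 = theta ?Q (-1)" "D =
      theta ?Q (- ?w)"
  have L3: "t2 * D = 2 * f * f'"
    using theta_mult_q[OF Q, of ?w] by (simp add: f_f'_def P_t2_t4_D_def)
  have L4: "f^2 + f'^2 / ?w = t4 * P"
    using theta_square_add[OF Q, of ?w] by (simp add: f_f'_def P_t2_t4_D_def)
  have nz': "t2 \<noteq> 0" "D \<noteq> 0" using L3 nz by auto
  then show "theta ?Q (- ?w) \<noteq> 0" by (simp add: P_t2_t4_D_def)
  have c: "cis (amplitude q z) * f' = ?v * f"
    using cis_amplitude[OF q, of z] by (simp add: f_f'_def)
  have w: "?w = ?v^2" by (simp add: Complex.DeMoivre)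
  have "2 * complex_of_real (cos (amplitude q z)) = cis (amplitude q z) + inverse (cis (amplitude q
      z))"
    by (simp add: complex_eq_iff)
  also have "cis (amplitude q z) = ?v * f / f'" using c nz by (simp add: field_simps)
  also have "?v * f / f' + inverse (?v * f / f') = ?v * (f^2 + f'^2 / ?w) / (f * f')"
    unfolding w using nz by (simp add: field_simps power2_eq_square)
  also have "\<dots> = 2 * (?v * (t4 * P) / (t2 * D))" unfolding L3 L4 using nz by simp
  finally have "complex_of_real (cos (amplitude q z)) = ?v * (t4 * P) / (t2 * D)"
    by (rule mult_left_cancel[THEN iffD1, rotated]) simp
  then have "complex_of_real (cos (amplitude q z)) = ?v * (t4 * P / (t2 * D))"
      by (simp only: times_divide_eq_right)
  then have "(complex_of_real (cos (amplitude q z)))^2 = ?w * (t4 * P / (t2 * D))^2"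
    unfolding w by (simp only: power_mult_distrib)
  then show "(complex_of_real (cos (amplitude q z)))^2 =
      ?w * (theta ?Q (-1) * theta ?Q (?Q * ?w) / (theta ?Q ?Q * theta ?Q (- ?w)))^2"
    by (simp add: P_t2_t4_D_def)
qed

text \<open>The left-hand side is the positive root of \<open>x^2 - 4 k x = 4 (cos (amplitude q z))^2\<close>, and the
  addition formulas show that \<open>4 k \<theta>(q^2, w)^2 / (\<theta>(q, -1) \<theta>(q, -w))\<close> with \<open>w = cis (2 z)\<close> is a
  root as well.\<close>

lemma integrand_amplitude:
  defines "k \<equiv> modulus_ratio q"
  shows "2 * k + 2 * sqrt (k^2 + cos (amplitude q z) ^ 2) =
           exp (ln (4 * k) + (\<Sum>n. log_coeff q n * (cos (2 * real n * z) - (-1) ^ n)))"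
proof -
  let ?Q = "complex_of_real q" and ?w = "cis (2*z)" and ?v = "cis z"
  have Q: "?Q \<noteq> 0" "norm ?Q < 1" using q by auto
  define P t2 t4 D A B where defs: "P = theta ?Q (?Q * ?w)" "t2 = theta q q" "t4 =
      theta q (-1)" "D = theta ?Q (- ?w)"
     "A = theta (?Q^2) ?w" "B = theta (?Q^2) (?Q^2 * ?w)"
  have t: "theta ?Q ?Q = of_real t2" "theta ?Q (-1) = of_real t4"
    using theta_of_real[of q q] theta_of_real[of q "-1"] q by (auto simp: defs)
  have pos: "t2 > 0" "t4 > 0" "k > 0" using theta_minus_one_pos theta_q_pos modulus_ratio_pos
      by (auto simp: defs k_def)
  define R where "R = (\<Sum>n. log_coeff q n * (cos (2 * real n * z) - (-1) ^ n))"
  define h where "h = 4 * k * exp R"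
  have nzD: "D \<noteq> 0" using cos_amplitude_square(2) by (simp add: defs)
  have L1: "D * of_real t4 = A^2 - ?Q * ?w * B^2"
    using theta_minus_mult[OF Q, of ?w] t by (simp add: defs)
  have L2: "P * of_real t2 = 2 * B * A"
    using theta_q_mult[OF Q, of ?w] t by (simp add: defs)
  have R: "A^2 = of_real t4 * of_real (exp R) * D"
    using theta_square_eq_exp[OF q, of "2*z"] t by (simp add: defs R_def exp_of_real mult_ac)
  have C: "(complex_of_real (cos (amplitude q z)))^2 = ?w * (of_real t4 * P / (of_real t2 * D))^2"
    using cos_amplitude_square(1)[of z] t by (simp add: defs)
  have eR: "complex_of_real (exp R) = A^2 / (of_real t4 * D)" using R nzD pos
      by (simp add: field_simps)
  \<comment> \<open>Both exp R and exp R - 1 are theta quotients over t4 D, so h (h - 4 k) is a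
    multiple of (B A)^2 and thus of P^2.\<close>
  have eR1: "complex_of_real (exp R) - 1 = ?Q * ?w * B^2 / (of_real t4 * D)"
  proof -
    have "complex_of_real (exp R) - 1 = (A^2 - D * of_real t4) / (of_real t4 * D)"
      unfolding eR using nzD pos by (simp add: field_simps)
    then show ?thesis unfolding L1 by simp
  qed
  have k2: "k^2 * q = t4^4 / t2^4"
    using q pos by (simp add: k_def modulus_ratio_def defs power_divide power_mult_distrib flip:
        power_mult)
  have "complex_of_real (h * (h - 4 * k)) = 16 * of_real (k^2) * (of_real (exp R) * (of_real (exp
      R) - 1))"
    by (simp add: h_def algebra_simps power2_eq_square)
  also have "\<dots> = 16 * of_real (k^2) * (?Q * ?w * (2 * B * A)^2 / (4 * (of_real t4 * D)^2))"
    unfolding eR1 unfolding eR by (simp add: power2_eq_square mult_ac)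
  also have "\<dots> = 4 * of_real (k^2 * q) * ?w * P^2 * (of_real t2)^2 / ((of_real t4)^2 * D^2)"
    unfolding L2[symmetric] by (simp add: power_mult_distrib mult_ac)
  also have "\<dots> = 4 * (complex_of_real (cos (amplitude q z)))^2"
    unfolding k2 C using pos nzD by (simp add: field_simps power2_eq_square power4_eq_xxxx)
  also have "\<dots> = of_real (4 * cos (amplitude q z) ^ 2)" by simp
  finally have h: "h * (h - 4 * k) = 4 * cos (amplitude q z) ^ 2" by (simp only: of_real_eq_iff)
  have "h > 0" using pos by (simp add: h_def)
  moreover have "h * (h - 4 * k) \<ge> 0" unfolding h by simp
  \<comment> \<open>This excludes the other root of the quadratic equation.\<close>
  ultimately have "h - 4 * k \<ge> 0" by (simp add: zero_le_mult_iff)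
  then have ge: "(h - 2 * k) / 2 \<ge> 0" using pos by simp
  have "((h - 2 * k) / 2)^2 = k^2 + cos (amplitude q z) ^ 2"
    using h by (simp add: power2_eq_square algebra_simps)
  then have "sqrt (k^2 + cos (amplitude q z) ^ 2) = (h - 2 * k) / 2"
    using ge by (metis real_sqrt_abs abs_of_nonneg)
  then have "2 * k + 2 * sqrt (k^2 + cos (amplitude q z) ^ 2) = h" by simp
  also have "h = exp (ln (4 * k) + R)" using pos by (simp add: h_def exp_add)
  finally show ?thesis unfolding R_def .
qed

lemma sech_coeff_bound: "0 \<le> sech_coeff q n" "sech_coeff q n \<le> 2 * q ^ n"
proof -
  show "0 \<le> sech_coeff q n" using q by (simp add: sech_coeff_def add_pos_pos)
  have "2 * q ^ n / (1 + q ^ (2*n)) \<le> 2 * q ^ n / 1"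
    using q by (intro divide_left_mono) (auto simp: add_pos_pos)
  then show "sech_coeff q n \<le> 2 * q ^ n" by (simp add: sech_coeff_def)
qed

lemma amplitude_deriv_bound: "\<bar>amplitude_deriv q n z\<bar> \<le> 4 * q ^ n"
proof -
  have "2 * (sech_coeff q n * \<bar>cos (2 * real n * z)\<bar>) \<le> 2 * (2 * q ^ n * 1)"
    using sech_coeff_bound[of n] q by (intro mult_left_mono mult_mono) auto
  then show ?thesis using q sech_coeff_bound[of n] by (auto simp: amplitude_deriv_def abs_mult)
qed

lemma summable_geom: "summable (\<lambda>n. C * q ^ n)"
  using q by (intro summable_mult summable_geometric) auto

lemma has_field_derivative_amplitude:
  "(amplitude q has_field_derivative (1 + (\<Sum>n. amplitude_deriv q n z))) (at z)"
proof -
  have "((\<lambda>z. \<Sum>n. sech_coeff q n * sin (2 * real n * z) / real n) has_field_derivative (\<Sum>n.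
      amplitude_deriv q n z)) (at z)"
  proof (rule has_field_derivative_series'(2)[of UNIV _ _ 0])
    show "((\<lambda>z. sech_coeff q n * sin (2 * real n * z) / real n) has_field_derivative
        amplitude_deriv q n x) (at x)" for n x
      unfolding amplitude_deriv_def by (auto intro!: derivative_eq_intros)
    show "uniformly_convergent_on UNIV (\<lambda>n x. \<Sum>i<n. amplitude_deriv q i x)"
      by (rule Weierstrass_m_test'[OF _ summable_geom[of 4]]) (use amplitude_deriv_bound in auto)
  qed auto
  then show ?thesis unfolding amplitude_def[abs_def] by (auto intro!: derivative_eq_intros)
qed

lemma continuous_on_amplitude_deriv: "continuous_on S (amplitude_deriv q n)"
  unfolding amplitude_deriv_def[abs_def] by (cases "n = 0") (auto intro!: continuous_intros)

lemma has_integral_cos_mult: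
  "((\<lambda>z. cos (2 * real m * z) * cos (2 * real n * z)) has_integral
     (if m = n then (if n = 0 then pi else pi / 2) else 0)) {0..pi}"
proof -
  have c: "((\<lambda>z. cos (2 * of_int j * z)) has_integral (if j = 0 then pi else 0)) {0..pi}"
      for j :: int
  proof (cases "j = 0")
    case False
    have "((\<lambda>z. cos (2 * of_int j * z)) has_integral (sin (2 * of_int j * pi) / (2 * of_int j) -
        sin (2 * of_int j * 0) / (2 * of_int j))) {0..pi}"
      by (rule fundamental_theorem_of_calculus)
         (use False in \<open>auto intro!: derivative_eq_intros simp flip:
             has_real_derivative_iff_has_vector_derivative\<close>)
    moreover have "sin (2 * of_int j * pi) = 0"
      using sin_int_2pin[of j] by (simp add: mult_ac)
    ultimately show ?thesis using False by simp
  qed (use has_integral_const_real[of "1::real" 0 pi] in simp)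
  have "((\<lambda>z. (cos (2 * of_int (int m - int n) * z) + cos (2 * of_int (int m + int n) * z)) / 2)
      has_integral
     ((if int m - int n = 0 then pi else 0) + (if int m + int n = 0 then pi else 0)) / 2) {0..pi}"
    by (intro has_integral_divide has_integral_add c)
  moreover have "(cos (2 * of_int (int m - int n) * z) + cos (2 * of_int (int m + int n) * z)) / 2 =
       cos (2 * real m * z) * cos (2 * real n * z)" for z
    by (simp add: cos_times_cos algebra_simps)
  moreover have "int m + int n = 0 \<longleftrightarrow> m = 0 \<and> n = 0" by auto
  ultimately show ?thesis by (cases "m = n"; cases "n = 0") (auto split: if_splits)
qed

text \<open>Orthogonality leaves one term of the series. For m = 0 that term is absent and the
  constant 1 contributes pi, in agreement with \<open>sech_coeff q 0 = 1\<close>.\<close>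

lemma has_integral_cos_amplitude_deriv:
  "((\<lambda>z. cos (2 * real m * z) * (1 + (\<Sum>n. amplitude_deriv q n z))) has_integral pi * sech_coeff q
      m) {0..pi}"
proof -
  have "((\<lambda>z. \<Sum>n. cos (2 * real m * z) * amplitude_deriv q n z) has_integral
     (\<Sum>n. if n = m then (if m = 0 then 0 else pi * sech_coeff q m) else 0)) {0..pi}"
  proof (rule has_integral_suminf)
    show "((\<lambda>z. cos (2 * real m * z) * amplitude_deriv q n z) has_integral
        (if n = m then (if m = 0 then 0 else pi * sech_coeff q m) else 0)) {0..pi}" for n
    proof (cases "n = 0")
      case False
      have "((\<lambda>z. 2 * sech_coeff q n * (cos (2 * real m * z) * cos (2 * real n * z))) has_integral
         2 * sech_coeff q n * (if m = n then (if n = 0 then pi else pi / 2) else 0)) {0..pi}"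
        by (intro has_integral_mult_right has_integral_cos_mult)
      moreover have "2 * sech_coeff q n * (if m = n then (if n = 0 then pi else pi / 2) else 0) =
          (if n = m then (if m = 0 then 0 else pi * sech_coeff q m) else 0)"
        using False by auto
      ultimately show ?thesis using False by (simp add: amplitude_deriv_def mult_ac)
    qed (simp add: amplitude_deriv_def)
    show "continuous_on {0..pi} (\<lambda>z. cos (2 * real m * z) * amplitude_deriv q n z)" for n
      by (intro continuous_intros continuous_on_amplitude_deriv)
    show "\<bar>cos (2 * real m * z) * amplitude_deriv q n z\<bar> \<le> 4 * q ^ n" for n z
      using mult_mono[OF abs_cos_le_one[of "2 * real m * z"] amplitude_deriv_bound[of n z]] q
          by (simp add: abs_mult)
  qed (rule summable_geom)
  moreover have "(\<Sum>n. if n = m then (if m = 0 then 0 else pi * sech_coeff q m) else 0) = (if m =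
      0 then 0 else pi * sech_coeff q m)"
    using sums_single[of m "\<lambda>_. if m = 0 then 0 else pi * sech_coeff q m"] sums_unique by fastforce
  ultimately have 1: "((\<lambda>z. \<Sum>n. cos (2 * real m * z) * amplitude_deriv q n z) has_integral
     (if m = 0 then 0 else pi * sech_coeff q m)) {0..pi}" by simp
  have s: "summable (\<lambda>n. amplitude_deriv q n z)" for z
    by (rule summable_comparison_test'[OF summable_geom[of 4], of 0]) (use amplitude_deriv_bound in
        auto)
  have "((\<lambda>z. cos (2 * real m * z) * cos (2 * real 0 * z) + (\<Sum>n. cos (2 * real m * z) *
      amplitude_deriv q n z)) has_integral
     ((if m = 0 then (if (0::nat) = 0 then pi else pi / 2) else 0) + (if m =
         0 then 0 else pi * sech_coeff q m))) {0..pi}"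
    by (intro has_integral_add 1 has_integral_cos_mult)
  moreover have "sech_coeff q 0 = 1" by (simp add: sech_coeff_def)
  ultimately show ?thesis
    by (auto simp: suminf_mult[OF s] distrib_left split: if_splits)
qed

lemma abs_amplitude_deriv_suminf: "\<bar>1 + (\<Sum>n. amplitude_deriv q n z)\<bar> \<le> 1 + 4 / (1 - q)"
proof -
  have "\<bar>\<Sum>n. amplitude_deriv q n z\<bar> \<le> (\<Sum>n. 4 * q ^ n)"
    using norm_suminf_le[of "\<lambda>n. amplitude_deriv q n z" "\<lambda>n. 4 * q ^ n"] amplitude_deriv_bound
        summable_geom[of 4] q by simp
  also have "\<dots> = 4 / (1 - q)"
    using q by (simp add: suminf_mult[OF summable_geometric] suminf_geometric)
  finally show ?thesis by linarith
qed

theorem integral_ln_modulus: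
  defines "k \<equiv> modulus_ratio q"
  shows "integral {0..pi} (\<lambda>a. ln (2 * k + 2 * sqrt (k^2 + cos a ^ 2))) =
           pi * (ln (4 * k) + (\<Sum>n. log_coeff q n * (sech_coeff q n - (-1) ^ n)))"
proof -
  let ?G = "\<lambda>a. ln (2 * k + 2 * sqrt (k^2 + cos a ^ 2))" and ?g =
      "\<lambda>z. 1 + (\<Sum>n. amplitude_deriv q n z)"
  have k: "k > 0" unfolding k_def by (rule modulus_ratio_pos)
  have contG: "continuous_on S ?G" for S
    using k by (intro continuous_intros) (auto intro!: add_pos_nonneg simp: add_pos_nonneg
        less_imp_neq[symmetric])
  have "continuous_on {0..pi} (amplitude q)"
    by (rule DERIV_continuous_on) (rule has_field_derivative_at_within[OF
        has_field_derivative_amplitude])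
  then have "compact (amplitude q ` {0..pi})" by (rule compact_continuous_image) simp
  \<comment> \<open>A bound for the amplitude supplies the ambient interval that the substitution
    rule asks for.\<close>
  then obtain B where B: "\<And>y. y \<in> amplitude q ` {0..pi} \<Longrightarrow> norm y \<le> B"
    using compact_imp_bounded bounded_iff by metis
  have "sin (2 * real n * pi) = 0" for n by (metis mult.commute sin_npi2 mult.left_commute sin_npi
      of_nat_mult of_nat_numeral)
  then have ends: "amplitude q 0 = 0" "amplitude q pi = pi" by (simp_all add: amplitude_def)
  have "((\<lambda>z. ?g z *\<^sub>R ?G (amplitude q z)) has_integral integral {amplitude q 0..amplitude q pi}
      ?G) {0..pi}"
  proof (rule has_integral_substitution[where c = "-B" and d = B])
    show "amplitude q ` {0..pi} \<subseteq> {- B..B}" using B by force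
    show "(amplitude q has_real_derivative ?g x) (at x within {0..pi})" for x
      by (rule has_field_derivative_at_within[OF has_field_derivative_amplitude])
  qed (use contG ends in auto)
  then have "((\<lambda>z. ?g z * (ln (4 * k) + (\<Sum>n. log_coeff q n * (cos (2 * real n * z) - (-1) ^ n))))
      has_integral integral {0..pi} ?G) {0..pi}"
    unfolding ends using integrand_amplitude by (simp add: k_def)
  moreover have "((\<lambda>z. ?g z * (ln (4 * k) + (\<Sum>n. log_coeff q n * (cos (2 * real n * z) - (-1) ^
      n)))) has_integral
     (pi * ln (4 * k) + (\<Sum>n. pi * (log_coeff q n * (sech_coeff q n - (-1) ^ n))))) {0..pi}"
  proof -
    have I: "(?g has_integral pi) {0..pi}"
      using has_integral_cos_amplitude_deriv[of 0] by (simp add: sech_coeff_def)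
    have contg: "continuous_on {0..pi} ?g"
    proof -
      have "uniform_limit {0..pi} (\<lambda>n x. \<Sum>i<n. amplitude_deriv q i x) (\<lambda>x. \<Sum>n. amplitude_deriv q n
          x) sequentially"
        by (rule Weierstrass_m_test[OF _ summable_geom[of 4]]) (use amplitude_deriv_bound in auto)
      then have "continuous_on {0..pi} (\<lambda>x. \<Sum>n. amplitude_deriv q n x)"
        by (rule uniform_limit_theorem[rotated])
           (auto intro!: always_eventually continuous_intros continuous_on_amplitude_deriv)
      then show ?thesis by (intro continuous_intros)
    qed
    have "((\<lambda>z. \<Sum>n. log_coeff q n * (cos (2 * real n * z) * ?g z - (-1) ^ n * ?g z)) has_integral
        (\<Sum>n. log_coeff q n * (pi * sech_coeff q n - (-1) ^ n * pi))) {0..pi}"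
    proof (rule has_integral_suminf)
      show "((\<lambda>z. log_coeff q n * (cos (2 * real n * z) * ?g z - (-1) ^ n * ?g z)) has_integral
        log_coeff q n * (pi * sech_coeff q n - (-1) ^ n * pi)) {0..pi}" for n
        by (intro has_integral_mult_right has_integral_diff has_integral_cos_amplitude_deriv I)
      show "continuous_on {0..pi} (\<lambda>z. log_coeff q n * (cos (2 * real n * z) * ?g z - (-1) ^ n * ?g
          z))" for n
        by (intro continuous_intros contg)
      show "\<bar>log_coeff q n * (cos (2 * real n * z) * ?g z - (-1) ^ n * ?g z)\<bar> \<le>
          6 / (1 - q) * (2 * (1 + 4 / (1 - q))) * q ^ n" for n z
      proof -
        have "\<bar>cos (2 * real n * z) * ?g z - (-1) ^ n * ?g z\<bar> \<le>
            \<bar>cos (2 * real n * z)\<bar> * \<bar>?g z\<bar> + \<bar>?g z\<bar>"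
          by (rule order.trans[OF abs_triangle_ineq4]) (simp add: abs_mult power_abs)
        also have "\<dots> \<le> 1 * \<bar>?g z\<bar> + \<bar>?g z\<bar>" by (intro add_mono mult_right_mono) auto
        also have "\<dots> \<le> 2 * (1 + 4 / (1 - q))" using abs_amplitude_deriv_suminf[of z] by simp
        finally have "\<bar>log_coeff q n\<bar> * \<bar>cos (2 * real n * z) * ?g z - (-1) ^ n * ?g z\<bar> \<le>
            (6 / (1 - q) * q ^ n) * (2 * (1 + 4 / (1 - q)))"
          using norm_log_coeff[OF q, of n] by (intro mult_mono) (auto intro: order.trans[OF
              abs_ge_zero])
        then show ?thesis by (simp add: abs_mult mult_ac)
      qed
    qed (rule summable_geom)
    then have 2: "((\<lambda>z. \<Sum>n. log_coeff q n * (cos (2 * real n * z) * ?g z - (-1) ^ n * ?g z))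
        has_integral
        (\<Sum>n. pi * (log_coeff q n * (sech_coeff q n - (-1) ^ n)))) {0..pi}"
      by (simp add: algebra_simps)
    have "summable (\<lambda>n. log_coeff q n * (cos (2 * real n * z) - (-1) ^ n))" for z
      by (rule summable_log_coeff[OF q, where B = 2]) (rule order.trans[OF abs_triangle_ineq4],
          simp add: power_abs)
    then have "?g z * (\<Sum>n. log_coeff q n * (cos (2 * real n * z) - (-1) ^ n)) =
        (\<Sum>n. ?g z * (log_coeff q n * (cos (2 * real n * z) - (-1) ^ n)))" for z
      by (rule suminf_mult[symmetric])
    moreover have "g * (a * (b - c)) = a * (b * g - c * g)" for a b c g :: real
      by (simp add: algebra_simps)
    ultimately have "?g z * (\<Sum>n. log_coeff q n * (cos (2 * real n * z) - (-1) ^ n)) =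
        (\<Sum>n. log_coeff q n * (cos (2 * real n * z) * ?g z - (-1) ^ n * ?g z))" for z
      by (simp only:)
    then have "?g z * (ln (4 * k) + (\<Sum>n. log_coeff q n * (cos (2 * real n * z) - (-1) ^ n))) =
       ?g z * ln (4 * k) + (\<Sum>n. log_coeff q n * (cos (2 * real n * z) * ?g z - (-1) ^ n * ?g z))"
           for z
      by (simp only: distrib_left)
    then show ?thesis
      using has_integral_add[OF has_integral_mult_left[OF I, of "ln (4 * k)"] 2] by simp
  qed
  ultimately have "integral {0..pi} ?G = pi * ln (4 * k) + (\<Sum>n. pi * (log_coeff q n * (sech_coeff q
      n - (-1) ^ n)))"
    by (rule has_integral_unique)
  also have "(\<Sum>n. pi * (log_coeff q n * (sech_coeff q n - (-1) ^ n))) =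
      pi * (\<Sum>n. log_coeff q n * (sech_coeff q n - (-1) ^ n))"
  proof (intro suminf_mult summable_log_coeff[OF q])
    show "\<bar>sech_coeff q n - (-1) ^ n\<bar> \<le> 3" for n
    proof -
      have "q ^ n \<le> 1" using q by (simp add: power_le_one)
      then have "\<bar>sech_coeff q n\<bar> \<le> 2" using sech_coeff_bound[of n] by linarith
      then show ?thesis using abs_triangle_ineq4[of "sech_coeff q n" "(-1)^n"]
          by (simp add: power_abs)
    qed
  qed
  finally show ?thesis by (simp add: distrib_left)
qed

end

section \<open>Reduction of the double integral to a single angle\<close>

lemma integral_periodic_shift:
  fixes f :: "real \<Rightarrow> real"
  assumes cont: "continuous_on UNIV f" and per: "\<And>x. f (x + 1) = f x" and c: "0 \<le> c" "c \<le> 1"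
  shows "integral {0..1} (\<lambda>x. f (x + c)) = integral {0..1} f"
proof -
  have int: "f integrable_on {a..b}" for a b
    by (intro integrable_continuous_real continuous_on_subset[OF cont]) auto
  have "integral {0..1} (\<lambda>x. f (x + c)) = integral {c..1+c} f"
    using integral_shift_Icc_real[of 0 1 f c] by (simp add: o_def add.commute)
  also have "\<dots> = integral {c..1} f + integral {1..1+c} f"
    using c int by (intro Henstock_Kurzweil_Integration.integral_combine[symmetric]) auto
  also have "integral {1..1+c} f = integral {0..c} (\<lambda>x. f (x + 1))"
    using integral_shift_Icc_real[of 0 c f 1] by (simp add: o_def add.commute)
  also have "\<dots> = integral {0..c} f" by (simp add: per)
  also have "integral {c..1} f + integral {0..c} f = integral {0..1} f"
    using c int by (subst add.commute, intro Henstock_Kurzweil_Integration.integral_combine) auto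
  finally show ?thesis .
qed

text \<open>The integrand is 2 Re (ln (1 + z)) with z = r cis (4 pi s), and every term of the
  logarithm series has mean 0 over [0, 1].\<close>

lemma integral_ln_poisson_kernel:
  fixes r :: real
  assumes r: "\<bar>r\<bar> < 1"
  shows "((\<lambda>s. ln (1 + 2 * r * cos (4 * pi * s) + r^2)) has_integral 0) {0..1}"
proof -
  have sums: "(\<lambda>n. - 2 * ((- r) ^ n * cos (4 * pi * real n * s)) / real n) sums ln (1 + 2 * r * cos
      (4 * pi * s) + r^2)" for s
  proof -
    define z where "z = of_real r * cis (4 * pi * s)"
    have z: "norm z < 1" using r by (simp add: z_def norm_mult)
    then have nz: "1 + z \<noteq> 0" by (metis add.inverse_inverse add_eq_0_iff norm_minus_cancel norm_one
        order_less_irrefl)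
    have "(\<lambda>n. Re (- ((- z) ^ n) / of_nat n)) sums Re (ln (1 + z))"
      by (intro sums_Re Ln_series' z)
    moreover have "- z = of_real (- r) * cis (4 * pi * s)" by (simp add: z_def)
    then have "(- z) ^ n = of_real ((- r) ^ n) * cis (real n * (4 * pi * s))" for n
      by (simp only: power_mult_distrib of_real_power Complex.DeMoivre)
    ultimately have "(\<lambda>n. 2 * (- ((- r) ^ n * cos (real n * (4 * pi * s))) / real n)) sums (2 * Re
        (ln (1 + z)))"
      by (intro sums_mult) (simp add: Re_divide_of_nat)
    also have "2 * Re (ln (1 + z)) = ln ((norm (1 + z))^2)"
      using nz by (simp add: ln_realpow)
    also have "(norm (1 + z))^2 = (1 + r * cos (4 * pi * s))^2 + (r * sin (4 * pi * s))^2"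
      unfolding cmod_power2 by (simp add: z_def)
    also have "\<dots> = 1 + 2 * r * cos (4 * pi * s) + r^2 * ((cos (4 * pi * s))^2 + (sin (4 * pi *
        s))^2)"
      by (simp only: power2_eq_square distrib_left distrib_right) simp
    finally show ?thesis by (simp add: mult_ac)
  qed
  have "((\<lambda>s. \<Sum>n. - 2 * ((- r) ^ n * cos (4 * pi * real n * s)) / real n) has_integral (\<Sum>n::nat.
      0)) {0..1}"
  proof (rule has_integral_suminf)
    show "((\<lambda>s. - 2 * ((- r) ^ n * cos (4 * pi * real n * s)) / real n) has_integral 0) {0..1}"
        for n
    proof (cases "n = 0")
      case False
      let ?F = "\<lambda>s. - 2 * (- r) ^ n * sin (4 * pi * real n * s) / (4 * pi * (real n)^2)"
      have "((\<lambda>s. - 2 * ((- r) ^ n * cos (4 * pi * real n * s)) / real n) has_integral (?F 1 - ?F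
          0)) {0..1}"
        by (rule fundamental_theorem_of_calculus)
           (use False in \<open>auto intro!: derivative_eq_intros simp: power2_eq_square simp flip:
               has_real_derivative_iff_has_vector_derivative\<close>)
      moreover have "sin (4 * pi * real n) = 0"
        using sin_npi[of "4 * n"] by (simp add: mult_ac)
      ultimately show ?thesis by simp
    qed simp
    show "continuous_on {0..1} (\<lambda>s. - 2 * ((- r) ^ n * cos (4 * pi * real n * s)) / real n)" for n
      by (cases "n = 0") (auto intro!: continuous_intros)
    show "\<bar>- 2 * ((- r) ^ n * cos (4 * pi * real n * s)) / real n\<bar> \<le> 2 * \<bar>r\<bar> ^ n" for n s
    proof (cases "n = 0")
      case False
      have "2 * (\<bar>r\<bar> ^ n * \<bar>cos (4 * pi * real n * s)\<bar>) / real n \<le> 2 * (\<bar>r\<bar> ^ n * 1) / 1"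
        using False by (intro frac_le mult_left_mono) auto
      then show ?thesis by (simp add: abs_mult power_abs)
    qed simp
  qed (use r in \<open>intro summable_mult summable_geometric, auto\<close>)
  then show ?thesis by (simp only: sums_unique[OF sums, symmetric] suminf_zero)
qed

text \<open>Replacing t by t + s turns the sum of cosines into 4 cos (pi t) cos (2 pi s + pi t). For
  fixed t the mean over s is of Jensen type, and K > 0 keeps the logarithm continuous, which
  justifies exchanging the integrals.\<close>

lemma mahler_m_imaginary:
  assumes K: "K > 0"
  shows "mahler_m (\<i> * of_real K) = integral {0..pi} (\<lambda>a. ln ((K + sqrt (K^2 + 16 * cos a ^ 2)) /
      2)) / pi"
proof -
  define F where "F = (\<lambda>x::real. ln (sqrt (K^2 + x^2)))"
  have pos: "0 < K^2 + x^2" for x using K by (intro add_pos_nonneg) auto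
  have contF: "continuous_on UNIV F"
    unfolding F_def using pos by (intro continuous_intros) (auto simp: less_imp_neq[symmetric])
  have cF: "continuous_on S (\<lambda>x. F (g x))" if "continuous_on S g"
      for S :: "'b::topological_space set" and g
    by (rule continuous_on_compose2[OF contF that]) auto
  define G where "G = (\<lambda>a. ln ((K + sqrt (K^2 + 16 * cos a ^ 2)) / 2))"
  have nrm: "ln (norm (\<i> * of_real K + of_real x + of_real y)) = F (x + y)" for x y
    by (simp add: F_def cmod_def add.commute)
  have "mahler_m (\<i> * of_real K) = integral {0..1} (\<lambda>s. integral {0..1} (\<lambda>t. F (2 * cos (2 * pi *
      s) + 2 * cos (2 * pi * t))))"
    unfolding mahler_m_eq nrm ..
  also have "\<dots> = integral {0..1} (\<lambda>s. integral {0..1} (\<lambda>t. F (4 * cos (pi * t) * cos (2 * pi * s +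
      pi * t))))"
  proof (rule integral_cong)
    fix s :: real assume s: "s \<in> {0..1}"
    have 1: "integral {0..1} (\<lambda>t. F (2 * cos (2 * pi * s) + 2 * cos (2 * pi * t))) =
          integral {0..1} (\<lambda>t. F (2 * cos (2 * pi * s) + 2 * cos (2 * pi * (t + s))))"
    proof (rule integral_periodic_shift[symmetric])
      show "F (2 * cos (2 * pi * s) + 2 * cos (2 * pi * (x + 1))) =
          F (2 * cos (2 * pi * s) + 2 * cos (2 * pi * x))" for x
        by (simp add: distrib_left cos_add)
    qed (use s in \<open>auto intro!: cF continuous_intros\<close>)
    have 2: "2 * cos (2 * pi * s) + 2 * cos (2 * pi * (t + s)) =
        4 * cos (pi * t) * cos (2 * pi * s + pi * t)" for t
    proof -
      have "2 * pi * s = (2 * pi * s + pi * t) - pi * t" "2 * pi * (t + s) =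
          (2 * pi * s + pi * t) + pi * t"
        by (simp_all add: algebra_simps)
      then have "cos (2 * pi * s) = cos ((2 * pi * s + pi * t) - pi * t)"
        "cos (2 * pi * (t + s)) = cos ((2 * pi * s + pi * t) + pi * t)" by presburger+
      then show ?thesis
        by (simp only: cos_add[of "2 * pi * s + pi * t"] cos_diff[of "2 * pi * s + pi * t"]) (simp
            add: algebra_simps)
    qed
    show "integral {0..1} (\<lambda>t. F (2 * cos (2 * pi * s) + 2 * cos (2 * pi * t))) =
       integral {0..1} (\<lambda>t. F (4 * cos (pi * t) * cos (2 * pi * s + pi * t)))"
      unfolding 1 unfolding 2 ..
  qed
  also have "\<dots> = integral {0..1} (\<lambda>t. integral {0..1} (\<lambda>s. F (4 * cos (pi * t) * cos (2 * pi * s +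
      pi * t))))"
    using integral_swap_continuous[of 0 0 1 1 "\<lambda>s t. F (4 * cos (pi * t) * cos (2 * pi * s + pi *
        t))"]
    by (simp add: case_prod_unfold cF continuous_intros)
  also have "\<dots> = integral {0..1} (\<lambda>t. G (pi * t))"
  proof (rule integral_cong)
    fix t :: real assume t: "t \<in> {0..1}"
    define A where "A = 4 * cos (pi * t)"
    define R where "R = sqrt (K^2 + A^2)"
    \<comment> \<open>Chosen so that K^2 + (A cos (2 pi s))^2 factors as ((K + R) / 2)^2 times 1 + 2
      r cos (4 pi s) + r^2; K > 0 gives |r| < 1.\<close>
    define r where "r = (R - K) / (R + K)"
    have R2: "R^2 = K^2 + A^2" using pos[of A] by (simp add: R_def)
    have R: "R \<ge> K" using K by (simp add: R_def real_le_rsqrt)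
    then have r: "\<bar>r\<bar> < 1" using K by (simp add: r_def abs_div_pos)
    have "integral {0..1} (\<lambda>s. F (A * cos (2 * pi * s + pi * t))) =
        integral {0..1} (\<lambda>s. F (A * cos (2 * pi * (s + t/2))))"
      by (simp add: algebra_simps)
    also have "\<dots> = integral {0..1} (\<lambda>s. F (A * cos (2 * pi * s)))"
    proof (rule integral_periodic_shift)
      show "F (A * cos (2 * pi * (x + 1))) = F (A * cos (2 * pi * x))" for x
        by (simp add: distrib_left cos_add)
    qed (use t in \<open>auto intro!: cF continuous_intros\<close>)
    also have "(\<lambda>s. F (A * cos (2 * pi * s))) = (\<lambda>s. ln ((K + R) / 2) + ln (1 + 2 * r * cos (4 * pi
        * s) + r^2) / 2)"
    proof
      fix s
      define c where "c = cos (2 * pi * s)"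
      have c2: "cos (4 * pi * s) = 2 * c^2 - 1"
        using cos_double_cos[of "2 * pi * s"] by (simp add: c_def mult.assoc)
      define P where "P = 1 + 2 * r * cos (4 * pi * s) + r^2"
      have RK: "R + K > 0" using R K by simp
      have rK: "r * (K + R) = R - K" using RK by (simp add: r_def add.commute)
      have "((K + R) / 2)^2 * P = ((K + R)^2 + 2 * (r * (K + R)) * (K + R) * (2 * c^2 - 1) + (r *
          (K + R))^2) / 4"
        unfolding P_def c2 by (simp add: field_simps power2_eq_square)
      also have "\<dots> = ((K + R)^2 + 2 * (R - K) * (K + R) * (2 * c^2 - 1) + (R - K)^2) / 4"
        unfolding rK ..
      also have "\<dots> = (R^2 + K^2 + (R^2 - K^2) * (2 * c^2 - 1)) / 2"
        by (simp add: field_simps power2_eq_square)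
      also have "\<dots> = K^2 + (A * c)^2"
        unfolding R2 by (simp add: field_simps power2_eq_square)
      finally have eq: "((K + R) / 2)^2 * P = K^2 + (A * c)^2" .
      then have "0 < ((K + R) / 2)^2 * P" using pos[of "A * c"] by simp
      then have P: "P > 0" by (simp add: zero_less_mult_iff)
      have "F (A * c) = ln (K^2 + (A * c)^2) / 2"
        unfolding F_def using pos[of "A * c"] by (simp add: ln_sqrt)
      also have "\<dots> = (ln (((K + R) / 2)^2) + ln P) / 2"
        unfolding eq[symmetric] using P RK by (subst ln_mult) auto
      also have "ln (((K + R) / 2)^2) = 2 * ln ((K + R) / 2)"
        using RK by (simp add: ln_realpow)
      finally show "F (A * cos (2 * pi * s)) = ln ((K + R) / 2) + ln (1 + 2 * r * cos (4 * pi * s)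
          + r^2) / 2"
        unfolding c_def P_def by (simp add: add_divide_distrib)
    qed
    also have "integral {0..1} \<dots> = ln ((K + R) / 2)"
      using has_integral_add[OF has_integral_const_real[of "ln ((K + R) / 2)" 0 1]
          has_integral_divide[OF integral_ln_poisson_kernel[OF r], of 2]]
      by (intro integral_unique) simp
    also have "\<dots> = G (pi * t)" by (simp add: G_def R_def A_def power_mult_distrib)
    finally show "integral {0..1} (\<lambda>s. F (4 * cos (pi * t) * cos (2 * pi * s + pi * t))) =
        G (pi * t)"
      by (simp add: A_def)
  qed
  also have "\<dots> = integral {0..pi} G / pi"
  proof -
    have "sqrt (K^2 + 16 * cos a ^ 2) \<ge> 0" for a by simp
    then have "K + sqrt (K^2 + 16 * cos a ^ 2) \<noteq> 0" for a using K by (smt (verit))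
    then have "continuous_on {0..pi} G"
      unfolding G_def using K by (intro continuous_intros) auto
    then have "((\<lambda>t. pi *\<^sub>R G (pi * t)) has_integral (integral {pi * 0..pi * 1} G)) {0..1}"
      by (intro has_integral_substitution[where c = 0 and d =
          pi]) (auto intro!: derivative_eq_intros simp: mult_le_cancel_left1)
    then have "((\<lambda>t. (1 / pi) * (pi *\<^sub>R G (pi * t))) has_integral ((1 / pi) * integral {0..pi} G))
        {0..1}"
      by (intro has_integral_mult_right) simp
    then show ?thesis by (intro integral_unique) simp
  qed
  finally show ?thesis unfolding G_def .
qed

text \<open>On the reals the exponential is injective, so the product identity determines the
  Lambert series themselves.\<close>

lemma LS_split:
  fixes a x :: real
  assumes "\<bar>a\<bar> < 1" "\<bar>x\<bar> < 1"
  shows "LS a x = LS a (x^2) + LS (a * x) (x^2)"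
proof -
  have x: "\<bar>x^2\<bar> < 1" using assms by (simp add: abs_square_less_1)
  have ax: "\<bar>a * x\<bar> < 1" using assms mult_strict_mono[of "\<bar>a\<bar>" 1 "\<bar>x\<bar>" 1] by (simp add: abs_mult)
  have "exp (- LS (complex_of_real a) (of_real x)) = exp (- LS (complex_of_real a) ((of_real x)^2))
      * exp (- LS (complex_of_real a * of_real x) ((of_real x)^2))"
    by (rule exp_LS_split) (use assms in auto)
  then have "exp (complex_of_real (- LS a x)) = exp (of_real (- LS a (x^2) - LS (a * x) (x^2)))"
    using LS_of_real[OF assms] LS_of_real[OF assms(1) x] LS_of_real[OF ax x]
    by (simp add: mult_exp_exp)
  then have "exp (- LS a x) = exp (- LS a (x^2) - LS (a * x) (x^2))"
    by (simp only: exp_of_real of_real_eq_iff)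
  then show ?thesis by simp
qed

lemma LS_add_uminus:
  fixes a x :: real
  assumes "\<bar>a\<bar> < 1" "\<bar>x\<bar> < 1"
  shows "LS a x + LS (- a) x = LS (a^2) (x^2)"
proof -
  have sq: "\<bar>x^2\<bar> < 1" "\<bar>a^2\<bar> < 1" "\<bar>- a\<bar> < 1" using assms by (auto simp: abs_square_less_1)
  have "exp (- LS (complex_of_real a) (of_real x)) * exp (- LS (- complex_of_real a) (of_real x)) =
      exp (- LS ((complex_of_real a)^2) ((of_real x)^2))"
    by (rule exp_LS_mult_uminus) (use assms in auto)
  then have "exp (complex_of_real (- LS a x - LS (- a) x)) = exp (of_real (- LS (a^2) (x^2)))"
    using LS_of_real[OF assms] LS_of_real[OF sq(2,1)] LS_of_real[OF sq(3) assms(2)]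
    by (simp add: mult_exp_exp)
  then have "exp (- LS a x - LS (- a) x) = exp (- LS (a^2) (x^2))"
    by (simp only: exp_of_real of_real_eq_iff)
  then show ?thesis by simp
qed

context
  fixes q :: real
  assumes q: "0 < q" "q < 1"
begin

text \<open>With t2 t4 = 2 f^2 the quotient becomes (t4 / f)^4 / sqrt q, and t4 and f are known from
  the triple product. The right-hand side is the logarithm of q^(-1/2) times the product of (1 -
  q^(2n+1))^4 (1 - q^(4n+2))^4.\<close>

lemma ln_modulus_ratio:
  "ln (4 * modulus_ratio q) = - ln q / 2 - 4 * LS q (q^2) - 4 * LS (q^2) (q^4)"
proof -
  have p: "q^2 < 1" "q^3 < 1" "q^4 < 1" "\<bar>q\<bar> < 1" using q by (auto simp: power_less_one_iff)
  have p2: "q^2 * q < 1" "q^2 / q < 1" using p q by (simp_all add: power2_eq_square power3_eq_cube)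
  define t2 t4 f where "t2 = theta q q" "t4 = theta q (-1)" "f = theta (q^2) (- q)"
  have pos: "t2 > 0" "t4 > 0" using theta_minus_one_pos[OF q] theta_q_pos[OF q]
      by (auto simp: t2_t4_f_def)
  have t4: "t4 = exp (- LS (q^2) (q^2) - 2 * LS q (q^2))"
    unfolding t2_t4_f_def using q by (subst theta_eq_exp_real) auto
  have "f = exp (- LS ((q^2)^2) ((q^2)^2) - LS (- (q^2) * (- q)) ((q^2)^2) - LS (- (q^2) / (- q))
      ((q^2)^2))"
    unfolding t2_t4_f_def using q p p2 by (intro theta_eq_exp_real) auto
  also have "(q^2)^2 = q^4" by simp
  also have "- (q^2) * (- q) = q * q^2" by simp
  also have "- (q^2) / (- q) = q" using q by (simp add: power2_eq_square)
  finally have f: "f = exp (- LS (q^4) (q^4) - LS q (q^2))"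
    using LS_split[of q "q^2"] p by simp
  have "t2 * t4 = 2 * f * f"
    using theta_mult_q[of q 1] q by (simp add: t2_t4_f_def)
  then have "t2 = 2 * f^2 / t4" using pos by (simp add: field_simps power2_eq_square)
  then have "4 * modulus_ratio q = (t4 / f)^4 / sqrt q"
    using pos by (simp add: modulus_ratio_def flip: t2_t4_f_def) (simp add: field_simps
        power2_eq_square power4_eq_xxxx)
  also have "t4 / f = exp (- LS (q^2) (q^2) - 2 * LS q (q^2) - (- LS (q^4) (q^4) - LS q (q^2)))"
    unfolding t4 f by (rule exp_diff[symmetric])
  also have "- LS (q^2) (q^2) - 2 * LS q (q^2) - (- LS (q^4) (q^4) - LS q (q^2)) =
      - LS (q^2) (q^4) - LS q (q^2)"
    using LS_split[of "q^2" "q^2"] p by simp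
  finally have "4 * modulus_ratio q = exp (4 * (- LS (q^2) (q^4) - LS q (q^2))) / sqrt q"
    by (simp add: exp_of_nat_mult[symmetric])
  then show ?thesis using q by (simp add: ln_div ln_sqrt)
qed

theorem mahler_m_modulus_ratio:
  "mahler_m (\<i> * of_real (4 * modulus_ratio q)) =
     - ln q / 2 + (\<Sum>n. (-1) ^ n * (1 - q ^ (2*n)) / (1 + q ^ (2*n)) * sech_coeff q n / real n)"
proof -
  define k where "k = modulus_ratio q"
  have k: "k > 0" unfolding k_def by (rule modulus_ratio_pos[OF q])
  have p: "q^2 < 1" "q^4 < 1" "\<bar>q\<bar> < 1" using q by (auto simp: power_less_one_iff)
  have eq: "(4 * k + sqrt ((4 * k)^2 + 16 * cos a ^ 2)) / 2 =
      2 * k + 2 * sqrt (k^2 + cos a ^ 2)" for a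
  proof -
    have "sqrt ((4 * k)^2 + 16 * cos a ^ 2) = sqrt (4^2 * (k^2 + cos a ^ 2))"
      by (simp add: power_mult_distrib)
    also have "\<dots> = 4 * sqrt (k^2 + cos a ^ 2)"
      unfolding real_sqrt_mult real_sqrt_abs by simp
    finally show ?thesis by simp
  qed
  have "mahler_m (\<i> * of_real (4 * k)) = integral {0..pi} (\<lambda>a. ln (2 * k + 2 * sqrt (k^2 + cos a ^
      2))) / pi"
    using k mahler_m_imaginary[of "4 * k"] unfolding eq by simp
  also have "\<dots> = ln (4 * k) + (\<Sum>n. log_coeff q n * (sech_coeff q n - (-1) ^ n))"
    using integral_ln_modulus[OF q] by (simp add: k_def)
  also have "ln (4 * k) = - ln q / 2 - 4 * LS q (q^2) - 4 * LS (q^2) (q^4)"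
    unfolding k_def by (rule ln_modulus_ratio)
  also have "(\<Sum>n. log_coeff q n * (sech_coeff q n - (-1) ^ n)) =
     (\<Sum>n. (-1) ^ n * (1 - q ^ (2*n)) / (1 + q ^ (2*n)) * sech_coeff q n / real n) - 4 * LS (- q)
         (q^2) + 8 * LS (q^2) (q^4)"
  proof -
    let ?T = "\<lambda>n. (-1) ^ n * (1 - q ^ (2*n)) / (1 + q ^ (2*n)) * sech_coeff q n / real n"
    let ?c = "\<lambda>n. log_coeff q n * (sech_coeff q n - (-1) ^ n)"
    let ?V = "\<lambda>n. (- q) ^ n / (real n * (1 - (q^2) ^ n))"
    let ?W = "\<lambda>n. (q^2) ^ n / (real n * (1 - (q^4) ^ n))"
    \<comment> \<open>The surplus of the coefficients over the desired terms consists of these two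
      Lambert series; by \<open>LS_add_uminus\<close> they cancel against those in ln (4 k).\<close>
    have V: "?V sums LS (- q) (q^2)" and W: "?W sums LS (q^2) (q^4)"
      unfolding LS_def by (intro summable_sums summable_LS; use p q in simp)+
    have "\<bar>sech_coeff q n - (-1) ^ n\<bar> \<le> 3" for n
    proof -
      have "q ^ n \<le> 1" using q by (simp add: power_le_one)
      then have "\<bar>sech_coeff q n\<bar> \<le> 2" using sech_coeff_bound[OF q, of n] by linarith
      then show ?thesis using abs_triangle_ineq4[of "sech_coeff q n" "(-1)^n"]
          by (simp add: power_abs)
    qed
    then have c: "?c sums (\<Sum>n. ?c n)" by (intro summable_sums summable_log_coeff[OF q])
    have "?c n + 4 * ?V n - 8 * ?W n = ?T n" for n
    proof (cases "n = 0")
      case False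
      define X where "X = q ^ n"
      define e where "e = (-1 :: real) ^ n"
      have X: "0 < X" "X < 1" using q False by (auto simp: X_def power_less_one_iff)
      have e: "e * e = 1" by (simp add: e_def flip: power_add)
      have pw: "(q^2)^n = X^2" "(q^4)^n = X^4" "q^(2*n) = X^2" "(- q)^n = e * X" "(- (q^2))^n =
          e * X^2"
        by (simp_all add: X_def e_def mult.commute power_minus[of q] power_minus[of "q^2"] flip:
            power_mult)
      define m where "m = 1 - X^2"
      define p where "p = 1 + X^2"
      have nz: "m \<noteq> 0" "p \<noteq> 0" "m * p = 1 - X^4"
      proof -
        have "X^2 < 1" using X by (simp add: power_less_one_iff)
        then show "m \<noteq> 0" by (simp add: m_def)
        show "p \<noteq> 0" unfolding p_def using zero_le_power2[of X] by linarith
        show "m * p = 1 - X^4" by (simp add: m_def p_def algebra_simps power2_eq_square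
            power4_eq_xxxx)
      qed
      \<comment> \<open>A polynomial identity after multiplication by m p^2; it rests on e^2 = 1 and
        p^2 - 4 X^2 = m^2.\<close>
      have "(2 * (X / m) - 4 * (e * X^2 / (m * p))) * (2 * X / p - e) + 4 * (e * X / m) - 8 * (X^2
          / (m * p)) =
            e * m / p * (2 * X / p)"
      proof -
        have "((2 * (X / m) - 4 * (e * X^2 / (m * p))) * (2 * X / p - e) + 4 * (e * X / m) - 8 *
            (X^2 / (m * p))) * (m * p^2) =
          (2 * X * p - 4 * e * X^2) * (2 * X - e * p) + 4 * e * X * p^2 - 8 * X^2 * p"
          using nz(1,2) by (simp add: field_simps power2_eq_square)
        also have "\<dots> = 4 * X^2 * p - 8 * e * X^3 - 2 * e * X * p^2 + 4 * (e * e) * X^2 * p + 4 * e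
            * X * p^2 - 8 * X^2 * p"
          by (simp add: algebra_simps power2_eq_square power3_eq_cube)
        also have "\<dots> = 2 * e * X * (p^2 - 4 * X^2)"
          unfolding e by (simp add: algebra_simps power2_eq_square power3_eq_cube)
        also have "p^2 - 4 * X^2 = m^2" by (simp add: m_def p_def power2_eq_square algebra_simps)
        also have "2 * e * X * m^2 = (e * m / p * (2 * X / p)) * (m * p^2)"
          using nz(1,2) by (simp add: power2_eq_square)
        finally show ?thesis
          by (rule mult_right_cancel[THEN iffD1, rotated]) (use nz(1,2) in simp)
      qed
      then have "((2 * (X / m) - 4 * (e * X^2 / (m * p))) * (2 * X / p - e) + 4 * (e * X / m) - 8 *
          (X^2 / (m * p))) / real n =
            e * m / p * (2 * X / p) / real n" by simp
      moreover have "?c n + 4 * ?V n - 8 * ?W n =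
         ((2 * (X / m) - 4 * (e * X^2 / (m * p))) * (2 * X / p - e) + 4 * (e * X / m) - 8 * (X^2 /
             (m * p))) / real n"
      proof -
        have gen: "(2 * (a / N) - 4 * (b / N)) * c + 4 * (v / N) - 8 * (w / N) =
            ((2 * a - 4 * b) * c + 4 * v - 8 * w) / N"
          for a b c v w N :: real
          by (simp add: diff_divide_distrib add_divide_distrib left_diff_distrib)
        have quot: "a / (real n * b) = a / b / real n" for a b
          by (simp add: mult.commute)
        show ?thesis
          unfolding log_coeff_def sech_coeff_def pw e_def[symmetric] X_def[symmetric]
              m_def[symmetric] p_def[symmetric] nz(3)
            quot gen ..
      qed
      moreover have "?T n = e * m / p * (2 * X / p) / real n"
        unfolding sech_coeff_def pw e_def[symmetric] X_def[symmetric] m_def[symmetric]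
            p_def[symmetric] ..
      ultimately show ?thesis by simp
    qed (simp add: log_coeff_def)
    then have "?T sums ((\<Sum>n. ?c n) + 4 * LS (- q) (q^2) - 8 * LS (q^2) (q^4))"
      using sums_diff[OF sums_add[OF c sums_mult[OF V, of 4]] sums_mult[OF W, of 8]] by simp
    then show ?thesis by (simp add: sums_iff)
  qed
  finally show ?thesis
    using LS_add_uminus[of q "q^2"] p by (simp add: k_def algebra_simps)
qed

end

subsection \<open>Class invariants\<close>

lemma prodinf_eq_exp_LS:
  fixes a x :: real
  assumes "\<bar>a\<bar> < 1" "\<bar>x\<bar> < 1"
  shows "(\<Prod>n. 1 - a * x ^ n) = exp (- LS a x)"
proof -
  have "(\<lambda>N. complex_of_real (\<Prod>k<N. 1 - a * x ^ k)) \<longlonglongrightarrow> of_real (exp (- LS a x))"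
    using prod_tendsto_exp_LS[of "of_real a" "of_real x"] LS_of_real[OF assms] assms
    by (simp flip: exp_of_real)
  then have lim: "(\<lambda>N. \<Prod>k<N. 1 - a * x ^ k) \<longlonglongrightarrow> exp (- LS a x)"
    by (simp only: tendsto_of_real_iff)
  have nz: "1 - a * x ^ k \<noteq> 0" for k
  proof -
    have "\<bar>a * x ^ k\<bar> \<le> \<bar>a\<bar> * 1"
      unfolding abs_mult power_abs using assms by (intro mult_left_mono) (auto simp: power_le_one)
    then show ?thesis using assms by auto
  qed
  have "convergent_prod (\<lambda>n. 1 - a * x ^ n)"
    unfolding convergent_prod_iff_nz_lim[OF nz]
    using lim[unfolded LIMSEQ_lessThan_iff_atMost] exp_not_eq_zero by blast
  then have "(\<Prod>n. 1 - a * x ^ n) = lim (\<lambda>n. \<Prod>i<n. 1 - a * x ^ i)"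
    by (rule prodinf_eq_lim') (rule nz)
  then show ?thesis using limI[OF lim] by simp
qed

lemma nome_bounds: "r \<ge> 1 \<Longrightarrow> 0 < nome r" "r \<ge> 1 \<Longrightarrow> nome r < 1"
  by (auto simp: nome_def)

text \<open>The prefactors collapse to 8 / 2^3 = 1 and q^(-1/2). Of the products, A^8 B^4 = A^4 (A
  B)^4, and A B is the product of all 1 - q^(4n+2).\<close>

theorem class_invariants_eq_modulus_ratio:
  assumes "r \<ge> 1"
  shows "8 * class_g r ^ 8 * class_G r ^ 4 = 4 * modulus_ratio (nome r)"
proof -
  define q where "q = nome r"
  have q: "0 < q" "q < 1" using nome_bounds[OF assms] by (auto simp: q_def)
  have p: "q^2 < 1" "q^4 < 1" using q by (auto simp: power_less_one_iff)
  define A where "A = exp (- LS q (q^2))"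
  define B where "B = exp (- LS (- q) (q^2))"
  have "(\<Prod>n. 1 - q ^ (2*n+1)) = A" "(\<Prod>n. 1 + q ^ (2*n+1)) = B"
    using prodinf_eq_exp_LS[of q "q^2"] prodinf_eq_exp_LS[of "-q" "q^2"] q p
        by (simp_all add: power_mult A_def B_def)
  then have g: "class_g r = 2 powr (- 1 / 4) * q powr (- 1 / 24) * A" "class_G r =
      2 powr (- 1 / 4) * q powr (- 1 / 24) * B"
    unfolding class_g_def class_G_def q_def[symmetric] by simp_all
  have "8 * class_g r ^ 8 * class_G r ^ 4 = 8 * (2 powr (- 1 / 4))^12 * (q powr (- 1 / 24))^12 *
      (A^8 * B^4)"
  proof -
    have "8 * (a * b * A) ^ 8 * (a * b * B) ^ 4 = 8 * (a ^ 8 * a ^ 4) * (b ^ 8 * b ^ 4) * (A ^ 8 *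
        B ^ 4)" for a b :: real
      by (simp only: power_mult_distrib mult_ac)
    moreover have "x ^ 8 * x ^ 4 = x ^ 12" for x :: real by (simp flip: power_add)
    ultimately show ?thesis unfolding g by (simp only:)
  qed
  also have "(2 powr (- 1 / 4))^12 = (1 / 8 :: real)"
    by (simp add: powr_power) (simp add: powr_minus field_simps powr_numeral)
  also have "(q powr (- 1 / 24))^12 = exp (- ln q / 2)"
    using q by (simp add: powr_def flip: exp_of_nat_mult)
  also have "A^8 * B^4 = exp (4 * (- LS q (q^2) - LS (q^2) (q^4)))"
  proof -
    have "LS q (q^2) + LS (- q) (q^2) = LS (q^2) (q^4)"
      using LS_add_uminus[of q "q^2"] q p by simp
    then have "8 * (- LS q (q^2)) + 4 * (- LS (- q) (q^2)) = 4 * (- LS q (q^2) - LS (q^2) (q^4))"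
      by (simp add: algebra_simps)
    moreover have "A^8 * B^4 = exp (8 * (- LS q (q^2)) + 4 * (- LS (- q) (q^2)))"
      unfolding A_def B_def exp_add by (simp add: exp_of_nat_mult[symmetric])
    ultimately show ?thesis by simp
  qed
  also have "8 * (1 / 8) * exp (- ln q / 2) * exp (4 * (- LS q (q^2) - LS (q^2) (q^4))) =
      exp (ln (4 * modulus_ratio q))"
    unfolding ln_modulus_ratio[OF q] by (simp add: mult_exp_exp algebra_simps)
  also have "\<dots> = 4 * modulus_ratio q" using modulus_ratio_pos[OF q] by simp
  finally show ?thesis by (simp add: q_def)
qed

section \<open>The trigamma function and alternating sums over odd numbers\<close>

lemma Polygamma_1_reflection:
  fixes z :: complex
  assumes "z \<notin> \<int>"
  shows "Polygamma 1 z + Polygamma 1 (1 - z) = (of_real pi / sin (of_real pi * z))^2"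
proof -
  let ?S = "- \<int> :: complex set"
  have opn: "open ?S" by (intro open_Compl closed_Ints)
  have nonpos: "w \<notin> \<int>\<^sub>\<le>\<^sub>0" "1 - w \<notin> \<int>\<^sub>\<le>\<^sub>0" if "w \<in> ?S" for w :: complex
  proof -
    show "w \<notin> \<int>\<^sub>\<le>\<^sub>0" using that nonpos_Ints_Int by auto
    have "1 - (1 - w) \<notin> \<int>" using that by simp
    then have "1 - w \<notin> \<int>" by (metis Ints_1 Ints_diff)
    then show "1 - w \<notin> \<int>\<^sub>\<le>\<^sub>0" using nonpos_Ints_Int by auto
  qed
  have sin: "sin (of_real pi * w) \<noteq> 0" if "w \<in> ?S" for w :: complex
  proof
    assume "sin (of_real pi * w) = 0"
    then obtain n :: int where "complex_of_real pi * w = of_real (of_int n * pi)"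
      using sin_eq_0 by auto
    then have "w = of_int n" by simp
    then show False using that by auto
  qed
  \<comment> \<open>The logarithmic derivative of Euler's reflection formula for Gamma;
    differentiating once more gives the claim.\<close>
  have D1: "Digamma w - Digamma (1 - w) = - of_real pi * cos (of_real pi * w) / sin (of_real pi *
      w)" if w: "w \<in> ?S" for w
  proof -
    let ?F = "\<lambda>w :: complex. Gamma w * Gamma (1 - w)"
    have "(?F has_field_derivative (?F w * (Digamma w - Digamma (1 - w)))) (at w)"
      using nonpos[OF w] by (auto intro!: derivative_eq_intros simp: algebra_simps)
    moreover have "?F = (\<lambda>w. of_real pi / sin (of_real pi * w))"
      by (simp add: Gamma_reflection_complex fun_eq_iff)
    moreover have "((\<lambda>w. of_real pi / sin (of_real pi * w)) has_field_derivative
        (- ((of_real pi)^2 * cos (of_real pi * w) / (sin (of_real pi * w))^2))) (at w)"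
      using sin[OF w] by (auto intro!: derivative_eq_intros simp: power2_eq_square)
    ultimately have "?F w * (Digamma w - Digamma (1 - w)) =
        - ((of_real pi)^2 * cos (of_real pi * w) / (sin (of_real pi * w))^2)"
      by (metis DERIV_unique)
    then have "of_real pi / sin (of_real pi * w) * (Digamma w - Digamma (1 - w)) =
        - ((of_real pi)^2 * cos (of_real pi * w) / (sin (of_real pi * w))^2)"
      by (simp only: Gamma_reflection_complex)
    also have "\<dots> = of_real pi / sin (of_real pi * w) * (- of_real pi * cos (of_real pi * w) / sin
        (of_real pi * w))"
      by (simp add: power2_eq_square)
    finally show ?thesis
      by (rule mult_left_cancel[THEN iffD1, rotated]) (use sin[OF w] in simp)
  qed
  have z: "z \<in> ?S" using assms by simp
  have "((\<lambda>w. Digamma w - Digamma (1 - w)) has_field_derivative (Polygamma 1 z + Polygamma 1 (1 -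
      z))) (at z)"
    using nonpos[OF z] by (auto intro!: derivative_eq_intros)
  moreover have "((\<lambda>w. - of_real pi * cos (of_real pi * w) / sin (of_real pi * w))
      has_field_derivative
      ((of_real pi)^2 * ((sin (of_real pi * z))^2 + (cos (of_real pi * z))^2) / (sin (of_real pi *
          z))^2)) (at z)"
    using sin[OF z] by (auto intro!: derivative_eq_intros simp: power2_eq_square field_simps
        simp del: sin_cos_squared_add sin_cos_squared_add2 sin_cos_squared_add3)
  then have "((\<lambda>w. Digamma w - Digamma (1 - w)) has_field_derivative
      ((of_real pi)^2 * ((sin (of_real pi * z))^2 + (cos (of_real pi * z))^2) / (sin (of_real pi *
          z))^2)) (at z)"
    by (rule has_field_derivative_transform_within_open[OF _ opn z]) (simp add: D1)
  ultimately have "Polygamma 1 z + Polygamma 1 (1 - z) =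
      (of_real pi)^2 * ((sin (of_real pi * z))^2 + (cos (of_real pi * z))^2) / (sin (of_real pi *
      z))^2"
    by (rule DERIV_unique)
  then show ?thesis by (simp add: power_divide)
qed

text \<open>With a = 2 n + 1 this is chi(a) a / (a^2 + t^2)^2 for the nontrivial character chi
  modulo 4; t = 2 m sqrt r gives a row of the lattice sum up to sign.\<close>

definition char_lattice_term :: "real \<Rightarrow> nat \<Rightarrow> real" where
  "char_lattice_term t n = (-1) ^ n * (2 * real n + 1) / ((2 * real n + 1)^2 + t^2)^2"

text \<open>The bound is uniform in t, as the passage to t = 0 requires.\<close>

lemma abs_char_lattice_term: "\<bar>char_lattice_term t n\<bar> \<le> inverse ((real n + 1)^2)"
proof -
  let ?a = "2 * real n + 1"
  have a: "0 < ?a" "1 \<le> ?a" "real n + 1 \<le> ?a" "0 < real n + 1" by linarith+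
  have "?a / (?a^2 + t^2)^2 \<le> ?a / (?a^2)^2"
  proof (rule divide_left_mono)
    show "(?a^2)^2 \<le> (?a^2 + t^2)^2" by (intro power_mono) auto
    show "0 < (?a^2 + t^2)^2 * (?a^2)^2" using add_pos_nonneg[of "?a^2" "t^2"] a(1)
        by (intro mult_pos_pos zero_less_power) auto
  qed (use a in simp)
  also have "\<dots> = 1 / (?a^2 * ?a)" using a by (simp add: power2_eq_square)
  also have "\<dots> \<le> 1 / ((real n + 1)^2 * 1)"
  proof (rule divide_left_mono)
    show "(real n + 1)^2 * 1 \<le> ?a^2 * ?a" using a by (intro mult_mono power_mono) auto
    show "0 < (?a^2 * ?a) * ((real n + 1)^2 * 1)" using a
        by (intro mult_pos_pos zero_less_power) auto
  qed simp
  finally show ?thesis by (simp add: char_lattice_term_def abs_mult power_abs inverse_eq_divide)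
qed

lemma summable_char_lattice_bound: "summable (\<lambda>n. inverse ((real n + 1)^2))"
proof -
  have "summable (\<lambda>n. inverse (real (Suc n) ^ 2))"
    using summable_Suc_iff[of "\<lambda>n. inverse (real n ^ 2)"] inverse_power_summable[of 2, where 'a =
        real] by simp
  then show ?thesis by (simp add: add.commute)
qed

lemma summable_char_lattice_term: "summable (\<lambda>n. norm (char_lattice_term t n))"
  by (rule summable_comparison_test'[OF summable_char_lattice_bound, of 0]) (simp add:
      abs_char_lattice_term)

text \<open>Partial fractions turn two consecutive terms into inverse squares along four
  progressions, starting at z, 1 - z, z' and 1 - z'. The reflection formula applies twice, and since
  z' = 1/2 - z the difference is a function of the double angle, where the hyperbolic functions
  arise. The identity carries a factor t, so t = 0 needs another argument.\<close>

lemma char_lattice_sum_nonzero: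
  assumes t: "t \<noteq> 0"
  shows "(\<Sum>n. char_lattice_term t n) = pi^2 / (16 * t) * tanh (pi * t / 2) / cosh (pi * t / 2)"
proof -
  define z where "z = (1 - \<i> * of_real t) / 4"
  define z' where "z' = (1 + \<i> * of_real t) / 4"
  have cos_half_pi: "cos (of_real pi / 2 - w) = sin w" and sin_half_pi: "sin (of_real pi / 2 - w) =
      cos w" for w :: complex
    by (simp_all add: cos_diff sin_diff cos_of_real_pi_half)
  have Im: "Im z = - t / 4" "Im z' = t / 4" by (simp_all add: z_def z'_def)
  have ni: "z \<notin> \<int>" "z' \<notin> \<int>"
    using Im t by (auto elim!: Ints_cases)
  have S: "(\<lambda>k. inverse ((w + of_nat k)^2)) sums Polygamma 1 w" if "w \<noteq> 0" for w :: complex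
    using Polygamma_LIMSEQ[OF that, of 1] by (simp add: numeral_2_eq_2)
  have nz: "z \<noteq> 0" "z' \<noteq> 0" "1 - z \<noteq> 0" "1 - z' \<noteq> 0"
    using ni by (metis Ints_0, metis Ints_0, metis Ints_1 right_minus_eq, metis Ints_1
        right_minus_eq)
  let ?a = "\<lambda>n. 64 * \<i> * of_real t * complex_of_real (char_lattice_term t n)"
  have key: "?a (2*k) + ?a (2*k+1) = (inverse ((z + of_nat k)^2) + inverse ((1 - z + of_nat k)^2)) -
       (inverse ((z' + of_nat k)^2) + inverse ((1 - z' + of_nat k)^2))" for k
  proof -
    have gen: "inverse (((of_real a - \<i> * of_real t) / 4)^2) - inverse (((of_real a + \<i> * of_real
        t) / 4)^2) =
          64 * \<i> * of_real t * complex_of_real (a / (a^2 + t^2)^2)" for a :: real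
    proof -
      define u v where "u = complex_of_real a - \<i> * of_real t" "v =
          complex_of_real a + \<i> * of_real t"
      have nz: "u \<noteq> 0" "v \<noteq> 0" using t by (auto simp: u_v_def complex_eq_iff)
      have uv: "u * v = of_real (a^2 + t^2)" by (simp add: u_v_def algebra_simps power2_eq_square)
      have "inverse ((u / 4)^2) - inverse ((v / 4)^2) = 16 * (v^2 - u^2) / (u * v)^2"
        using nz by (simp add: field_simps power2_eq_square)
      also have "v^2 - u^2 = 4 * \<i> * of_real a * of_real t"
          by (simp add: u_v_def power2_eq_square algebra_simps)
      finally show ?thesis unfolding uv by (simp add: u_v_def)
    qed
    have 1: "z + of_nat k = (of_real (4 * real k + 1) - \<i> * of_real t) / 4"
         "z' + of_nat k = (of_real (4 * real k + 1) + \<i> * of_real t) / 4"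
         "1 - z' + of_nat k = (of_real (4 * real k + 3) - \<i> * of_real t) / 4"
         "1 - z + of_nat k = (of_real (4 * real k + 3) + \<i> * of_real t) / 4"
      by (simp_all add: z_def z'_def field_simps)
    have 2: "char_lattice_term t (2*k) = (4 * real k + 1) / ((4 * real k + 1)^2 + t^2)^2"
      "char_lattice_term t (2*k+1) = - ((4 * real k + 3) / ((4 * real k + 3)^2 + t^2)^2)"
    proof -
      have r: "2 * real (2*k) + 1 = 4 * real k + 1" "2 * real (2*k+1) + 1 = 4 * real k + 3"
          by simp_all
      have m: "(-1 :: real) ^ (2*k) = 1" "(-1 :: real) ^ (2*k+1) = -1" by simp_all
      have n: "-1 * x / y = - (x / y)" for x y :: real by simp
      show "char_lattice_term t (2*k) = (4 * real k + 1) / ((4 * real k + 1)^2 + t^2)^2"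
        unfolding char_lattice_term_def r m by (rule arg_cong2[where f = "(/)"]) simp_all
      show "char_lattice_term t (2*k+1) = - ((4 * real k + 3) / ((4 * real k + 3)^2 + t^2)^2)"
        unfolding char_lattice_term_def r m by (rule n)
    qed
    show ?thesis unfolding 1 2 using gen[of "4 * real k + 1"] gen[of "4 * real k + 3"]
        by (simp add: algebra_simps)
  qed
  have "summable (char_lattice_term t)" using summable_norm_cancel[OF summable_char_lattice_term] .
  then have "?a sums (64 * \<i> * of_real t * of_real (\<Sum>n. char_lattice_term t n))"
    by (intro sums_mult sums_of_real summable_sums)
  from sums_group[OF this, of 2]
  have "(\<lambda>k. ?a (2*k) + ?a (2*k+1)) sums (64 * \<i> * of_real t * of_real (\<Sum>n. char_lattice_term t n))"
    by (simp add: mult.commute[of _ 2] atLeastLessThanSuc numeral_2_eq_2 add.commute)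
  moreover have "(\<lambda>k. ?a (2*k) + ?a (2*k+1)) sums ((Polygamma 1 z + Polygamma 1 (1 - z)) -
      (Polygamma 1 z' + Polygamma 1 (1 - z')))"
    unfolding key by (intro sums_add sums_diff S nz)
  ultimately have "64 * \<i> * of_real t * of_real (\<Sum>n. char_lattice_term t n) =
      (Polygamma 1 z + Polygamma 1 (1 - z)) - (Polygamma 1 z' + Polygamma 1 (1 - z'))"
    by (rule sums_unique2)
  then have "64 * \<i> * of_real t * of_real (\<Sum>n. char_lattice_term t n) =
      (of_real pi / sin (of_real pi * z))^2 - (of_real pi / sin (of_real pi * z'))^2"
    unfolding Polygamma_1_reflection[OF ni(1)] Polygamma_1_reflection[OF ni(2)] .
  also have "sin (of_real pi * z') = cos (of_real pi * z)"
  proof -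
    have "of_real pi * z' = of_real pi / 2 - of_real pi * z" by (simp add: z_def z'_def field_simps)
    then show ?thesis by (simp add: sin_diff cos_of_real_pi_half)
  qed
  also have "(of_real pi / sin (of_real pi * z))^2 - (of_real pi / cos (of_real pi * z))^2 =
     4 * (of_real pi)^2 * cos (2 * (of_real pi * z)) / (sin (2 * (of_real pi * z)))^2"
  proof -
    let ?s = "sin (of_real pi * z)" and ?c = "cos (of_real pi * z)"
    have "sin (2 * (of_real pi * z)) \<noteq> 0 \<Longrightarrow> ?thesis"
      unfolding sin_double cos_double by (simp add: field_simps power2_eq_square)
    moreover have "sin (2 * (of_real pi * z)) \<noteq> 0"
    proof
      assume "sin (2 * (of_real pi * z)) = 0"
      then obtain n :: int where "2 * (complex_of_real pi * z) = of_real (of_int n * pi)"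
        using sin_eq_0 by blast
      then have "Im (2 * (complex_of_real pi * z)) = Im (complex_of_real (of_int n * pi))"
          by (simp only:)
      then show False using Im t by simp
    qed
    ultimately show ?thesis by blast
  qed
  also have "2 * (of_real pi * z) = of_real pi / 2 - \<i> * of_real (pi * t / 2)"
      by (simp add: z_def field_simps)
  also have "cos (of_real pi / 2 - \<i> * of_real (pi * t / 2)) = \<i> * of_real (sinh (pi * t / 2))"
    unfolding cos_half_pi sin_i_times
    by (simp add: sinh_def exp_minus scaleR_conv_of_real flip: exp_of_real)
  also have "sin (of_real pi / 2 - \<i> * of_real (pi * t / 2)) = of_real (cosh (pi * t / 2))"
    unfolding sin_half_pi cos_i_times
    by (simp add: cosh_def exp_minus scaleR_conv_of_real flip: exp_of_real)
  finally have "\<i> * complex_of_real (64 * t * (\<Sum>n. char_lattice_term t n)) =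
      \<i> * of_real (4 * pi^2 * sinh (pi * t / 2) / (cosh (pi * t / 2))^2)"
    by (simp add: mult_ac)
  then have "complex_of_real (64 * t * (\<Sum>n. char_lattice_term t n)) =
      of_real (4 * pi^2 * sinh (pi * t / 2) / (cosh (pi * t / 2))^2)"
    by (metis mult_left_cancel complex_i_not_zero)
  then have "64 * t * (\<Sum>n. char_lattice_term t n) = 4 * pi^2 * sinh (pi * t / 2) / (cosh (pi * t /
      2))^2"
    by (simp only: of_real_eq_iff)
  then show ?thesis using t by (simp add: tanh_def field_simps power2_eq_square)
qed

text \<open>By continuity: both sides of the formula for nonzero t have limits at 0, and sinh (pi t
  / 2) / t tends to pi / 2.\<close>

lemma char_lattice_sum_zero: "(\<Sum>n. char_lattice_term 0 n) = pi^3 / 32"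
proof -
  have 1: "((\<lambda>t. \<Sum>n. char_lattice_term t n) \<longlongrightarrow> (\<Sum>n. char_lattice_term 0 n)) (at 0)"
  proof (rule tannerys_theorem[THEN conjunct2, THEN conjunct2, OF _ _ summable_char_lattice_bound])
    show "((\<lambda>t. char_lattice_term t n) \<longlongrightarrow> char_lattice_term 0 n) (at 0)" for n
    proof -
      have "2 * real n + 1 \<noteq> 0" by linarith
      then show ?thesis unfolding char_lattice_term_def by (intro tendsto_intros) auto
    qed
  qed (auto intro!: always_eventually simp: abs_char_lattice_term)
  have "((\<lambda>t. sinh (pi * t / 2)) has_field_derivative (pi / 2)) (at 0)"
    by (auto intro!: derivative_eq_intros)
  then have 3: "((\<lambda>t. sinh (pi * t / 2) / t) \<longlongrightarrow> pi / 2) (at 0)"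
    by (simp add: DERIV_def)
  have "((\<lambda>t. pi^2 / 16 * (sinh (pi * t / 2) / t) / (cosh (pi * t / 2) * cosh (pi * t / 2))) \<longlongrightarrow>
     pi^2 / 16 * (pi / 2) / (cosh (pi * 0 / 2) * cosh (pi * 0 / 2))) (at 0)"
    by (intro tendsto_divide[OF tendsto_mult[OF tendsto_const 3]] tendsto_intros) auto
  then have 2: "((\<lambda>t. pi^2 / 16 * (sinh (pi * t / 2) / t) / (cosh (pi * t / 2) * cosh (pi * t /
      2))) \<longlongrightarrow> pi^3 / 32) (at 0)"
    by (simp add: power2_eq_square power3_eq_cube)
  have "eventually (\<lambda>t. pi^2 / 16 * (sinh (pi * t / 2) / t) / (cosh (pi * t / 2) * cosh (pi * t /
      2)) = (\<Sum>n. char_lattice_term t n)) (at 0)"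
    using eventually_neq_at_within[of 0] by eventually_elim (simp add: char_lattice_sum_nonzero
        tanh_def field_simps)
  from Lim_transform_eventually[OF 2 this] 1 show ?thesis
    using tendsto_unique trivial_limit_at by blast
qed

subsection \<open>The coefficients of the eta quotient\<close>

lemma gbin_const_poly: "gbin [:q:] n k = [:gbin q n k:]"
  by (induction q n k rule: gbin.induct) (simp_all add: poly_const_pow del: power_Suc)

lemma gbin_symmetric:
  fixes q :: "'a::idom"
  assumes "k \<le> n" "\<And>m. qfac q m \<noteq> 0"
  shows "gbin q n (n - k) = gbin q n k"
proof -
  have "gbin q n (n - k) * (qfac q k * qfac q (n - k)) = gbin q n k * (qfac q k * qfac q (n - k))"
    using gbin_mult_qfac[OF assms(1), of q] gbin_mult_qfac[of "n - k" n q] assms(1)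
        by (simp add: mult_ac)
  then show ?thesis using assms(2) by simp
qed

text \<open>The derivative at \<open>z = 1\<close> of the polynomial identity obtained from the \<open>q\<close>-binomial theorem
  for \<open>\<Prod>i\<le>2n. q^n - z q^i\<close>, whose middle factor vanishes there.\<close>

lemma finite_jacobi_cube:
  fixes q :: "'a::idom"
  assumes q: "q \<noteq> 0" and qf: "\<And>m. qfac q m \<noteq> 0"
  shows "qfac q n ^ 2 = (\<Sum>j\<le>n. (-1) ^ j * of_nat (2*j+1) * q ^ (Suc j choose 2) * gbin q (2*n+1)
      (n+1+j))"
proof -
  define N where "N = 2*n+1"
  define E where "E = (n choose 2) + n + n * n"
  let ?P = "\<lambda>i. [:q^n, - (q^i):]"
  have "(\<Prod>i<N. ?P i) = (\<Prod>i<N. [:q^n:] + [:0, -1:] * [:q:] ^ i)"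
    by (simp add: poly_const_pow)
  also have "\<dots> = (\<Sum>k\<le>N. [:q:] ^ (k choose 2) * gbin [:q:] N k * [:0, -1:] ^ k * [:q^n:] ^ (N - k))"
    by (rule qbinomial)
  also have "\<dots> = (\<Sum>k\<le>N. monom (q ^ (k choose 2) * gbin q N k * (-1) ^ k * q ^ (n * (N - k))) k)"
  proof (intro sum.cong refl)
    fix k
    have "[:0, -1:] ^ k = monom ((-1 :: 'a) ^ k) k"
      by (induction k) (simp_all add: monom_Suc one_pCons minus_monom)
    then show "[:q:] ^ (k choose 2) * gbin [:q:] N k * [:0, -1:] ^ k * [:q^n:] ^ (N - k) =
         monom (q ^ (k choose 2) * gbin q N k * (-1) ^ k * q ^ (n * (N - k))) k"
      by (simp add: gbin_const_poly poly_const_pow smult_monom power_mult mult_ac)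
  qed
  finally have "pderiv (\<Prod>i<N. ?P i) = pderiv (\<Sum>k\<le>N. monom (q ^ (k choose 2) * gbin q N k * (-1) ^ k
      * q ^ (n * (N - k))) k)"
    by simp
  moreover have "pderiv (\<Sum>k\<le>m. f k) = (\<Sum>k\<le>m. pderiv (f k))" for m and f :: "nat \<Rightarrow> 'a poly"
    by (induction m) (simp_all add: pderiv_add)
  ultimately have deriv: "poly (pderiv (\<Prod>i<N. ?P i)) 1 =
      (\<Sum>k\<le>N. of_nat k * (q ^ (k choose 2) * gbin q N k * (-1) ^ k * q ^ (n * (N - k))))"
    by (simp add: pderiv_monom poly_sum poly_monom)
  \<comment> \<open>All factors except the one with i = n, which is q^n (1 - z).\<close>
  define A where "A = (\<Prod>i<n. ?P i) * (\<Prod>i<n. ?P (n+1+i))"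
  have "(\<Prod>i<N. ?P i) = A * ?P n"
  proof -
    have split: "(\<Prod>i<m + k. f i) = (\<Prod>i<m. f i) * (\<Prod>i<k. f (m + i))" for m k and f :: "nat \<Rightarrow> 'a poly"
      by (induction k) (simp_all add: mult_ac)
    have "N = (n + 1) + n" by (simp add: N_def)
    then show ?thesis
      by (simp only: split A_def Suc_eq_plus1[symmetric] prod.lessThan_Suc mult_ac)
  qed
  then have "poly (pderiv (\<Prod>i<N. ?P i)) 1 = poly A 1 * poly (pderiv (?P n)) 1 + poly (?P n) 1 *
      poly (pderiv A) 1"
    by (simp only: pderiv_mult poly_add poly_mult)
  then have lhs: "poly (pderiv (\<Prod>i<N. ?P i)) 1 = - (q ^ n) * poly A 1"
    by (simp add: pderiv_pCons)
  have "(\<Prod>i<n. poly (?P (n+1+i)) 1) = (\<Prod>i<n. q ^ n * (1 - q ^ Suc i))"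
    by (intro prod.cong refl) (simp add: power_add algebra_simps)
  also have "\<dots> = q ^ (n * n) * qfac q n"
    by (simp add: prod.distrib qfac_def power_mult)
  finally have A2: "(\<Prod>i<n. poly (?P (n+1+i)) 1) = q ^ (n * n) * qfac q n" .
  have "(\<Prod>i<n. poly (?P i) 1) = (\<Prod>i<n. q ^ i * (q ^ (n - i) - 1))"
    by (intro prod.cong refl) (simp add: right_diff_distrib flip: power_add)
  also have "\<dots> = q ^ (n choose 2) * (\<Prod>i<n. q ^ (n - i) - 1)"
  proof -
    have "(\<Prod>i<n. q ^ i) = q ^ (n choose 2)"
      by (simp add: choose_two Sum_Ico_nat lessThan_atLeast0 flip: power_sum)
    then show ?thesis by (simp add: prod.distrib)
  qed
  also have "(\<Prod>i<n. q ^ (n - i) - 1) = (\<Prod>i<n. q ^ (n - (n - Suc i)) - 1)"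
    by (rule prod.nat_diff_reindex[symmetric])
  also have "\<dots> = (\<Prod>i<n. (-1) * (1 - q ^ Suc i))"
    by (intro prod.cong refl) (simp add: Suc_diff_Suc)
  also have "\<dots> = (-1) ^ n * qfac q n"
    by (simp only: prod.distrib) (simp add: qfac_def)
  finally have A1: "(\<Prod>i<n. poly (?P i) 1) = q ^ (n choose 2) * ((-1) ^ n * qfac q n)" .
  have lhs': "poly (pderiv (\<Prod>i<N. ?P i)) 1 = q ^ E * ((-1) ^ Suc n * qfac q n ^ 2)"
    unfolding lhs A_def poly_mult poly_prod A1 A2 by (simp add: E_def power_add power2_eq_square)
  define T where "T = (\<lambda>k. of_nat k * (q ^ (k choose 2) * gbin q N k * (-1) ^ k * q ^ (n * (N -
      k))))"
  have "(\<Sum>k\<le>N. T k) = (\<Sum>k<n+1. T k) + (\<Sum>j<n+1. T (n+1+j))"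
  proof -
    have "(\<Sum>k<m + l. T k) = (\<Sum>k<m. T k) + (\<Sum>j<l. T (m + j))" for m l
      by (induction l) (simp_all add: add_ac)
    from this[of "n+1" "n+1"] show ?thesis by (simp add: N_def mult_2 lessThan_Suc_atMost)
  qed
  also have "(\<Sum>k<n+1. T k) = (\<Sum>j<n+1. T (n+1 - Suc j))"
    by (rule sum.nat_diff_reindex[symmetric])
  also have "(\<Sum>j<n+1. T (n+1 - Suc j)) + (\<Sum>j<n+1. T (n+1+j)) = (\<Sum>j\<le>n. T (n - j) + T (n+1+j))"
    by (simp add: sum.distrib lessThan_Suc_atMost)
  \<comment> \<open>The terms k = n - j and k = n + 1 + j have equal powers of q and equal Gaussian
    binomials but opposite signs, so their weights combine to (n + 1 + j) - (n - j) = 2 j +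
    1.\<close>
  also have "\<dots> = (\<Sum>j\<le>n. q ^ E * ((-1) ^ Suc n * ((-1) ^ j * of_nat (2*j+1) * q ^ (Suc j choose 2) *
      gbin q N (n+1+j))))"
  proof (intro sum.cong refl)
    fix j assume "j \<in> {..n}"
    then have j: "j \<le> n" by simp
    define m where "m = n - j"
    have n: "n = m + j" using j by (simp add: m_def)
    \<comment> \<open>Exponents are compared after doubling and adding k, which avoids the truncated
      subtraction and the division in \<open>k choose 2\<close>.\<close>
    have two: "2 * (k choose 2) + k = k * k" for k
      unfolding two_choose_two by (cases k) auto
    have e1: "((n+1+j) choose 2) + n * (N - (n+1+j)) = E + (Suc j choose 2)"
    proof -
      have "2 * (((n+1+j) choose 2) + n * m) + (n+1+j) = 2 * (E + (Suc j choose 2)) + (n+1+j)"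
        using two[of "n+1+j"] two[of n] two[of "Suc j"] by (simp add: E_def n algebra_simps)
      then show ?thesis by (simp add: N_def n)
    qed
    have e2: "((n-j) choose 2) + n * (N - (n-j)) = E + (Suc j choose 2)"
    proof -
      have "2 * ((m choose 2) + n * (N - m)) + m = 2 * (E + (Suc j choose 2)) + m"
        using two[of m] two[of n] two[of "Suc j"] by (simp add: E_def N_def n algebra_simps)
      then show ?thesis by (simp add: m_def)
    qed
    have sym: "gbin q N (n - j) = gbin q N (n+1+j)"
      using gbin_symmetric[of "n+1+j" N q] qf j by (simp add: N_def)
    have sgn: "(-1 :: 'a) ^ (n+1+j) = (-1) ^ Suc n * (-1) ^ j" "(-1 :: 'a) ^ (n-j) =
        - ((-1) ^ Suc n * (-1) ^ j)"
    proof -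
      have sq: "(-1 :: 'a) ^ j * (-1) ^ j = 1" by (simp flip: power_mult_distrib)
      show "(-1 :: 'a) ^ (n+1+j) = (-1) ^ Suc n * (-1) ^ j" by (simp add: power_add)
      have "(-1 :: 'a) ^ Suc n * (-1) ^ j = - ((-1) ^ m * ((-1) ^ j * (-1) ^ j))"
        by (simp add: n power_add mult.assoc)
      then show "(-1 :: 'a) ^ (n-j) = - ((-1) ^ Suc n * (-1) ^ j)"
        unfolding sq by (simp add: m_def)
    qed
    have T: "T k = (of_nat k * (-1) ^ k) * (q ^ ((k choose 2) + n * (N - k)) * gbin q N k)" for k
      by (simp add: T_def power_add mult_ac)
    have "T (n - j) + T (n+1+j) = (of_nat (n-j) * (-1) ^ (n-j) + of_nat (n+1+j) * (-1) ^ (n+1+j)) *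
         (q ^ (E + (Suc j choose 2)) * gbin q N (n+1+j))"
      unfolding T e1 e2 sym by (simp only: distrib_right)
    also have "of_nat (n-j) * (-1) ^ (n-j) + of_nat (n+1+j) * (-1) ^ (n+1+j) =
        (-1 :: 'a) ^ Suc n * ((-1) ^ j * of_nat (2*j+1))"
      unfolding sgn using j by (simp add: of_nat_diff algebra_simps)
    finally show "T (n - j) + T (n+1+j) = q ^ E * ((-1) ^ Suc n * ((-1) ^ j * of_nat (2*j+1) * q ^
        (Suc j choose 2) * gbin q N (n+1+j)))"
      by (simp add: power_add mult_ac)
  qed
  finally have "q ^ E * ((-1) ^ Suc n * qfac q n ^ 2) = q ^ E * ((-1) ^ Suc n *
     (\<Sum>j\<le>n. (-1) ^ j * of_nat (2*j+1) * q ^ (Suc j choose 2) * gbin q N (n+1+j)))"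
    using deriv lhs' unfolding T_def by (simp only: sum_distrib_left)
  then show ?thesis using q by (simp add: N_def)
qed

text \<open>Divisibility by powers of X expresses agreement of coefficients; the identities for
  infinite products are proved in this form, modulo a power that grows with n.\<close>

lemma fps_X_power_dvd_iff:
  fixes f :: "real fps"
  shows "fps_X ^ m dvd f \<longleftrightarrow> (\<forall>i<m. fps_nth f i = 0)"
proof
  assume "fps_X ^ m dvd f"
  then obtain g where "f = fps_X ^ m * g" by (elim dvdE)
  then show "\<forall>i<m. fps_nth f i = 0" by (simp add: fps_X_power_mult_nth)
next
  assume *: "\<forall>i<m. fps_nth f i = 0"
  have "f = fps_X ^ m * fps_shift m f"
    by (rule fps_ext) (use * in \<open>simp add: fps_X_power_mult_nth\<close>)
  then show "fps_X ^ m dvd f" by (metis dvd_triv_left)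
qed

context
  fixes d :: nat and x :: "real fps"
  assumes d: "d \<ge> 1"
  defines "x \<equiv> fps_X ^ d"
begin

lemma qfac_fps_nth_0 [simp]: "fps_nth (qfac x n) 0 = 1"
  using d by (induction n) (simp_all add: qfac_Suc x_def fps_X_power_nth flip: power_mult power_Suc)

lemma qfac_fps_nonzero: "qfac x n \<noteq> 0"
  using qfac_fps_nth_0[of n] by (metis fps_zero_nth zero_neq_one)

lemma qfac_fps_cong:
  assumes "m \<le> k"
  shows "x ^ Suc m dvd qfac x k - qfac x m"
  using assms
proof (induction k rule: dec_induct)
  case (step k)
  have "x ^ Suc m dvd x ^ Suc k" using step by (intro le_imp_power_dvd) auto
  moreover have "qfac x (Suc k) - qfac x m = (qfac x k - qfac x m) - qfac x k * x ^ Suc k"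
    by (simp add: qfac_Suc algebra_simps)
  ultimately show ?case using step by (metis dvd_diff dvd_mult)
qed simp

text \<open>After multiplication by the unit \<open>qfac x k * qfac x (N - k)\<close> the claim
  compares two products of finite Euler products, and all of these agree modulo x^(m+1).\<close>

lemma gbin_fps_cong:
  assumes "m \<le> k" "m \<le> N - k" "k \<le> N" "m \<le> M"
  shows "x ^ Suc m dvd gbin x N k * qfac x M - 1"
proof -
  define u where "u = qfac x k * qfac x (N - k)"
  have "u * (gbin x N k * qfac x M - 1) = qfac x N * qfac x M - u"
    using gbin_mult_qfac[OF assms(3), of x] by (simp add: u_def algebra_simps)
  also have "\<dots> = (qfac x N - qfac x m) * qfac x M + qfac x m * (qfac x M - qfac x m)
     - (qfac x k - qfac x m) * qfac x (N - k) - qfac x m * (qfac x (N - k) - qfac x m)"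
    by (simp add: u_def algebra_simps)
  also have "x ^ Suc m dvd \<dots>"
    using assms by (intro dvd_diff dvd_add dvd_mult dvd_mult2 qfac_fps_cong) auto
  finally have "x ^ Suc m dvd u * (gbin x N k * qfac x M - 1)" .
  moreover have "u dvd 1" by (simp add: u_def)
  ultimately show ?thesis using dvd_mult_unit_iff' by metis
qed

text \<open>One more factor \<open>qfac x n\<close> makes each Gaussian binomial equal to 1 up to
  order n - j + 1, and the power of x in front adds at least j, because j <= j (j + 1) / 2.\<close>

lemma qfac_cube_cong:
  "x ^ Suc n dvd qfac x n ^ 3 - (\<Sum>j\<le>n. (-1) ^ j * of_nat (2*j+1) * x ^ (Suc j choose 2))"
proof -
  have "x \<noteq> 0" by (simp add: x_def)
  have "qfac x n ^ 3 - (\<Sum>j\<le>n. (-1) ^ j * of_nat (2*j+1) * x ^ (Suc j choose 2)) =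
     (\<Sum>j\<le>n. (-1) ^ j * of_nat (2*j+1) * (x ^ (Suc j choose 2) * (gbin x (2*n+1) (n+1+j) * qfac x n
         - 1)))"
    unfolding power3_eq_cube power2_eq_square[symmetric] finite_jacobi_cube[OF \<open>x \<noteq> 0\<close>
        qfac_fps_nonzero]
    by (simp add: sum_distrib_right sum_distrib_left sum_subtractf algebra_simps)
  also have "x ^ Suc n dvd \<dots>"
  proof (rule dvd_sum, rule dvd_mult)
    fix j assume "j \<in> {..n}"
    then have j: "j \<le> n" by simp
    have "2 * (Suc j choose 2) = j * Suc j" by (simp add: two_choose_two)
    moreover have "2 * j \<le> j * Suc j" by (cases j) auto
    ultimately have "j \<le> (Suc j choose 2)" by linarith
    then have "x ^ Suc n dvd x ^ ((Suc j choose 2) + Suc (n - j))"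
      using j by (intro le_imp_power_dvd) auto
    also have "\<dots> dvd x ^ (Suc j choose 2) * (gbin x (2*n+1) (n+1+j) * qfac x n - 1)"
      unfolding power_add using j by (intro mult_dvd_mono dvd_refl gbin_fps_cong) auto
    finally show "x ^ Suc n dvd x ^ (Suc j choose 2) * (gbin x (2*n+1) (n+1+j) * qfac x n - 1)" .
  qed
  finally show ?thesis .
qed

lemma euler_fps_cong: "x ^ Suc n dvd euler_fps d - qfac x n"
proof -
  \<comment> \<open>Coefficients stabilise: the i-th one can be read off the i-th partial product,
    since later factors change nothing below X^(d (i + 1)).\<close>
  define F where "F = Abs_fps (\<lambda>i. fps_nth (qfac x i) i)"
  have nth: "fps_nth (qfac x k) i = fps_nth F i" if "i \<le> k" for i k
  proof -
    have "fps_X ^ (d * Suc i) dvd qfac x k - qfac x i"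
      using qfac_fps_cong[OF that] unfolding x_def power_mult .
    moreover have "i < d * Suc i" using d by (cases d) auto
    ultimately show ?thesis by (simp add: fps_X_power_dvd_iff F_def)
  qed
  have "(\<lambda>n. \<Prod>i\<le>n. 1 - fps_X ^ (d * Suc i)) \<longlonglongrightarrow> F"
  proof (rule tendsto_fpsI)
    fix i
    have "(\<Prod>i\<le>n. 1 - fps_X ^ (d * Suc i)) = qfac x (Suc n)" for n
      by (simp add: qfac_def x_def lessThan_Suc_atMost flip: power_mult del: power_Suc)
    then show "eventually (\<lambda>n. fps_nth (\<Prod>i\<le>n. 1 - fps_X ^ (d * Suc i)) i =
        fps_nth F i) sequentially"
      using nth by (intro eventually_sequentiallyI[of i]) auto
  qed
  \<comment> \<open>Convergence of an infinite product in the sense of \<open>has_prod\<close>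
    includes that the limit is nonzero.\<close>
  moreover have "F \<noteq> 0" using nth[of 0 0] by (metis fps_zero_nth order_refl qfac_fps_nth_0
      zero_neq_one)
  ultimately have "(\<lambda>j. 1 - fps_X ^ (d * Suc j)) has_prod F"
    by (simp add: has_prod_def raw_has_prod_def)
  then have E: "euler_fps d = F" unfolding euler_fps_def by (rule has_prod_unique[symmetric])
  have "x ^ Suc n dvd F - qfac x n"
    unfolding x_def power_mult[symmetric] fps_X_power_dvd_iff
  proof safe
    fix i assume i: "i < d * Suc n"
    show "fps_nth (F - qfac (fps_X ^ d) n) i = 0"
    proof -
      have "fps_X ^ (d * Suc n) dvd qfac x (max i n) - qfac x n"
        using qfac_fps_cong[of n "max i n"] unfolding x_def power_mult by simp
      then have "fps_nth (qfac x (max i n)) i = fps_nth (qfac x n) i" using i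
          by (simp add: fps_X_power_dvd_iff)
      then show ?thesis using nth[of i "max i n"] by (simp add: x_def)
    qed
  qed
  then show ?thesis unfolding E .
qed

lemma euler_fps_nth_0: "fps_nth (euler_fps d) 0 = 1"
  using euler_fps_cong[of 0] d by (simp add: x_def fps_X_power_dvd_iff qfac_def)

end

text \<open>The factors with even exponent form \<open>qfac (q^2) n\<close>, those with odd exponent
  form P, and (-1)^n P^2 is the finite triple product at z = -1.\<close>

lemma finite_gauss:
  fixes q :: "'a::idom"
  assumes q: "q \<noteq> 0"
  shows "qfac q (2 * n) ^ 2 = qfac (q^2) n * (\<Sum>k\<le>2*n. (-1) ^ (n + k) * (q ^ nat ((int k - int n)^2)
      * (gbin (q^2) (2*n) k * qfac (q^2) n)))"
proof -
  define P where "P = (\<Prod>k<n. 1 - q ^ (2*k+1))"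
  have split: "qfac q (2 * n) = qfac (q^2) n * P"
    unfolding P_def
  proof (induction n)
    case (Suc n)
    have "2 * Suc n = Suc (Suc (2 * n))" by simp
    then have "q ^ Suc (Suc (2 * n)) = (q^2) ^ Suc n" by (metis power_mult)
    moreover have "q ^ Suc (2 * n) = q ^ (2*n+1)" by simp
    ultimately have "qfac q (2 * Suc n) = qfac q (2 * n) * (1 - q ^ (2*n+1)) * (1 - (q^2) ^ Suc n)"
      by (simp only: mult_Suc_right add_2_eq_Suc qfac_Suc)
    then show ?case unfolding Suc by (simp only: qfac_Suc prod.lessThan_Suc mult_ac)
  qed simp
  have factor: "(1 + (-1) * a) * (-1 + a) = (-1) * ((1 - a) * (1 - a))" for a :: 'a
    by (simp add: algebra_simps)
  have "(-1) ^ n * P^2 = (\<Prod>k<n. (1 + (-1) * q ^ (2*k+1)) * (-1 + q ^ (2*k+1)))"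
    unfolding factor prod.distrib by (simp add: P_def power2_eq_square)
  also have "\<dots> = (\<Sum>k\<le>2*n. gbin (q^2) (2*n) k * q ^ nat ((int k - int n)^2) * (-1) ^ k)"
    by (rule finite_jacobi_triple[OF q])
  finally have eq: "(-1) ^ n * P^2 = (\<Sum>k\<le>2*n. gbin (q^2) (2*n) k * q ^ nat ((int k - int n)^2) *
      (-1) ^ k)" .
  have "(-1 :: 'a) ^ n * (-1) ^ n = 1" by (simp flip: power_mult_distrib)
  then have "P^2 = (-1) ^ n * ((-1) ^ n * P^2)" by (simp only: mult.assoc[symmetric] mult_1)
  also have "\<dots> = (\<Sum>k\<le>2*n. (-1) ^ (n + k) * (q ^ nat ((int k - int n)^2) * gbin (q^2) (2*n) k))"
    unfolding eq sum_distrib_left by (intro sum.cong refl) (simp add: power_add mult_ac)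
  finally have P2: "P^2 = (\<Sum>k\<le>2*n. (-1) ^ (n + k) * (q ^ nat ((int k - int n)^2) * gbin (q^2) (2*n)
      k))" .
  have "qfac q (2 * n) ^ 2 = qfac (q^2) n * (P^2 * qfac (q^2) n)"
    unfolding split by (simp add: power2_eq_square mult_ac)
  then show ?thesis unfolding P2 sum_distrib_right mult.assoc .
qed

lemma gauss_cong:
  fixes e n :: nat
  assumes e: "e \<ge> 1"
  defines "y \<equiv> fps_X ^ e :: real fps"
  shows "y ^ Suc n dvd euler_fps e ^ 2 - euler_fps (2 * e) * (\<Sum>k\<le>2*n. (-1) ^ (n + k) * y ^ nat
      ((int k - int n)^2))"
proof -
  have y0: "y \<noteq> 0" by (simp add: y_def)
  have y2: "y^2 = fps_X ^ (2 * e)" by (simp add: y_def mult.commute flip: power_mult)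
  have e2: "2 * e \<ge> 1" using e by simp
  define G where "G = (\<Sum>k\<le>2*n. (-1) ^ (n + k) * y ^ nat ((int k - int n)^2))"
  define S where "S = (\<Sum>k\<le>2*n. (-1) ^ (n + k) * (y ^ nat ((int k - int n)^2) * (gbin (y^2) (2*n) k
      * qfac (y^2) n)))"
  have split: "qfac y (2 * n) ^ 2 = qfac (y^2) n * S"
    unfolding S_def by (rule finite_gauss[OF y0])
  have "S - G = (\<Sum>k\<le>2*n. (-1) ^ (n + k) * (y ^ nat ((int k - int n)^2) * (gbin (y^2) (2*n) k * qfac
      (y^2) n - 1)))"
    unfolding S_def G_def sum_subtractf[symmetric] by (simp only: right_diff_distrib mult_1_right)
  also have "y ^ Suc n dvd \<dots>"
  proof (rule dvd_sum, rule dvd_mult)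
    fix k assume "k \<in> {..2*n}"
    then have k: "k \<le> 2*n" by simp
    \<comment> \<open>Near the ends of the range the binomial is accurate only to order m + 1 in
      y^2, but there the exponent (k - n)^2 = D^2 is large: n = m + D and D <= D^2 give total order
      at least n + 1.\<close>
    define m where "m = min k (2*n - k)"
    define D where "D = nat \<bar>int k - int n\<bar>"
    have nD: "n = m + D" using k by (auto simp: m_def D_def)
    have "int D * int D = (int k - int n)^2" by (simp add: D_def power2_eq_square)
    then have sq: "nat ((int k - int n)^2) = D * D" by (metis nat_int of_nat_mult)
    have "D \<le> D * D" by (cases D) auto
    then have "D + 2 * Suc m \<le> D * D + 2 * Suc m" by (rule add_right_mono)
    moreover have "Suc n \<le> D + 2 * Suc m" using nD by simp
    ultimately have "Suc n \<le> D * D + 2 * Suc m" by (rule order.trans[rotated])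
    then have "y ^ Suc n dvd y ^ (D * D + 2 * Suc m)" by (rule le_imp_power_dvd)
    also have "y ^ (D * D + 2 * Suc m) = y ^ (D * D) * (y^2) ^ Suc m"
      by (simp only: power_add power_mult[of y 2 "Suc m"])
    also have "\<dots> dvd y ^ nat ((int k - int n)^2) * (gbin (y^2) (2*n) k * qfac (y^2) n - 1)"
      unfolding sq
    proof (rule mult_dvd_mono[OF dvd_refl])
      show "(y^2) ^ Suc m dvd gbin (y^2) (2*n) k * qfac (y^2) n - 1"
        unfolding y2 by (rule gbin_fps_cong[OF e2]) (use k in \<open>auto simp: m_def\<close>)
    qed
    finally show "y ^ Suc n dvd y ^ nat ((int k - int n)^2) * (gbin (y^2) (2*n) k * qfac (y^2) n -
        1)" .
  qed
  finally have 1: "y ^ Suc n dvd S - G" .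
  have 2: "y ^ Suc n dvd euler_fps e - qfac y (2*n)"
  proof -
    have "y ^ Suc n dvd y ^ Suc (2*n)" by (intro le_imp_power_dvd) auto
    also have "\<dots> dvd euler_fps e - qfac y (2*n)" unfolding y_def by (rule euler_fps_cong[OF e])
    finally show ?thesis .
  qed
  have 3: "y ^ Suc n dvd euler_fps (2*e) - qfac (y^2) n"
  proof -
    have "y ^ Suc n dvd y ^ (2 * Suc n)" by (intro le_imp_power_dvd) auto
    also have "y ^ (2 * Suc n) = (y^2) ^ Suc n" by (rule power_mult)
    also have "\<dots> dvd euler_fps (2*e) - qfac (y^2) n" unfolding y2 by (rule euler_fps_cong[OF e2])
    finally show ?thesis .
  qed
  have "euler_fps e ^ 2 - euler_fps (2*e) * G =
      (euler_fps e - qfac y (2*n)) * (euler_fps e + qfac y (2*n)) + qfac (y^2) n * (S - G)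
       - (euler_fps (2*e) - qfac (y^2) n) * G"
    using split by (simp add: algebra_simps power2_eq_square)
  also have "y ^ Suc n dvd \<dots>"
    by (rule dvd_diff[OF dvd_add[OF dvd_mult2[OF 2] dvd_mult[OF 1]] dvd_mult2[OF 3]])
  finally show ?thesis unfolding G_def .
qed

section \<open>The coefficients as weighted counts of lattice points\<close>

definition lattice_points :: "nat \<Rightarrow> nat \<Rightarrow> (nat \<times> int) set" where
  "lattice_points r n = {(j, m). (2 * int j + 1)^2 + 4 * int r * m^2 = int n}"

text \<open>(-1)^j (2 j + 1) comes from Jacobi's series for the cube, (-1)^m from Gauss's
  series.\<close>

definition lattice_weight :: "nat \<times> int \<Rightarrow> real" where
  "lattice_weight = (\<lambda>(j, m). (-1) ^ (j + nat \<bar>m\<bar>) * (2 * real j + 1))"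

lemma lattice_points_subset:
  assumes "r \<ge> 1"
  shows "lattice_points r n \<subseteq> {..n} \<times> {-int n..int n}"
proof (rule subsetI)
  fix p assume "p \<in> lattice_points r n"
  then obtain j m where p: "p = (j, m)" and eq: "(2 * int j + 1)^2 + 4 * int r * m^2 = int n"
      by (auto simp: lattice_points_def)
  have rm: "0 \<le> int r * m^2" "m^2 \<le> int r * m^2"
    using assms mult_right_mono[of 1 "int r" "m^2"] by auto
  have "int j \<le> (2 * int j + 1)^2" by (simp add: power2_eq_square algebra_simps)
  then have "int j \<le> int n" using eq rm by linarith
  then have "j \<le> n" by simp
  moreover have "\<bar>m\<bar> \<le> m^2" using self_le_power[of "\<bar>m\<bar>" 2] by (cases "m = 0") auto
  moreover have "m^2 \<le> int n" using eq rm zero_le_power2[of "2 * int j + 1"] by linarith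
  ultimately show "p \<in> {..n} \<times> {-int n..int n}" using p by auto
qed

lemma finite_lattice_points: "r \<ge> 1 \<Longrightarrow> finite (lattice_points r n)"
  by (rule finite_subset[OF lattice_points_subset]) auto

text \<open>The extra factor X turns the exponents 8 (j (j + 1) / 2) of the cube series into (2 j +
  1)^2, and Gauss's series in X^(4 r) adds 4 r m^2. Truncating both series at n leaves the
  coefficient of X^n unchanged.\<close>

theorem b_coeff_eq:
  assumes r: "r \<ge> 1"
  shows "b_coeff r n = sum lattice_weight (lattice_points r n)"
proof -
  define J where "J = (\<Sum>j\<le>n. (-1) ^ j * of_nat (2*j+1) * (fps_X ^ 8) ^ (Suc j choose 2) :: real
      fps)"
  define G where "G = (\<Sum>k\<le>2*n. (-1) ^ (n + k) * (fps_X ^ (4*r)) ^ nat ((int k - int n)^2) :: real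
      fps)"
  define F where "F = euler_fps 8 ^ 3 * euler_fps (4 * r) ^ 2 / euler_fps (8 * r)"
  have r4: "4 * r \<ge> 1" and r8: "8 * r \<ge> 1" using r by auto
  let ?X = "fps_X ^ Suc n :: real fps"
  have E: "fps_nth (euler_fps (8 * r)) 0 = 1" by (rule euler_fps_nth_0[OF r8])
  then have unit: "euler_fps (8 * r) dvd 1" "euler_fps (8 * r) \<noteq> 0" by auto
  have FE: "F * euler_fps (8 * r) = euler_fps 8 ^ 3 * euler_fps (4 * r) ^ 2"
    unfolding F_def by (rule dvd_div_mult_self) (use E in simp)
  have 1: "?X dvd euler_fps 8 ^ 3 - J"
  proof -
    let ?x = "fps_X ^ 8 :: real fps"
    have X: "?X dvd ?x ^ Suc n" unfolding power_mult[symmetric] by (intro le_imp_power_dvd) auto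
    have a: "?x ^ Suc n dvd qfac ?x n ^ 3 - J" unfolding J_def by (rule qfac_cube_cong) simp
    have b: "?x ^ Suc n dvd euler_fps 8 - qfac ?x n" by (rule euler_fps_cong) simp
    have c: "euler_fps 8 ^ 3 - J = (euler_fps 8 - qfac ?x n) * (euler_fps 8 ^ 2 + euler_fps 8 *
        qfac ?x n + qfac ?x n ^ 2) + (qfac ?x n ^ 3 - J)"
      by (simp add: algebra_simps power2_eq_square power3_eq_cube)
    show ?thesis unfolding c by (rule dvd_add[OF dvd_mult2[OF dvd_trans[OF X b]] dvd_trans[OF X a]])
  qed
  have 2: "?X dvd euler_fps (4 * r) ^ 2 - euler_fps (8 * r) * G"
  proof -
    have "1 * Suc n \<le> 4 * r * Suc n" using r by (intro mult_right_mono) auto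
    then have "?X dvd (fps_X ^ (4 * r)) ^ Suc n"
      unfolding power_mult[symmetric] by (intro le_imp_power_dvd) simp
    moreover have "(fps_X ^ (4 * r)) ^ Suc n dvd euler_fps (4 * r) ^ 2 - euler_fps (8 * r) * G"
      using gauss_cong[OF r4, of n] unfolding G_def by simp
    ultimately show ?thesis by (rule dvd_trans)
  qed
  \<comment> \<open>The denominator has constant coefficient 1 and is a unit, so the congruence may
    be proved after multiplying by it.\<close>
  have "(F - J * G) * euler_fps (8 * r) = (euler_fps 8 ^ 3 - J) * euler_fps (4 * r) ^ 2 + J *
      (euler_fps (4 * r) ^ 2 - euler_fps (8 * r) * G)"
    unfolding left_diff_distrib FE by (simp add: algebra_simps)
  also have "?X dvd \<dots>" by (rule dvd_add[OF dvd_mult2[OF 1] dvd_mult[OF 2]])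
  finally have "?X dvd F - J * G" using unit(1) dvd_mult_unit_iff by metis
  then have "?X dvd fps_X * (F - J * G)" by (rule dvd_mult)
  then have "fps_nth (fps_X * (F - J * G)) n = 0"
    unfolding fps_X_power_dvd_iff by simp
  then have "fps_nth (fps_X * F) n = fps_nth (fps_X * (J * G)) n"
    by (simp only: right_diff_distrib fps_sub_nth right_minus_eq)
  then have "b_coeff r n = fps_nth (fps_X * (J * G)) n"
    by (simp add: b_coeff_def F_def)
  also have "J * G = (\<Sum>j\<le>n. \<Sum>k\<le>2*n. ((-1) ^ j * of_nat (2*j+1) * (fps_X ^ 8) ^ (Suc j choose 2)) *
      ((-1) ^ (n + k) * (fps_X ^ (4*r)) ^ nat ((int k - int n)^2)))"
    unfolding J_def G_def by (rule sum_product)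
  also have "fps_X * \<dots> = (\<Sum>j\<le>n. \<Sum>k\<le>2*n. fps_const ((-1) ^ j * (2 * real j + 1) * (-1) ^ (n + k)) *
        fps_X ^ nat ((2 * int j + 1)^2 + 4 * int r * (int k - int n)^2))"
    unfolding sum_distrib_left
  proof (intro sum.cong refl)
    fix j k
    have sq: "int (nat ((int k - int n)^2)) = (int k - int n)^2" by simp
    have "int (2 * (Suc j choose 2)) = int j * int j + int j" unfolding two_choose_two by simp
    then have "8 * int (Suc j choose 2) + 1 = (2 * int j + 1)^2"
        by (simp add: power2_eq_square algebra_simps)
    then have "(2 * int j + 1)^2 + 4 * int r * (int k - int n)^2 =
        int (1 + 8 * (Suc j choose 2) + 4 * r * nat ((int k - int n)^2))"
      unfolding of_nat_add of_nat_mult sq by simp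
    then have e: "nat ((2 * int j + 1)^2 + 4 * int r * (int k - int n)^2) =
        1 + 8 * (Suc j choose 2) + 4 * r * nat ((int k - int n)^2)"
      by (metis nat_int)
    have c: "fps_const ((-1) ^ j * (2 * real j + 1) * (-1) ^ (n + k)) =
        (-1) ^ j * of_nat (2*j+1) * (-1) ^ (n + k)"
    proof -
      have odd: "2 * real j + 1 = of_nat (2*j+1)" by simp
      have "fps_const (-1) = (-1 :: real fps)" by (simp flip: fps_const_neg)
      then show ?thesis unfolding odd by (simp only: fps_of_nat flip: fps_const_mult
          fps_const_power)
    qed
    show "fps_X * ((-1) ^ j * of_nat (2*j+1) * (fps_X ^ 8) ^ (Suc j choose 2) * ((-1) ^ (n + k) *
        (fps_X ^ (4 * r)) ^ nat ((int k - int n)^2))) =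
      fps_const ((-1) ^ j * (2 * real j + 1) * (-1) ^ (n + k)) * fps_X ^ nat ((2 * int j + 1)^2 + 4
          * int r * (int k - int n)^2)"
      unfolding e unfolding c unfolding power_add power_mult by (simp add: mult_ac)
  qed
  also have "fps_nth \<dots> n = (\<Sum>j\<le>n. \<Sum>k\<le>2*n. if (2 * int j + 1)^2 + 4 * int r * (int k - int n)^2 =
      int n
       then (-1) ^ j * (2 * real j + 1) * (-1) ^ (n + k) else 0)"
    unfolding fps_sum_nth
  proof (intro sum.cong refl)
    fix j k
    have "0 \<le> (2 * int j + 1)^2 + 4 * int r * (int k - int n)^2" by simp
    then have "n = nat ((2 * int j + 1)^2 + 4 * int r * (int k - int n)^2) \<longleftrightarrow> (2 * int j + 1)^2 + 4
        * int r * (int k - int n)^2 = int n"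
      by linarith
    then show "fps_nth (fps_const ((-1) ^ j * (2 * real j + 1) * (-1) ^ (n + k)) * fps_X ^ nat ((2
        * int j + 1)^2 + 4 * int r * (int k - int n)^2)) n
      = (if (2 * int j + 1)^2 + 4 * int r * (int k - int n)^2 =
          int n then (-1) ^ j * (2 * real j + 1) * (-1) ^ (n + k) else 0)"
      by (simp add: fps_X_power_nth)
  qed
  also have "\<dots> = (\<Sum>j\<le>n. \<Sum>m\<in>{-int n..int n}. if (j, m) \<in> lattice_points r n then lattice_weight (j,
      m) else 0)"
  proof (intro sum.cong refl)
    fix j
    show "(\<Sum>k\<le>2*n. if (2 * int j + 1)^2 + 4 * int r * (int k - int n)^2 = int n
       then (-1) ^ j * (2 * real j + 1) * (-1) ^ (n + k) else 0) =
       (\<Sum>m\<in>{-int n..int n}. if (j, m) \<in> lattice_points r n then lattice_weight (j, m) else 0)"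
    proof (rule sum.reindex_bij_witness[of _ "\<lambda>m. nat (m + int n)" "\<lambda>k. int k - int n"])
      fix k assume "k \<in> {..2*n}"
      have "even (n + k) \<longleftrightarrow> even (nat \<bar>int k - int n\<bar>)"
        by (auto simp: even_nat_iff)
      then have "(-1 :: real) ^ (n + k) = (-1) ^ nat \<bar>int k - int n\<bar>"
        by (simp add: minus_one_power_iff)
      then show "(if (j, int k - int n) \<in> lattice_points r n then lattice_weight (j, int k - int n)
          else 0) =
        (if (2 * int j + 1)^2 + 4 * int r * (int k - int n)^2 =
            int n then (-1) ^ j * (2 * real j + 1) * (-1) ^ (n + k) else 0)"
        by (simp add: lattice_points_def lattice_weight_def power_add)
    qed auto
  qed
  also have "\<dots> = (\<Sum>p\<in>{..n} \<times> {-int n..int n}. if p \<in> lattice_points r n then lattice_weight p else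
      0)"
    unfolding sum.cartesian_product by (intro sum.cong refl) auto
  also have "\<dots> = (\<Sum>p\<in>({..n} \<times> {-int n..int n}) \<inter> lattice_points r n. lattice_weight p)"
    by (rule sum.inter_restrict[symmetric]) simp
  also have "({..n} \<times> {-int n..int n}) \<inter> lattice_points r n = lattice_points r n"
    using lattice_points_subset[OF r] by blast
  finally show ?thesis .
qed

text \<open>The bounds 121 = 11^2 and 36 r = 4 r 3^2 exclude j >= 5 and |m| >= 3, which makes these
  coefficients computable.\<close>

lemma lattice_points_small:
  assumes r: "r \<ge> 1" and n: "n < 121" "n < 36 * r"
  shows "lattice_points r n \<subseteq> {0,1,2,3,4} \<times> {-2,-1,0,1,2}"
proof (rule subsetI)
  fix p assume "p \<in> lattice_points r n"
  then obtain j m where p: "p = (j, m)" and eq: "(2 * int j + 1)^2 + 4 * int r * m^2 = int n"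
    by (auto simp: lattice_points_def)
  have "0 \<le> int r * m^2" by simp
  then have "(2 * int j + 1)^2 < 121" using eq n by linarith
  then have "(2 * int j + 1)^2 < 11^2" by simp
  then have "2 * int j + 1 < 11" by (rule power_less_imp_less_base) simp
  then have j: "j \<in> {0,1,2,3,4}" by auto
  have "m \<in> {-2,-1,0,1,2}"
  proof (rule ccontr)
    assume "m \<notin> {-2,-1,0,1,2}"
    then have "3 \<le> \<bar>m\<bar>" by auto
    then have "3^2 \<le> \<bar>m\<bar>^2" by (intro power_mono) auto
    then have "int r * 9 \<le> int r * m^2" by (intro mult_left_mono) auto
    moreover have "0 \<le> (2 * int j + 1)^2" by simp
    ultimately show False using eq n by linarith
  qed
  with j show "p \<in> {0,1,2,3,4} \<times> {-2,-1,0,1,2}" unfolding p by (rule SigmaI)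
qed

lemma b_coeff_small:
  assumes "r \<ge> 1" "n < 121" "n < 36 * r"
  shows "b_coeff r n = (\<Sum>j\<in>{0,1,2,3,4}. \<Sum>m\<in>{-2,-1,0,1,2}.
     if (2 * int j + 1)^2 + 4 * int r * m^2 = int n then lattice_weight (j, m) else 0)"
proof -
  have "b_coeff r n = sum lattice_weight (({0,1,2,3,4} \<times> {-2,-1,0,1,2}) \<inter> lattice_points r n)"
    using lattice_points_small[OF assms] by (simp add: b_coeff_eq[OF assms(1)] Int_absorb1)
  also have "\<dots> = (\<Sum>p\<in>{0,1,2,3,4} \<times> {-2,-1,0,1,2}. if p \<in> lattice_points r n then lattice_weight p
      else 0)"
    by (rule sum.inter_restrict) simp
  also have "\<dots> = (\<Sum>j\<in>{0,1,2,3,4}. \<Sum>m\<in>{-2,-1,0,1,2}.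
     if (2 * int j + 1)^2 + 4 * int r * m^2 = int n then lattice_weight (j, m) else 0)"
    unfolding sum.cartesian_product by (intro sum.cong refl) (auto simp: lattice_points_def)
  finally show ?thesis .
qed

text \<open>In the applications m is not of the form x^2 + 4 r y^2 with x odd, but m n is: 33 = 5^2
  + 8 = 1 + 32 (total weight -10 + 2), 21 = 3^2 + 12, 77 = 7^2 + 28, 45 = 3^2 + 36 and 69 = 3^2 +
  60.\<close>

lemma not_multiplicative_seqI:
  assumes "b (m * n) \<noteq> 0" "b m = 0" "m \<ge> 1" "n \<ge> 1" "coprime m n"
  shows "\<not> multiplicative_seq b"
  using assms unfolding multiplicative_seq_def by (metis mult_zero_left)

lemma not_multiplicative_b_coeff_2: "\<not> multiplicative_seq (b_coeff 2)"
  by (rule not_multiplicative_seqI[of _ 3 11])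
     (simp_all add: b_coeff_small lattice_weight_def coprime_iff_gcd_eq_1 gcd_non_0_nat)

lemma not_multiplicative_b_coeff_3: "\<not> multiplicative_seq (b_coeff 3)"
  by (rule not_multiplicative_seqI[of _ 3 7])
     (simp_all add: b_coeff_small lattice_weight_def coprime_iff_gcd_eq_1 gcd_non_0_nat)

lemma not_multiplicative_b_coeff_7: "\<not> multiplicative_seq (b_coeff 7)"
  by (rule not_multiplicative_seqI[of _ 7 11])
     (simp_all add: b_coeff_small lattice_weight_def coprime_iff_gcd_eq_1 gcd_non_0_nat)

lemma not_multiplicative_b_coeff_9: "\<not> multiplicative_seq (b_coeff 9)"
  by (rule not_multiplicative_seqI[of _ 5 9])
     (simp_all add: b_coeff_small lattice_weight_def coprime_iff_gcd_eq_1 gcd_non_0_nat)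

lemma not_multiplicative_b_coeff_15: "\<not> multiplicative_seq (b_coeff 15)"
  by (rule not_multiplicative_seqI[of _ 3 23])
     (simp_all add: b_coeff_small lattice_weight_def coprime_iff_gcd_eq_1 gcd_non_0_nat)

lemma b_coeff_eq_0: "r \<ge> 1 \<Longrightarrow> b_coeff r 0 = 0"
  by (simp add: b_coeff_def)

section \<open>Absolute convergence and the two groupings of the lattice sum\<close>

definition lattice_term :: "nat \<Rightarrow> nat \<times> int \<Rightarrow> real" where
  "lattice_term r = (\<lambda>(j, m). lattice_weight (j, m) / ((2 * real j + 1)^2 + 4 * real r * (of_int
      m)^2)^2)"

lemma lattice_term_eq: "lattice_term r (j, m) = (-1) ^ nat \<bar>m\<bar> * char_lattice_term (2 * of_int m *
    sqrt (real r)) j"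
  by (simp add: lattice_term_def lattice_weight_def char_lattice_term_def power_add
      power_mult_distrib mult_ac)

lemma summable_on_inverse_powr_int: "(\<lambda>m::int. (1 + real_of_int \<bar>m\<bar>) powr (-3/2)) summable_on UNIV"
proof (rule summable_on_int)
  have "summable (\<lambda>n. real (Suc n) powr (-3/2))"
    by (subst summable_Suc_iff) (simp add: summable_real_powr_iff)
  then have s: "summable (\<lambda>n. (1 + real n) powr (-3/2))" by simp
  then show "summable (\<lambda>n. (1 + real_of_int \<bar>int n\<bar>) powr (-3/2))" "summable (\<lambda>n. (1 + real_of_int
      \<bar>- int n\<bar>) powr (-3/2))"
    by simp_all
qed simp

text \<open>A product bound gives summability over pairs. The term has degree 1 - 4 = -3, which is
  shared as -3/2 in each variable; a^2 + c^2 <= 3 D yields the constant 9.\<close>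

lemma abs_lattice_term:
  assumes "r \<ge> 1"
  shows "norm (lattice_term r (j, m)) \<le> 9 * ((1 + real j) powr (-3/2) * (1 + real_of_int \<bar>m\<bar>) powr
      (-3/2))"
proof -
  define a where "a = 2 * real j + 1"
  define c where "c = 1 + real_of_int \<bar>m\<bar>"
  have a: "a \<ge> 1 + real j" "a > 0" and c: "c \<ge> 1" by (auto simp: a_def c_def)
  have j: "1 + real j > 0" by simp
  define D where "D = a^2 + 4 * real r * (of_int m)^2"
  have "(of_int m)^2 \<le> real r * (of_int m :: real)^2"
      using assms mult_right_mono[of 1 "real r" "(of_int m)^2"] by simp
  then have D1: "D \<ge> a^2 + 4 * (real_of_int \<bar>m\<bar>)^2" by (simp add: D_def)
  have "c^2 \<le> 2 + 2 * (real_of_int \<bar>m\<bar>)^2"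
    using zero_le_power2[of "real_of_int \<bar>m\<bar> - 1"] by (simp add: c_def power2_eq_square
        algebra_simps)
  moreover have "1 \<le> a^2" using a by (simp add: a_def power2_eq_square algebra_simps)
  ultimately have D2: "a^2 + c^2 \<le> 3 * D" using D1 zero_le_power2[of "real_of_int \<bar>m\<bar>"] by linarith
  have "2 * a * c \<le> a^2 + c^2" using zero_le_power2[of "a - c"]
      by (simp add: power2_eq_square algebra_simps)
  have powr_le: "a powr (5/2) * c powr (3/2) \<le> (a^2 + c^2)^2"
  proof -
    have s: "a powr 2 = a^2" "c powr 2 = c^2" using a c by auto
    have "a powr (5/2) \<le> (a^2 + c^2) powr (5/4)"
    proof -
      have "a powr (5/2) = (a powr 2) powr (5/4)" by (simp add: powr_powr)
      also have "\<dots> \<le> (a^2 + c^2) powr (5/4)" unfolding s by (intro powr_mono2) auto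
      finally show ?thesis .
    qed
    moreover have "c powr (3/2) \<le> (a^2 + c^2) powr (3/4)"
    proof -
      have "c powr (3/2) = (c powr 2) powr (3/4)" by (simp add: powr_powr)
      also have "\<dots> \<le> (a^2 + c^2) powr (3/4)" unfolding s by (intro powr_mono2) auto
      finally show ?thesis .
    qed
    ultimately have "a powr (5/2) * c powr (3/2) \<le> (a^2 + c^2) powr (5/4) * (a^2 + c^2) powr (3/4)"
      by (intro mult_mono) auto
    also have "\<dots> = (a^2 + c^2)^2" using a by (simp add: powr_add[symmetric] add_pos_nonneg)
    finally show ?thesis .
  qed
  have Dpos: "D > 0" using D1 a by (intro less_le_trans[OF _ D1] add_pos_nonneg) auto
  have "a powr (5/2) * c powr (3/2) \<le> (3 * D)^2"
    using powr_le power_mono[OF D2, of 2] by (meson add_nonneg_nonneg order.trans zero_le_power2)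
  then have "a powr (5/2) * c powr (3/2) \<le> 9 * D^2" by (simp add: power_mult_distrib)
  then have "1 / D^2 \<le> 9 / (a powr (5/2) * c powr (3/2))"
    using a c Dpos by (simp add: field_simps)
  then have "a * (1 / D^2) \<le> a * (9 / (a powr (5/2) * c powr (3/2)))"
    using a by (intro mult_left_mono) auto
  also have "\<dots> = 9 * (a powr (-3/2) * c powr (-3/2))"
  proof -
    have "a powr (-3/2) = a powr (1 - 5/2)" by simp
    also have "\<dots> = a / a powr (5/2)" using a by (subst powr_diff) auto
    finally have 1: "a powr (-3/2) = a / a powr (5/2)" .
    have 2: "c powr (-3/2) = 1 / c powr (3/2)" using powr_minus_divide[of c "3/2"] by simp
    show ?thesis unfolding 1 2 by simp
  qed
  finally have main: "a * (1 / D^2) \<le> 9 * (a powr (-3/2) * c powr (-3/2))" .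
  have "norm (lattice_term r (j, m)) = a * (1 / D^2)"
    by (simp add: lattice_term_def lattice_weight_def abs_mult power_abs a_def D_def)
  also note main
  also have "9 * (a powr (-3/2) * c powr (-3/2)) \<le> 9 * ((1 + real j) powr (-3/2) * c powr (-3/2))"
    using a j by (intro mult_left_mono mult_right_mono powr_mono2') auto
  finally show ?thesis by (simp add: c_def)
qed

lemma abs_summable_lattice_term:
  assumes "r \<ge> 1"
  shows "(\<lambda>p. norm (lattice_term r p)) summable_on UNIV"
proof -
  have "summable (\<lambda>n. real (Suc n) powr (-3/2))"
    by (subst summable_Suc_iff) (simp add: summable_real_powr_iff)
  then have A: "(\<lambda>j. (1 + real j) powr (-3/2)) summable_on UNIV"
    by (intro summable_nonneg_imp_summable_on) simp_all
  note B = summable_on_inverse_powr_int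
  have "((\<lambda>(j, m). (1 + real j) powr (-3/2) * (1 + real_of_int \<bar>m\<bar>) powr (-3/2)) has_sum
     (\<Sum>\<^sub>\<infinity>j. (1 + real j) powr (-3/2)) * (\<Sum>\<^sub>\<infinity>m::int. (1 + real_of_int \<bar>m\<bar>) powr (-3/2))) (UNIV \<times>
         UNIV)"
    by (rule has_sum_product[OF has_sum_infsum[OF A] _ has_sum_infsum[OF B]])
       (use A B in \<open>simp_all del: of_int_abs\<close>)
  then have "(\<lambda>(j, m). (1 + real j) powr (-3/2) * (1 + real_of_int \<bar>m\<bar>) powr (-3/2)) summable_on
      (UNIV :: (nat \<times> int) set)"
    by (simp add: has_sum_imp_summable)
  then have s: "(\<lambda>p. 9 * (case p of (j, m) \<Rightarrow> (1 + real j) powr (-3/2) * (1 + real_of_int \<bar>m\<bar>) powr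
      (-3/2))) summable_on (UNIV :: (nat \<times> int) set)"
    by (rule summable_on_cmult_right)
  show ?thesis
    by (rule summable_on_comparison_test[OF s]) (use abs_lattice_term[OF assms] in auto)
qed

lemma has_sum_reindexI:
  assumes "(h has_sum s) T"
    and "\<And>a. a \<in> S \<Longrightarrow> i (j a) = a" "\<And>a. a \<in> S \<Longrightarrow> j a \<in> T"
    and "\<And>b. b \<in> T \<Longrightarrow> j (i b) = b" "\<And>b. b \<in> T \<Longrightarrow> i b \<in> S"
    and "\<And>a. a \<in> S \<Longrightarrow> h (j a) = g a"
  shows "(g has_sum s) S"
  using has_sum_reindex_bij_witness[of S i j T h g s s] assms by blast

lemma has_sum_int_even:
  fixes g :: "int \<Rightarrow> real"
  assumes g: "(g has_sum S) UNIV" and even: "\<And>m. g (- m) = g m"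
  shows "(\<lambda>n. 2 * g (int (Suc n))) sums (S - g 0)"
proof -
  have s: "g summable_on A" for A
    using summable_on_subset[OF has_sum_imp_summable[OF g]] by auto
  define P where "P = infsum g {0<..}"
  have P: "(g has_sum P) {0<..}" unfolding P_def by (intro has_sum_infsum s)
  have N: "(g has_sum P) {..<0}"
    by (rule has_sum_reindexI[OF P, of _ uminus uminus]) (auto simp: even)
  have Z: "(g has_sum g 0) {0}" by (simp add: has_sum_finiteI)
  have "(g has_sum ((P + P) + g 0)) (({0<..} \<union> {..<0}) \<union> {0})"
    by (intro has_sum_Un_disjoint P N Z) auto
  moreover have "({0<..} \<union> {..<0}) \<union> {0} = (UNIV :: int set)" by auto
  ultimately have S: "S = 2 * P + g 0" using g has_sum_unique by fastforce
  have "((\<lambda>n. g (int (Suc n))) has_sum P) UNIV"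
    by (rule has_sum_reindexI[OF P, of _ "\<lambda>m. nat (m - 1)" "\<lambda>n. int (Suc n)"]) auto
  then have "(\<lambda>n. g (int (Suc n))) sums P" by (rule has_sum_imp_sums)
  then show ?thesis unfolding S using sums_mult[of _ P 2] by simp
qed

text \<open>Every lattice point lies over exactly one value n of the form, and on that fibre the
  denominator is n^2.\<close>

lemma sums_b_coeff:
  assumes r: "r \<ge> 1"
  shows "(\<lambda>n. b_coeff r (Suc n) / real (Suc n) ^ 2) sums infsum (lattice_term r) UNIV"
proof -
  have "(lattice_term r has_sum infsum (lattice_term r) UNIV) UNIV"
    by (rule has_sum_infsum[OF abs_summable_summable[OF abs_summable_lattice_term[OF r]]])
  then have "((\<lambda>x. lattice_term r (snd x)) has_sum infsum (lattice_term r) UNIV) (SIGMA n:UNIV.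
      lattice_points r n)"
    by (rule has_sum_reindexI[where j = snd and i = "\<lambda>(j, m). (nat ((2 * int j + 1)^2 + 4 * int r *
        m^2), (j, m))"])
       (auto simp: lattice_points_def)
  moreover have "((\<lambda>p. lattice_term r (snd (n, p))) has_sum b_coeff r n / real n ^ 2)
      (lattice_points r n)" for n
  proof (rule has_sum_finiteI[OF finite_lattice_points[OF r]])
    have "lattice_term r p = lattice_weight p / real n ^ 2" if "p \<in> lattice_points r n" for p
    proof -
      obtain j m where p: "p = (j, m)" by (cases p)
      then have "(2 * int j + 1)^2 + 4 * int r * m^2 = int n" using that
          by (simp add: lattice_points_def)
      then have "real_of_int ((2 * int j + 1)^2 + 4 * int r * m^2) = real_of_int (int n)"
          by (simp only:)
      then have "(2 * real j + 1)^2 + 4 * real r * (of_int m)^2 = real n" by simp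
      then show ?thesis by (simp add: lattice_term_def p)
    qed
    then show "b_coeff r n / real n ^ 2 = (\<Sum>p\<in>lattice_points r n. lattice_term r (snd (n, p)))"
      by (simp add: b_coeff_eq[OF r] sum_divide_distrib)
  qed
  ultimately have "((\<lambda>n. b_coeff r n / real n ^ 2) has_sum infsum (lattice_term r) UNIV) UNIV"
    by (rule has_sum_SigmaD)
  then have "(\<lambda>n. b_coeff r n / real n ^ 2) sums infsum (lattice_term r) UNIV"
    by (rule has_sum_imp_sums)
  then show ?thesis by (subst sums_Suc_iff) (simp add: b_coeff_eq_0[OF r])
qed

text \<open>Row by row: m = 0 contributes pi^3 / 32, which scales to pi y / 2 = - ln q / 2, and the
  rows n and -n together give the n-th hyperbolic term.\<close>

lemma infsum_lattice_term:
  assumes r: "r \<ge> 1"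
  defines "q \<equiv> nome r" and "y \<equiv> sqrt (real r)"
  shows "16 * y / pi^2 * infsum (lattice_term r) UNIV =
     - ln q / 2 + (\<Sum>n. (-1) ^ n * (1 - q ^ (2*n)) / (1 + q ^ (2*n)) * sech_coeff q n / real n)"
proof -
  let ?T = "\<lambda>n. (-1) ^ n * (1 - q ^ (2*n)) / (1 + q ^ (2*n)) * sech_coeff q n / real n"
  have y: "y > 0" using r by (simp add: y_def)
  define S where "S = infsum (lattice_term r) UNIV"
  have "(lattice_term r has_sum S) UNIV"
    unfolding S_def by (rule has_sum_infsum[OF abs_summable_summable[OF
        abs_summable_lattice_term[OF r]]])
  then have "((\<lambda>(m, j). lattice_term r (j, m)) has_sum S) (UNIV \<times> UNIV)"
    by (rule has_sum_reindexI[where i = prod.swap and j = prod.swap]) auto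
  moreover define g where "g = (\<lambda>m::int. (-1) ^ nat \<bar>m\<bar> * (\<Sum>j. char_lattice_term (2 * of_int m * y)
      j))"
  have "((\<lambda>j. case (m, j) of (m, j) \<Rightarrow> lattice_term r (j, m)) has_sum g m) UNIV" for m :: int
  proof -
    have "(char_lattice_term (2 * of_int m * y) has_sum (\<Sum>j. char_lattice_term (2 * of_int m * y)
        j)) UNIV"
      by (intro norm_summable_imp_has_sum summable_char_lattice_term summable_sums
          summable_norm_cancel[OF summable_char_lattice_term])
    then show ?thesis unfolding g_def by (simp add: lattice_term_eq y_def has_sum_cmult_right)
  qed
  ultimately have g: "(g has_sum S) UNIV" by (rule has_sum_SigmaD)
  have "char_lattice_term (- t) = char_lattice_term t" for t
      by (simp add: char_lattice_term_def fun_eq_iff)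
  then have "g (- m) = g m" for m by (simp add: g_def)
  then have sums: "(\<lambda>n. 2 * g (int (Suc n))) sums (S - g 0)" by (rule has_sum_int_even[OF g])
  have q: "0 < q" "q < 1" unfolding q_def by (rule nome_bounds[OF r])+
  have T: "2 * g (int n) = pi^2 / (16 * y) * ?T n" if "n > 0" for n
  proof -
    \<comment> \<open>E = q^(-n); multiplied by E, numerators and denominators in q^n turn into sinh
      and cosh.\<close>
    define E where "E = exp (pi * real n * y)"
    have E: "E > 0" by (simp add: E_def)
    have qn: "q ^ n = inverse E"
      by (simp add: q_def nome_def E_def y_def mult_ac flip: exp_of_nat_mult exp_minus)
    have c: "cosh (pi * real n * y) = (E + inverse E) / 2" and s: "sinh (pi * real n * y) =
        (E - inverse E) / 2"
      by (simp_all add: cosh_def sinh_def E_def exp_minus)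
    have q2n: "q ^ (2*n) = inverse E ^ 2" using qn by (simp add: power_mult mult.commute
        power2_eq_square flip: power_add mult_2)
    have half: "(a / 2) / (b / 2) = a / b" "1 / (b / 2) = 2 / b" for a b :: real by simp_all
    have e: "E * (1 - inverse E ^ 2) = E - inverse E" "E * (1 + inverse E ^ 2) =
        E + inverse E" "E * (2 * inverse E) = 2"
      using E by (simp_all add: power2_eq_square algebra_simps)
    have "(1 - q ^ (2*n)) / (1 + q ^ (2*n)) = (E * (1 - inverse E ^ 2)) / (E * (1 + inverse E ^ 2))"
      unfolding q2n using E by simp
    also have "\<dots> = tanh (pi * real n * y)"
      unfolding tanh_def c s e by (rule half(1)[symmetric])
    finally have "(1 - q ^ (2*n)) / (1 + q ^ (2*n)) = tanh (pi * real n * y)" .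
    moreover have "sech_coeff q n = 1 / cosh (pi * real n * y)"
    proof -
      have "sech_coeff q n = (E * (2 * inverse E)) / (E * (1 + inverse E ^ 2))"
        unfolding sech_coeff_def q2n qn using E by simp
      then show ?thesis unfolding c e half(2) .
    qed
    ultimately have "?T n = (-1) ^ n * tanh (pi * real n * y) / cosh (pi * real n * y) / real n"
    proof -
      assume t: "(1 - q ^ (2*n)) / (1 + q ^ (2*n)) = tanh (pi * real n * y)" and u: "sech_coeff q n
          = 1 / cosh (pi * real n * y)"
      have "a * b / c * d / k = a * (b / c) * d / k" for a b c d k :: real by simp
      then have "?T n = (-1) ^ n * ((1 - q ^ (2*n)) / (1 + q ^ (2*n))) * sech_coeff q n / real n" .
      then show ?thesis unfolding t u by simp
    qed
    moreover have "2 * g (int n) = 2 * ((-1) ^ n * (pi^2 / (16 * (2 * real n * y)) * tanh (pi * (2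
        * real n * y) / 2) / cosh (pi * (2 * real n * y) / 2)))"
      using that y by (simp add: g_def char_lattice_sum_nonzero)
    ultimately show ?thesis using that y by (simp add: mult_ac)
  qed
  have g0: "g 0 = pi^3 / 32" by (simp add: g_def char_lattice_sum_zero)
  have "(\<lambda>n. pi^2 / (16 * y) * ?T (Suc n)) sums (S - pi^3 / 32)"
  proof -
    have "2 * g (int (Suc n)) = pi^2 / (16 * y) * ?T (Suc n)" for n by (rule T) simp
    then show ?thesis using sums unfolding g0 by (simp only:)
  qed
  then have "(\<lambda>n. 16 * y / pi^2 * (pi^2 / (16 * y) * ?T (Suc n))) sums (16 * y / pi^2 * (S - pi^3 /
      32))"
    by (rule sums_mult)
  moreover have "16 * y / pi^2 * (pi^2 / (16 * y) * a) = a" for a using y by simp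
  ultimately have "(\<lambda>n. ?T (Suc n)) sums (16 * y / pi^2 * (S - pi^3 / 32))" by (simp only:)
  then have "?T sums (16 * y / pi^2 * (S - pi^3 / 32) + ?T 0)"
      by (rule sums_Suc_iff[of ?T, THEN iffD1])
  then have "?T sums (16 * y / pi^2 * (S - pi^3 / 32))" by simp
  then have "suminf ?T = 16 * y / pi^2 * (S - pi^3 / 32)" by (simp add: sums_iff)
  moreover have "- ln q / 2 = pi * y / 2" by (simp add: q_def nome_def y_def)
  ultimately show ?thesis unfolding S_def[symmetric]
    by (simp add: right_diff_distrib power2_eq_square power3_eq_cube)
qed

theorem mahler_m_eq_b_coeff_sum:
  assumes r: "r \<ge> 1"
  shows "summable (\<lambda>n. b_coeff r (Suc n) / real (Suc n) ^ 2)"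
    and "mahler_m (8 * \<i> * of_real (class_g r ^ 8 * class_G r ^ 4)) =
              16 * sqrt (real r) / pi ^ 2 * (\<Sum>n. b_coeff r (Suc n) / real (Suc n) ^ 2)"
proof -
  show "summable (\<lambda>n. b_coeff r (Suc n) / real (Suc n) ^ 2)"
    using sums_b_coeff[OF r] by (rule sums_summable)
  have "8 * \<i> * complex_of_real (class_g r ^ 8 * class_G r ^ 4) =
      \<i> * of_real (8 * class_g r ^ 8 * class_G r ^ 4)"
    by simp
  also have "\<dots> = \<i> * of_real (4 * modulus_ratio (nome r))"
    by (simp only: class_invariants_eq_modulus_ratio[OF r])
  finally have eq: "8 * \<i> * complex_of_real (class_g r ^ 8 * class_G r ^ 4) =
      \<i> * of_real (4 * modulus_ratio (nome r))" .
  have "mahler_m (8 * \<i> * of_real (class_g r ^ 8 * class_G r ^ 4)) =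
      mahler_m (\<i> * of_real (4 * modulus_ratio (nome r)))"
    by (simp only: eq)
  also have "\<dots> = 16 * sqrt (real r) / pi^2 * infsum (lattice_term r) UNIV"
    unfolding mahler_m_modulus_ratio[OF nome_bounds[OF r]] infsum_lattice_term[OF r] ..
  also have "infsum (lattice_term r) UNIV = (\<Sum>n. b_coeff r (Suc n) / real (Suc n) ^ 2)"
    by (rule sums_unique[OF sums_b_coeff[OF r]])
  finally show "mahler_m (8 * \<i> * of_real (class_g r ^ 8 * class_G r ^ 4)) =
              16 * sqrt (real r) / pi ^ 2 * (\<Sum>n. b_coeff r (Suc n) / real (Suc n) ^ 2)" .
qed

subsection \<open>Inversion of theta series\<close>

text \<open>A geometric sum whose ratio is a 2h-th root of unity detects the multiples of 2 h. The
  offset \<open>e\<close>, 0 or 1 in the application, selects integer or half-integer nodes and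
  reappears as a sign.\<close>

lemma sum_cis_multiples:
  fixes h :: nat and n :: int and e :: nat
  assumes h: "h \<ge> 1"
  shows "(\<Sum>k\<in>{-int h..<int h}. cis (pi * of_int ((2 * k + int e) * n) / of_nat (2 * h))) =
    (if int (2 * h) dvd n then of_nat (2 * h) * (-1) ^ (e * nat \<bar>n div int (2 * h)\<bar>) else 0)"
proof -
  let ?l = "int (2 * h)"
  have l: "?l > 0" using h by simp
  define z where "z = cis (2 * pi * of_int n / of_int ?l)"
  \<comment> \<open>The summand for k = -h, while z is the common ratio.\<close>
  define c where "c = cis (pi * of_int (int e * n) / of_int ?l - 2 * pi * of_int (int h * n) /
      of_int ?l)"
  have "(\<Sum>k\<in>{-int h..<int h}. cis (pi * of_int ((2 * k + int e) * n) / of_nat (2 * h))) =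
      (\<Sum>i<2*h. c * z ^ i)"
  proof (rule sum.reindex_bij_witness[of _ "\<lambda>i. int i - int h" "\<lambda>k. nat (k + int h)"])
    fix k assume k: "k \<in> {-int h..<int h}"
    define i where "i = nat (k + int h)"
    have ki: "k = int i - int h" using k by (simp add: i_def)
    have "c * z ^ i = cis (pi * of_int (int e * n) / of_int ?l - 2 * pi * of_int (int h * n) /
        of_int ?l + real i * (2 * pi * of_int n / of_int ?l))"
      by (simp add: c_def z_def Complex.DeMoivre cis_mult)
    also have "pi * of_int (int e * n) / of_int ?l - 2 * pi * of_int (int h * n) / of_int ?l + real
        i * (2 * pi * of_int n / of_int ?l)
        = pi * of_int ((2 * k + int e) * n) / of_nat (2 * h)"
      using h by (simp add: ki field_simps)
    finally show "c * z ^ nat (k + int h) = cis (pi * of_int ((2 * k + int e) * n) / of_nat (2 *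
        h))" by (simp add: i_def)
  qed auto
  also have "\<dots> = c * (\<Sum>i<2*h. z ^ i)" by (simp add: sum_distrib_left)
  also have "\<dots> = (if int (2 * h) dvd n then of_nat (2 * h) * (-1) ^ (e * nat \<bar>n div int (2 * h)\<bar>)
      else 0)"
  proof (cases "?l dvd n")
    case True
    then obtain j where n: "n = ?l * j" by (elim dvdE)
    have "z = cis (2 * pi * of_int j)" using h by (simp add: z_def n mult_ac)
    then have "z = 1" by (simp add: complex_eq_iff cos_int_2pin sin_int_2pin)
    moreover have "c = (-1) ^ (e * nat \<bar>j\<bar>)"
    proof -
      have "c = cis (real e * (pi * of_int j) - 2 * pi * of_int (int h * j))"
        using h by (simp add: c_def n field_simps)
      also have "\<dots> = cis (real e * (pi * of_int j)) / cis (2 * pi * of_int (int h * j))"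
        by (rule cis_divide[symmetric])
      also have "cis (2 * pi * of_int (int h * j)) = 1"
        using cos_int_2pin[of "int h * j"] sin_int_2pin[of "int h * j"]
            by (simp add: complex_eq_iff mult_ac)
      also have "cis (real e * (pi * of_int j)) = cis (pi * of_int j) ^ e"
        by (simp add: Complex.DeMoivre)
      also have "cis (pi * of_int j) = (-1) ^ nat \<bar>j\<bar>"
      proof -
        have c: "cis (real k * pi) = (-1) ^ k" for k using Complex.DeMoivre[of pi k] by simp
        show ?thesis
      proof (cases "j \<ge> 0")
        case True
        then have "j = int (nat \<bar>j\<bar>)" by simp
        then have "cis (pi * of_int j) = cis (real (nat \<bar>j\<bar>) * pi)"
            by (metis mult.commute of_int_of_nat_eq)
        then show ?thesis by (simp only: c)
      next
        case False
        then have "j = - int (nat \<bar>j\<bar>)" by simp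
        then have "real_of_int j = - real (nat \<bar>j\<bar>)" by (metis of_int_minus of_int_of_nat_eq)
        then have "cis (pi * of_int j) = inverse (cis (real (nat \<bar>j\<bar>) * pi))"
            by (simp add: mult.commute)
        also have "\<dots> = inverse ((-1) ^ nat \<bar>j\<bar>)" by (simp only: c)
        finally show ?thesis by (simp add: power_inverse[symmetric])
      qed
      qed
      finally show ?thesis by (simp add: mult.commute flip: power_mult)
    qed
    ultimately show ?thesis using True l by (simp add: n mult.commute)
  next
    case False
    have "z \<noteq> 1"
    proof
      assume "z = 1"
      then have "cos (2 * pi * of_int n / of_int ?l) = 1" by (simp add: z_def complex_eq_iff)
      then obtain x :: int where "2 * pi * of_int n / of_int ?l = of_int x * (2 * pi)"
        using cos_one_2pi_int by auto
      then have "real_of_int n = of_int x * of_int ?l" using l by (simp add: field_simps)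
      then have "n = x * ?l" by (metis of_int_eq_iff of_int_mult)
      then show False using False by simp
    qed
    moreover have "z ^ (2 * h) = cis (2 * pi * of_int n)"
      unfolding z_def Complex.DeMoivre by (rule arg_cong[where f = cis]) (use h in simp)
    then have "z ^ (2 * h) = 1" by (simp add: complex_eq_iff cos_int_2pin sin_int_2pin)
    ultimately show ?thesis using False by (simp add: geometric_sum)
  qed
  finally show ?thesis .
qed

text \<open>Binomial coefficients counted from the centre. The case distinction matters for n < -m,
  where \<open>nat\<close> would truncate to 0 and give the value 1.\<close>

definition shifted_choose :: "nat \<Rightarrow> int \<Rightarrow> real" where
  "shifted_choose m n = (if \<bar>n\<bar> \<le> int m then real ((2 * m) choose nat (int m + n)) else 0)"

text \<open>A finite Poisson summation: after expanding the power by the binomial theorem, only the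
  frequencies divisible by 2 h survive the sum over the nodes.\<close>

lemma sum_cos_power:
  assumes h: "h \<ge> 1"
  shows "(\<Sum>k\<in>{-int h..<int h}. (2 * cos (pi * of_int (2 * k + int e) / of_nat (4 * h))) ^ (2 * m)) =
      real (2 * h) * (\<Sum>\<^sub>\<infinity>j::int. (-1) ^ (e * nat \<bar>j\<bar>) * shifted_choose m (int (2 * h) * j))"
proof -
  let ?l = "int (2 * h)"
  let ?t = "\<lambda>k. pi * of_int (2 * k + int e) / of_nat (4 * h)"
  let ?d = "\<lambda>n::int. if ?l dvd n then of_nat (2 * h) * (-1) ^ (e * nat \<bar>n div ?l\<bar>) else (0 ::
      complex)"
  have l: "?l > 0" using h by simp
  have "complex_of_real ((2 * cos (?t k)) ^ (2 * m)) =
      (\<Sum>i\<le>2*m. of_nat ((2*m) choose i) * cis (pi * of_int ((2 * k + int e) * (int i - int m)) /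
          of_nat (2 * h)))" for k
  proof -
    have "complex_of_real (2 * cos (?t k)) = cis (?t k) + cis (- ?t k)"
        by (simp add: complex_eq_iff)
    then have "complex_of_real ((2 * cos (?t k)) ^ (2 * m)) = (cis (?t k) + cis (- ?t k)) ^ (2 * m)"
      by (simp only: of_real_power)
    also have "\<dots> = (\<Sum>i\<le>2*m. of_nat ((2*m) choose i) * cis (?t k) ^ i * cis (- ?t k) ^ (2 * m - i))"
      by (rule binomial_ring)
    also have "\<dots> = (\<Sum>i\<le>2*m. of_nat ((2*m) choose i) * cis (pi * of_int ((2 * k + int e) * (int i -
        int m)) / of_nat (2 * h)))"
    proof (intro sum.cong refl)
      fix i assume "i \<in> {..2*m}"
      then have "real (2 * m - i) = 2 * real m - real i" by auto
      then have "real i * ?t k + real (2 * m - i) * - ?t k =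
          pi * of_int ((2 * k + int e) * (int i - int m)) / of_nat (2 * h)"
        using h by (simp add: field_simps)
      then show "of_nat ((2*m) choose i) * cis (?t k) ^ i * cis (- ?t k) ^ (2 * m - i) =
         of_nat ((2*m) choose i) * cis (pi * of_int ((2 * k + int e) * (int i - int m)) / of_nat (2
             * h))"
        by (simp only: Complex.DeMoivre mult.assoc cis_mult)
    qed
    finally show ?thesis .
  qed
  then have "complex_of_real (\<Sum>k\<in>{-int h..<int h}. (2 * cos (?t k)) ^ (2 * m)) =
     (\<Sum>k\<in>{-int h..<int h}. \<Sum>i\<le>2*m. of_nat ((2*m) choose i) * cis (pi * of_int ((2 * k + int e) *
         (int i - int m)) / of_nat (2 * h)))"
    by (simp only: of_real_sum)
  also have "\<dots> = (\<Sum>i\<le>2*m. of_nat ((2*m) choose i) * ?d (int i - int m))"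
    unfolding sum.swap[of _ "{..2*m}"] sum_cis_multiples[OF h, symmetric]
        by (simp only: sum_distrib_left)
  also have "\<dots> = of_real (\<Sum>i\<le>2*m. (\<lambda>n. shifted_choose m n * (if ?l dvd n then real (2 * h) * (-1) ^
      (e * nat \<bar>n div ?l\<bar>) else 0)) (int i - int m))"
    unfolding of_real_sum by (intro sum.cong refl) (auto simp: shifted_choose_def)
  finally have "(\<Sum>k\<in>{-int h..<int h}. (2 * cos (?t k)) ^ (2 * m)) =
      (\<Sum>i\<le>2*m. (\<lambda>n. shifted_choose m n * (if ?l dvd n then real (2 * h) * (-1) ^ (e * nat \<bar>n div
          ?l\<bar>) else 0)) (int i - int m))"
    by (simp only: of_real_eq_iff)
  also have "\<dots> = (\<Sum>\<^sub>\<infinity>n. shifted_choose m n * (if ?l dvd n then real (2 * h) * (-1) ^ (e * nat \<bar>n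
      div ?l\<bar>) else 0))"
    by (rule infsum_nat_shift_int) (simp add: shifted_choose_def)
  also have "\<dots> = (\<Sum>\<^sub>\<infinity>n\<in>range ((*) ?l). shifted_choose m n * (real (2 * h) * (-1) ^ (e * nat \<bar>n div
      ?l\<bar>)))"
    by (rule infsum_cong_neutral) (auto elim!: dvdE)
  also have "\<dots> = (\<Sum>\<^sub>\<infinity>j. shifted_choose m (?l * j) * (real (2 * h) * (-1) ^ (e * nat \<bar>?l * j div
      ?l\<bar>)))"
    using l by (subst infsum_reindex) (auto simp: o_def inj_on_def)
  also have "\<dots> = (\<Sum>\<^sub>\<infinity>j. real (2 * h) * ((-1) ^ (e * nat \<bar>j\<bar>) * shifted_choose m (?l * j)))"
    using l by (intro infsum_cong) simp
  also have "\<dots> = real (2 * h) * (\<Sum>\<^sub>\<infinity>j. (-1) ^ (e * nat \<bar>j\<bar>) * shifted_choose m (?l * j))"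
    by (rule infsum_cmult_right')
  finally show ?thesis .
qed

text \<open>For n <= m the quotient of the binomials of 2 m over m + n and over m, written as a
  product of factors at most 1 so that exponential bounds apply.\<close>

definition central_ratio :: "nat \<Rightarrow> nat \<Rightarrow> real" where
  "central_ratio m n = (\<Prod>i<n. 1 - real n / (real m + real (Suc i)))"

lemma shifted_choose_eq:
  assumes "\<bar>n\<bar> \<le> int m"
  shows "shifted_choose m n = real ((2 * m) choose m) * central_ratio m (nat \<bar>n\<bar>)"
proof -
  have main: "real ((2 * m) choose (m + k)) = real ((2 * m) choose m) * central_ratio m k"
      if k: "k \<le> m" for k
  proof -
    have f: "fact (m + k) = fact m * (\<Prod>i<k. real m + real (Suc i))"
      by (induction k) (simp_all add: algebra_simps)
    have f': "fact m = fact (m - k) * (\<Prod>i<k. real (m - k) + real (Suc i))"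
    proof -
      have "fact ((m - k) + j) = fact (m - k) * (\<Prod>i<j. real (m - k) + real (Suc i))" for j
        by (induction j) (simp_all add: algebra_simps)
      from this[of k] show ?thesis using k by simp
    qed
    have pos: "(\<Prod>i<k. real m + real (Suc i)) > 0" by (intro prod_pos) simp
    have "central_ratio m k = (\<Prod>i<k. (real (m - k) + real (Suc i)) / (real m + real (Suc i)))"
      unfolding central_ratio_def using k by (intro prod.cong refl) (simp add: field_simps
          of_nat_diff)
    also have "\<dots> = (\<Prod>i<k. real (m - k) + real (Suc i)) / (\<Prod>i<k. real m + real (Suc i))"
      by (rule prod_dividef)
    finally have c: "central_ratio m k = (\<Prod>i<k. real (m - k) + real (Suc i)) / (\<Prod>i<k. real m + real
        (Suc i))" .
    have "real ((2 * m) choose (m + k)) = fact (2 * m) / (fact (m + k) * fact (m - k))"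
      using k by (simp add: binomial_fact)
    also have "\<dots> = fact (2 * m) / (fact m * fact m) * central_ratio m k"
      unfolding c f using f' pos by (simp add: field_simps)
    also have "fact (2 * m) / (fact m * fact m) = real ((2 * m) choose m)"
      by (simp add: binomial_fact)
    finally show ?thesis .
  qed
  show ?thesis
  proof (cases "n \<ge> 0")
    case True
    then have "nat (int m + n) = m + nat \<bar>n\<bar>" by simp
    then show ?thesis using main[of "nat \<bar>n\<bar>"] assms by (simp add: shifted_choose_def)
  next
    case False
    then have "nat (int m + n) = m - nat \<bar>n\<bar>" by simp
    moreover have "(2 * m) choose (m - nat \<bar>n\<bar>) = (2 * m) choose (m + nat \<bar>n\<bar>)"
      using assms binomial_symmetric[of "m - nat \<bar>n\<bar>" "2 * m"] by (simp add: mult_2)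
    ultimately show ?thesis using main[of "nat \<bar>n\<bar>"] assms by (simp add: shifted_choose_def)
  qed
qed

lemma central_ratio_upper:
  assumes "n \<le> m"
  shows "central_ratio m n \<le> exp (- ((real n)^2 / (real m + real n)))" "central_ratio m n \<ge> 0"
proof -
  have f: "0 \<le> 1 - real n / (real m + real (Suc i))" "1 - real n / (real m + real (Suc i)) \<le>
      exp (- (real n / (real m + real n)))" if "i < n" for i
  proof -
    show "0 \<le> 1 - real n / (real m + real (Suc i))" using assms by (simp add: field_simps)
    have "real n / (real m + real n) \<le> real n / (real m + real (Suc i))"
      using that by (intro divide_left_mono) auto
    then have "1 - real n / (real m + real (Suc i)) \<le> 1 - real n / (real m + real n)" by simp
    also have "\<dots> \<le> exp (- (real n / (real m + real n)))"
      using exp_ge_add_one_self[of "- (real n / (real m + real n))"] by simp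
    finally show "1 - real n / (real m + real (Suc i)) \<le> exp (- (real n / (real m + real n)))" .
  qed
  show "central_ratio m n \<ge> 0" unfolding central_ratio_def using f by (intro prod_nonneg) auto
  have "central_ratio m n \<le> (\<Prod>i<n. exp (- (real n / (real m + real n))))"
    unfolding central_ratio_def using f by (intro prod_mono) auto
  also have "\<dots> = exp (- ((real n)^2 / (real m + real n)))"
    by (simp add: power2_eq_square flip: exp_of_nat_mult)
  finally show "central_ratio m n \<le> exp (- ((real n)^2 / (real m + real n)))" .
qed

lemma central_ratio_lower:
  assumes "2 * n \<le> m" "m > 0"
  shows "central_ratio m n \<ge> exp (- ((real n)^2 / real m) - 2 * (real n)^3 / (real m)^2)"
proof -
  define x where "x = real n / real m"
  have x: "0 \<le> x" "x \<le> 1 / 2" using assms by (auto simp: x_def field_simps)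
  have "- x - 2 * x^2 \<le> ln (1 - x)" by (rule ln_one_minus_pos_lower_bound[OF x])
  then have e: "exp (- x - 2 * x^2) \<le> 1 - x" using x by (subst (asm) ln_ge_iff) auto
  have "(\<Prod>i<n. exp (- x - 2 * x^2)) \<le> central_ratio m n"
    unfolding central_ratio_def
  proof (intro prod_mono conjI)
    fix i
    have "real n / (real m + real (Suc i)) \<le> x" unfolding x_def using assms
        by (intro divide_left_mono) auto
    then show "exp (- x - 2 * x^2) \<le> 1 - real n / (real m + real (Suc i))" using e by linarith
  qed simp
  moreover have "(\<Prod>i<n. exp (- x - 2 * x^2)) = exp (- ((real n)^2 / real m) - 2 * (real n)^3 /
      (real m)^2)"
    using assms by (simp add: x_def power2_eq_square power3_eq_cube field_simps flip:
        exp_of_nat_mult)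
  ultimately show ?thesis by simp
qed

text \<open>Up to pi / 3 the derivative cos is at least 1/2, and beyond it sin x >= 1/2 > x / 4.
  This crude bound is enough for a Gaussian majorant of the powers of the cosine.\<close>

lemma sin_ge_quarter:
  assumes "0 \<le> x" "x \<le> pi / 2"
  shows "x / 4 \<le> sin x"
proof (cases "x \<le> pi / 3")
  case True
  have "sin 0 - 0 / 4 \<le> sin x - x / 4"
  proof (rule DERIV_nonneg_imp_nondecreasing[OF assms(1)])
    fix t assume t: "0 \<le> t" "t \<le> x"
    have "cos (pi / 3) \<le> cos t" using t True assms by (intro cos_monotone_0_pi_le) auto
    then have "0 \<le> cos t - 1 / 4" by (simp add: cos_60)
    moreover have "((\<lambda>x. sin x - x / 4) has_real_derivative (cos t - 1 / 4)) (at t)"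
      by (auto intro!: derivative_eq_intros)
    ultimately show "\<exists>y. ((\<lambda>x. sin x - x / 4) has_real_derivative y) (at t) \<and> 0 \<le> y" by blast
  qed
  then show ?thesis by simp
next
  case False
  have "sin (pi / 6) \<le> sin x" using False assms by (intro sin_monotone_2pi_le) auto
  then have "1 / 2 \<le> sin x" by (simp add: sin_30)
  then show ?thesis using assms pi_less_4 by linarith
qed

lemma cos_power_le:
  assumes "\<bar>x\<bar> \<le> pi / 2"
  shows "cos x ^ (2 * m) \<le> exp (- real m * x^2 / 16)"
proof -
  have "(\<bar>x\<bar> / 4)^2 \<le> (sin \<bar>x\<bar>)^2" using assms by (intro power_mono sin_ge_quarter) auto
  then have "x^2 / 16 \<le> (sin x)^2" by (simp add: power_divide abs_if split: if_splits)
  then have "(cos x)^2 \<le> 1 - x^2 / 16" by (simp add: cos_squared_eq)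
  also have "\<dots> \<le> exp (- (x^2 / 16))" using exp_ge_add_one_self[of "- (x^2 / 16)"] by simp
  finally have "((cos x)^2) ^ m \<le> exp (- (x^2 / 16)) ^ m" by (intro power_mono) auto
  then show ?thesis by (simp add: power_mult flip: exp_of_nat_mult)
qed

lemma tendsto_mult_sin_divide: "(\<lambda>h. real h * sin (c / real h)) \<longlonglongrightarrow> c"
proof -
  have "((\<lambda>x. sin (c * x)) has_field_derivative c) (at 0)"
    by (auto intro!: derivative_eq_intros)
  then have "((\<lambda>x. sin (c * x) / x) \<longlongrightarrow> c) (at 0)" by (simp add: DERIV_def)
  moreover have "filterlim (\<lambda>h. inverse (real h)) (at 0) sequentially"
    unfolding filterlim_at
    using eventually_gt_at_top[of "0::nat"] lim_inverse_n by (auto elim!: eventually_mono)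
  ultimately have "(\<lambda>h. sin (c * inverse (real h)) / inverse (real h)) \<longlonglongrightarrow> c"
    by (rule filterlim_compose)
  then show ?thesis by (simp add: divide_inverse mult.commute)
qed

text \<open>With this exponent m the binomial ratio at distance 2 h j tends to exp (- pi y j^2),
  while the 2m-th power of cos (pi (2 k + e) / (4 h)) tends to exp (- pi (2 k + e)^2 / (4 y)): the
  terms of the theta series at y and at 1 / y.\<close>

definition polya_exponent :: "real \<Rightarrow> nat \<Rightarrow> nat" where
  "polya_exponent y h = nat \<lfloor>4 * (real h)^2 / (pi * y)\<rfloor>"

context
  fixes y :: real
  assumes y: "y > 0"
begin

lemma polya_exponent_le: "real (polya_exponent y h) \<le> 4 * (real h)^2 / (pi * y)"
  unfolding polya_exponent_def using y by (intro of_nat_floor) auto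

lemma polya_exponent_tendsto: "(\<lambda>h. real (polya_exponent y h) / (real h)^2) \<longlonglongrightarrow> 4 / (pi * y)"
proof (rule tendsto_sandwich)
  have nz: "eventually (\<lambda>h::nat. h > 0) sequentially" by (rule eventually_gt_at_top)
  show "eventually (\<lambda>h. 4 / (pi * y) - inverse (real h) * inverse (real h) \<le>
      real (polya_exponent y h) / (real h)^2) sequentially"
    using nz
  proof eventually_elim
    case (elim h)
    have "4 * (real h)^2 / (pi * y) - 1 \<le> real (polya_exponent y h)"
      unfolding polya_exponent_def by linarith
    then have "(4 * (real h)^2 / (pi * y) - 1) / (real h)^2 \<le>
        real (polya_exponent y h) / (real h)^2"
      by (intro divide_right_mono) auto
    moreover have "(4 * (real h)^2 / (pi * y) - 1) / (real h)^2 =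
        4 / (pi * y) - inverse (real h) * inverse (real h)"
      using elim y by (simp add: field_simps power2_eq_square)
    ultimately show ?case by simp
  qed
  show "eventually (\<lambda>h. real (polya_exponent y h) / (real h)^2 \<le> 4 / (pi * y)) sequentially"
    using nz
  proof eventually_elim
    case (elim h)
    have "real (polya_exponent y h) / (real h)^2 \<le> (4 * (real h)^2 / (pi * y)) / (real h)^2"
      by (intro divide_right_mono polya_exponent_le) auto
    then show ?case using elim by simp
  qed
  show "(\<lambda>h. 4 / (pi * y) - inverse (real h) * inverse (real h)) \<longlonglongrightarrow> 4 / (pi * y)"
    using tendsto_diff[OF tendsto_const tendsto_mult[OF lim_inverse_n lim_inverse_n]] by simp
qed simp

lemma central_ratio_tendsto:
  "(\<lambda>h. if 2 * h * J \<le> polya_exponent y h then central_ratio (polya_exponent y h) (2 * h * J) else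
      0) \<longlonglongrightarrow> exp (- (pi * y * (real J)^2))"
proof -
  let ?a = "\<lambda>h. real (polya_exponent y h)"
  let ?r = "\<lambda>h. ?a h / (real h)^2"
  have py: "4 / (pi * y) > 0" "4 / (pi * y) \<noteq> 0" using y by auto
  have "(\<lambda>h. 4 * real J * inverse (real h)) \<longlonglongrightarrow> 4 * real J * 0"
    by (intro tendsto_intros lim_inverse_n)
  then have "eventually (\<lambda>h. 4 * real J * inverse (real h) < 2 / (pi * y)) sequentially"
    by (rule order_tendstoD) (use y in auto)
  moreover have "eventually (\<lambda>h. ?r h > 2 / (pi * y)) sequentially"
    by (rule order_tendstoD(1)[OF polya_exponent_tendsto]) (use y in \<open>auto simp: field_simps\<close>)
  ultimately have ev: "eventually (\<lambda>h. h > 0 \<and> 2 * (2 * h * J) \<le> polya_exponent y h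
      \<and> polya_exponent y h > 0) sequentially"
    using eventually_gt_at_top[of "0::nat"]
  proof eventually_elim
    case (elim h)
    have "?r h > 0" using elim y by (intro less_trans[OF _ elim(2)]) auto
    then have "?a h > 0" by (simp add: zero_less_divide_iff)
    have "4 * real J * inverse (real h) < ?r h" using elim by linarith
    then have "4 * real J * inverse (real h) * (real h)^2 < ?a h" using elim
        by (simp add: pos_less_divide_eq)
    moreover have "4 * real J * inverse (real h) * (real h)^2 = real (4 * J * h)"
      using elim by (simp add: power2_eq_square)
    ultimately have "real (4 * J * h) < ?a h" by simp
    then have "4 * J * h < polya_exponent y h" by (simp only: of_nat_less_iff)
    then show ?case using elim \<open>?a h > 0\<close> by (simp add: mult_ac)
  qed
  have lo: "(\<lambda>h. exp (- (4 * (real J)^2 / ?r h) - 16 * (real J)^3 * inverse (real h) / (?r h)^2)) \<longlonglongrightarrow>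
      exp (- (pi * y * (real J)^2))"
  proof -
    have "(\<lambda>h. exp (- (4 * (real J)^2 / ?r h) - 16 * (real J)^3 * inverse (real h) / (?r h)^2)) \<longlonglongrightarrow>
        exp (- (4 * (real J)^2 / (4 / (pi * y))) - 16 * (real J)^3 * 0 / (4 / (pi * y))^2)"
      using py by (intro tendsto_intros polya_exponent_tendsto lim_inverse_n) auto
    then show ?thesis by (simp add: mult_ac)
  qed
  have hi: "(\<lambda>h. exp (- (4 * (real J)^2 / (?r h + 2 * real J * inverse (real h))))) \<longlonglongrightarrow> exp (- (pi *
      y * (real J)^2))"
  proof -
    have "(\<lambda>h. exp (- (4 * (real J)^2 / (?r h + 2 * real J * inverse (real h))))) \<longlonglongrightarrow> exp (- (4 *
        (real J)^2 / (4 / (pi * y) + 2 * real J * 0)))"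
      using py by (intro tendsto_intros polya_exponent_tendsto lim_inverse_n) auto
    then show ?thesis by (simp add: mult_ac)
  qed
  show ?thesis
  proof (rule tendsto_sandwich[OF _ _ lo hi])
    show "eventually (\<lambda>h. exp (- (4 * (real J)^2 / ?r h) - 16 * (real J)^3 * inverse (real h) / (?r
        h)^2)
      \<le> (if 2 * h * J \<le> polya_exponent y h then central_ratio (polya_exponent y h) (2 * h * J) else
          0)) sequentially"
      using ev
    proof eventually_elim
      case (elim h)
      then have h: "h > 0" "2 * (2 * h * J) \<le> polya_exponent y h" "polya_exponent y h > 0" by auto
      have "- (4 * (real J)^2 / ?r h) - 16 * (real J)^3 * inverse (real h) / (?r h)^2 =
            - ((real (2 * h * J))^2 / ?a h) - 2 * (real (2 * h * J))^3 / (?a h)^2"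
        using h by (simp add: power2_eq_square power3_eq_cube field_simps)
      then show ?case using central_ratio_lower[OF h(2,3)] h by simp
    qed
    show "eventually (\<lambda>h. (if 2 * h * J \<le> polya_exponent y h then central_ratio (polya_exponent y
        h) (2 * h * J) else 0)
      \<le> exp (- (4 * (real J)^2 / (?r h + 2 * real J * inverse (real h))))) sequentially"
      using ev
    proof eventually_elim
      case (elim h)
      then have h: "h > 0" "2 * h * J \<le> polya_exponent y h" "polya_exponent y h > 0" by auto
      have "?r h + 2 * real J * inverse (real h) = (?a h + real (2 * h * J)) / (real h)^2"
        using h by (simp add: field_simps power2_eq_square)
      then have "4 * (real J)^2 / (?r h + 2 * real J * inverse (real h)) =
          (real (2 * h * J))^2 / (?a h + real (2 * h * J))"
        by (simp add: power_mult_distrib mult_ac)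
      then show ?case using central_ratio_upper(1)[OF h(2)] h by simp
    qed
  qed
qed

lemma cos_power_tendsto:
  "(\<lambda>h. cos (c / real h) ^ (2 * polya_exponent y h)) \<longlonglongrightarrow> exp (- (4 * c^2 / (pi * y)))"
proof -
  let ?a = "\<lambda>h. real (polya_exponent y h)"
  define s where "s = (\<lambda>h. (sin (c / real h))^2)"
  have ms: "(\<lambda>h. ?a h * s h) \<longlonglongrightarrow> 4 / (pi * y) * c^2"
  proof -
    have "(\<lambda>h. ?a h / (real h)^2 * (real h * sin (c / real h))^2) \<longlonglongrightarrow> 4 / (pi * y) * c^2"
      by (intro tendsto_intros polya_exponent_tendsto tendsto_mult_sin_divide)
    then show ?thesis
      by (rule Lim_transform_eventually)
         (use eventually_gt_at_top[of "0::nat"] in \<open>auto elim!: eventually_mono simp: s_def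
             power_mult_distrib\<close>)
  qed
  have s0: "s \<longlonglongrightarrow> 0"
  proof -
    have "(\<lambda>h. (sin (c * inverse (real h)))^2) \<longlonglongrightarrow> (sin (c * 0))^2"
      by (intro tendsto_intros lim_inverse_n)
    then show ?thesis by (simp add: s_def divide_inverse)
  qed
  have lo: "(\<lambda>h. exp (- (?a h * s h) - 2 * (?a h * s h) * s h)) \<longlonglongrightarrow> exp (- (4 * c^2 / (pi * y)))"
    using tendsto_exp[OF tendsto_diff[OF tendsto_minus[OF ms] tendsto_mult[OF tendsto_mult[OF
        tendsto_const[of 2] ms] s0]]] by simp
  have hi: "(\<lambda>h. exp (- (?a h * s h))) \<longlonglongrightarrow> exp (- (4 * c^2 / (pi * y)))"
    using tendsto_exp[OF tendsto_minus[OF ms]] by simp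
  have cs: "cos (c / real h) ^ (2 * polya_exponent y h) = (1 - s h) ^ polya_exponent y h" for h
    by (simp add: s_def power_mult cos_squared_eq)
  have "eventually (\<lambda>h. s h < 1 / 2) sequentially" by (rule order_tendstoD(2)[OF s0]) simp
  then have ev: "eventually (\<lambda>h. 0 \<le> s h \<and> s h \<le> 1 / 2) sequentially"
    by (auto elim!: eventually_mono simp: s_def)
  show ?thesis
  proof (rule tendsto_sandwich[OF _ _ lo hi])
    show "eventually (\<lambda>h. exp (- (?a h * s h) - 2 * (?a h * s h) * s h) \<le>
        cos (c / real h) ^ (2 * polya_exponent y h)) sequentially"
      using ev
    proof eventually_elim
      case (elim h)
      then have "- s h - 2 * (s h)^2 \<le> ln (1 - s h)" by (intro ln_one_minus_pos_lower_bound) auto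
      then have "exp (- s h - 2 * (s h)^2) \<le> 1 - s h" using elim by (subst (asm) ln_ge_iff) auto
      then have "exp (- s h - 2 * (s h)^2) ^ polya_exponent y h \<le> (1 - s h) ^ polya_exponent y h"
        by (intro power_mono) auto
      then show ?case unfolding cs by (simp add: power2_eq_square algebra_simps flip:
          exp_of_nat_mult)
    qed
    show "eventually (\<lambda>h. cos (c / real h) ^ (2 * polya_exponent y h) \<le>
        exp (- (?a h * s h))) sequentially"
      using ev
    proof eventually_elim
      case (elim h)
      have "1 - s h \<le> exp (- s h)" using exp_ge_add_one_self[of "- s h"] by simp
      then have "(1 - s h) ^ polya_exponent y h \<le> exp (- s h) ^ polya_exponent y h"
        using elim by (intro power_mono) auto
      then show ?case unfolding cs by (simp flip: exp_of_nat_mult)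
    qed
  qed
qed

text \<open>Polya's argument: divide \<open>sum_cos_power\<close> by the central binomial coefficient and let
  \<open>h \<rightarrow> \<infinity>\<close> with \<open>(2h)^2 / m \<rightarrow> \<pi> y\<close>; only the ratio of the two parities is needed, so Stirling's formula is not.\<close>

theorem theta_inversion:
  "theta (exp (- (pi * y))) (-1) * theta (exp (- (pi / y))) 1 =
     theta (exp (- (pi * y))) 1 * (exp (- (pi / (4 * y))) * theta (exp (- (pi / y))) (exp (- (pi /
         y))))"
proof -
  define q where "q = exp (- (pi * y))"
  define q' where "q' = exp (- (pi / y))"
  have q: "0 < q" "q < 1" "0 < q'" "q' < 1" using y by (auto simp: q_def q'_def)
  let ?a = "polya_exponent y"
  \<comment> \<open>The binomial side, divided by the central coefficient, and the cosine side. Both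
    are extended by 0 to all integers so that \<open>tannery_int\<close> applies.\<close>
  define B where "B = (\<lambda>h (j::int). if 2 * h * nat \<bar>j\<bar> \<le>
      ?a h then central_ratio (?a h) (2 * h * nat \<bar>j\<bar>) else 0)"
  define C where "C = (\<lambda>e h (k::int). if k \<in> {-int h..<int h} then cos (pi * of_int (2 * k + int e)
      / of_nat (4 * h)) ^ (2 * ?a h) else 0)"
  have eq: "2 ^ (2 * ?a h) * (\<Sum>\<^sub>\<infinity>k. C e h k) = real (2 * h) * real ((2 * ?a h) choose ?a h) *
      (\<Sum>\<^sub>\<infinity>j. (-1) ^ (e * nat \<bar>j\<bar>) * B h j)"
    if h: "h \<ge> 1" for h e
  proof -
    have "(\<Sum>\<^sub>\<infinity>k. C e h k) = (\<Sum>\<^sub>\<infinity>k\<in>{-int h..<int h}. cos (pi * of_int (2 * k + int e) / of_nat (4 *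
        h)) ^ (2 * ?a h))"
      by (rule infsum_cong_neutral) (auto simp: C_def)
    also have "2 ^ (2 * ?a h) * \<dots> = (\<Sum>k\<in>{-int h..<int h}. (2 * cos (pi * of_int (2 * k + int e) /
        of_nat (4 * h))) ^ (2 * ?a h))"
      by (simp only: infsum_finite finite_atLeastLessThan_int power_mult_distrib sum_distrib_left)
    also have "\<dots> = real (2 * h) * (\<Sum>\<^sub>\<infinity>j::int. (-1) ^ (e * nat \<bar>j\<bar>) * shifted_choose (?a h) (int (2
        * h) * j))"
      by (rule sum_cos_power[OF h])
    also have "(\<lambda>j::int. (-1) ^ (e * nat \<bar>j\<bar>) * shifted_choose (?a h) (int (2 * h) * j)) =
       (\<lambda>j. real ((2 * ?a h) choose ?a h) * ((-1) ^ (e * nat \<bar>j\<bar>) * B h j))"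
    proof
      fix j :: int
      have n: "nat \<bar>int (2 * h) * j\<bar> = 2 * h * nat \<bar>j\<bar>" by (simp add: abs_mult nat_mult_distrib)
      have "\<bar>int (2 * h) * j\<bar> \<le> int (?a h) \<longleftrightarrow> 2 * h * nat \<bar>j\<bar> \<le> ?a h"
        unfolding n[symmetric] by linarith
      then have "shifted_choose (?a h) (int (2 * h) * j) = real ((2 * ?a h) choose ?a h) * B h j"
        using shifted_choose_eq[of "int (2 * h) * j" "?a h"] n
            by (auto simp: B_def shifted_choose_def)
      then show "(-1) ^ (e * nat \<bar>j\<bar>) * shifted_choose (?a h) (int (2 * h) * j) =
          real ((2 * ?a h) choose ?a h) * ((-1) ^ (e * nat \<bar>j\<bar>) * B h j)"
        by simp
    qed
    also have "(\<Sum>\<^sub>\<infinity>j. real ((2 * ?a h) choose ?a h) * ((-1) ^ (e * nat \<bar>j\<bar>) * B h j)) =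
       real ((2 * ?a h) choose ?a h) * (\<Sum>\<^sub>\<infinity>j. (-1) ^ (e * nat \<bar>j\<bar>) * B h j)"
      by (rule infsum_cmult_right')
    finally show ?thesis by simp
  qed
  have cross: "(\<Sum>\<^sub>\<infinity>j. (-1) ^ (1 * nat \<bar>j\<bar>) * B h j) * (\<Sum>\<^sub>\<infinity>k. C 0 h k) =
      (\<Sum>\<^sub>\<infinity>j. (-1) ^ (0 * nat \<bar>j\<bar>) * B h j) * (\<Sum>\<^sub>\<infinity>k. C 1 h k)"
    if h: "h \<ge> 1" for h
  proof -
    define K where "K = real (2 * h) * real ((2 * ?a h) choose ?a h)"
    have K: "K \<noteq> 0" using h by (simp add: K_def)
    have gen: "sB1 * sC0 = sB0 * sC1" if "P * sC0 = K * sB0" "P * sC1 = K * sB1" "P \<noteq> 0"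
        for P sC0 sC1 sB0 sB1 :: real
    proof -
      have "K * P * (sB1 * sC0) = (P * sC0) * (K * sB1)" by simp
      also have "\<dots> = K * P * (sB0 * sC1)" unfolding that(1) that(2)[symmetric] by simp
      finally show ?thesis using K that(3) by simp
    qed
    show ?thesis by (rule gen[of "2 ^ (2 * ?a h)"]) (use eq[OF h] in \<open>simp_all only: K_def\<close>, simp)
  qed
  have "eventually (\<lambda>h. real (?a h) / (real h)^2 > 2 / (pi * y)) sequentially"
    by (rule order_tendstoD(1)[OF polya_exponent_tendsto]) (use y in \<open>auto simp: field_simps\<close>)
  then obtain N0 where N0: "\<And>h. h \<ge> N0 \<Longrightarrow> real (?a h) / (real h)^2 > 2 / (pi * y)"
    unfolding eventually_sequentially by blast
  \<comment> \<open>From this index on the exponent exceeds 2 h^2 / (pi y), on which the majorant of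
    the cosine powers relies.\<close>
  define N where "N = max 1 N0"
  have B_lim: "(\<lambda>i. \<Sum>\<^sub>\<infinity>j. (-1) ^ (e * nat \<bar>j\<bar>) * B (i + N) j) \<longlonglongrightarrow> (\<Sum>\<^sub>\<infinity>j. (-1) ^ (e * nat \<bar>j\<bar>) * q
      powi (j^2))" for e
  proof (rule tannery_int)
    fix j :: int
    have "(real (nat \<bar>j\<bar>))^2 = of_int (j^2)" by simp
    moreover have "q powi (j^2) = exp (- (pi * y * of_int (j^2)))"
    proof -
      have "q powi (j^2) = q ^ nat (j^2)" by (simp add: power_int_nonneg_exp)
      also have "\<dots> = exp (real (nat (j^2)) * (- (pi * y)))" by (simp only: q_def exp_of_nat_mult)
      also have "real (nat (j^2)) = of_int (j^2)" by (rule of_nat_nat) simp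
      finally show ?thesis by (simp add: mult_ac)
    qed
    ultimately have "(\<lambda>h. B h j) \<longlonglongrightarrow> q powi (j^2)"
      using central_ratio_tendsto[of "nat \<bar>j\<bar>"] unfolding B_def by simp
    from LIMSEQ_ignore_initial_segment[OF this, of N]
    show "(\<lambda>i. (-1) ^ (e * nat \<bar>j\<bar>) * B (i + N) j) \<longlonglongrightarrow> (-1) ^ (e * nat \<bar>j\<bar>) * q powi (j^2)"
      by (intro tendsto_mult tendsto_const)
  next
    fix i and j :: int
    define h where "h = i + N"
    define n where "n = 2 * h * nat \<bar>j\<bar>"
    have h: "h \<ge> 1" by (simp add: h_def N_def)
    have "\<bar>B h j\<bar> \<le> exp (- (pi * y / 2)) powi (j^2) * 1 powi j"
    proof (cases "n \<le> ?a h")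
      case True
      have p: "exp (- (pi * y / 2)) powi (j^2) = exp (- (pi * y / 2 * of_int (j^2)))"
      proof -
        have "exp (- (pi * y / 2)) powi (j^2) = exp (- (pi * y / 2)) ^ nat (j^2)"
            by (simp add: power_int_nonneg_exp)
        also have "\<dots> = exp (real (nat (j^2)) * (- (pi * y / 2)))" by (simp only: exp_of_nat_mult)
        also have "real (nat (j^2)) = of_int (j^2)" by (rule of_nat_nat) simp
        finally show ?thesis by (simp add: mult_ac)
      qed
      \<comment> \<open>Since n is at most the exponent, the denominator at most doubles; hence the
        loss from pi y to pi y / 2.\<close>
      have "pi * y / 2 * of_int (j^2) \<le> (real n)^2 / (real (?a h) + real n)"
      proof (cases "j = 0")
        case False
        then have n: "real n > 0" using h by (simp add: n_def)
        have sq: "(real n)^2 = 4 * (real h)^2 * of_int (j^2)"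
            by (simp add: n_def power_mult_distrib)
        have "real (?a h) * (pi * y) \<le> 4 * (real h)^2"
          using polya_exponent_le[of h] y by (simp add: field_simps)
        then have "real (?a h) * (pi * y) * of_int (j^2) \<le> 4 * (real h)^2 * of_int (j^2)"
          by (intro mult_right_mono) auto
        moreover have "real n * (pi * y) * of_int (j^2) \<le> real (?a h) * (pi * y) * of_int (j^2)"
          using True y by (intro mult_right_mono) auto
        moreover have "p / 2 * J * (A + n) \<le> M" if "A * p * J \<le> M" "n * p * J \<le> A * p * J"
          for A M J n p :: real
        proof -
          have "p / 2 * J * (A + n) = (A * p * J + n * p * J) / 2" by (simp add: field_simps)
          then show ?thesis using that by simp
        qed
        ultimately have "pi * y / 2 * of_int (j^2) * (real (?a h) + real n) \<le> (real n)^2"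
          unfolding sq by blast
        then show ?thesis using n by (simp add: pos_le_divide_eq add_nonneg_pos)
      qed (simp add: n_def)
      then have "exp (- ((real n)^2 / (real (?a h) + real n))) \<le>
          exp (- (pi * y / 2 * of_int (j^2)))"
        by (simp only: exp_le_cancel_iff neg_le_iff_le)
      from order_trans[OF central_ratio_upper(1)[OF True] this]
      have "\<bar>central_ratio (?a h) n\<bar> \<le> exp (- (pi * y / 2 * of_int (j^2)))"
        using central_ratio_upper(2)[OF True] by (simp only: abs_of_nonneg)
      then show ?thesis using True unfolding p by (simp add: B_def n_def[symmetric])
    qed (simp add: B_def n_def)
    then show "norm ((-1) ^ (e * nat \<bar>j\<bar>) * B (i + N) j) \<le>
        exp (- (pi * y / 2)) powi (j^2) * 1 powi j"
      by (simp add: h_def abs_mult power_abs)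
  next
    show "(\<lambda>j. exp (- (pi * y / 2)) powi (j^2) * 1 powi j) summable_on UNIV"
      by (rule summable_on_gauss) (use y in auto)
  qed
  have C_lim: "(\<lambda>i. \<Sum>\<^sub>\<infinity>k. C e (i + N) k) \<longlonglongrightarrow> (\<Sum>\<^sub>\<infinity>k. exp (- (pi / (4 * y) * of_int ((2 * k + int
      e)^2))))" if e: "e \<le> 1" for e
  proof (rule tannery_int)
    fix k :: int
    have "(\<lambda>h. cos (pi * of_int (2 * k + int e) / 4 / real h) ^ (2 * ?a h)) \<longlonglongrightarrow> exp (- (4 * (pi *
        of_int (2 * k + int e) / 4)^2 / (pi * y)))"
      by (rule cos_power_tendsto)
    also have "4 * (pi * of_int (2 * k + int e) / 4)^2 / (pi * y) =
        pi / (4 * y) * of_int ((2 * k + int e)^2)"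
      using y by (simp add: power2_eq_square field_simps)
    finally have "(\<lambda>h. C e h k) \<longlonglongrightarrow> exp (- (pi / (4 * y) * of_int ((2 * k + int e)^2)))"
      by (rule Lim_transform_eventually)
         (rule eventually_sequentiallyI[of "nat (\<bar>k\<bar> + 1)"], auto simp: C_def)
    then show "(\<lambda>i. C e (i + N) k) \<longlonglongrightarrow> exp (- (pi / (4 * y) * of_int ((2 * k + int e)^2)))"
      by (rule LIMSEQ_ignore_initial_segment)
  next
    fix i and k :: int
    define h where "h = i + N"
    have h: "h \<ge> 1" "h \<ge> N0" by (auto simp: h_def N_def)
    \<comment> \<open>pi / (128 y) is 2 / (pi y) times (pi / 4)^2 / 16: the lower bound for the
      exponent over h^2, the square of the angle pi k / (4 h) freed of h, and the 16 of
      \<open>cos_power_le\<close>.\<close>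
    let ?p = "exp (- (pi / (128 * y)))"
    have p: "?p powi (k^2) = exp (- (pi / (128 * y) * of_int (k^2)))"
    proof -
      have "?p powi (k^2) = ?p ^ nat (k^2)" by (simp add: power_int_nonneg_exp)
      also have "\<dots> = exp (real (nat (k^2)) * (- (pi / (128 * y))))" by (simp only: exp_of_nat_mult)
      also have "real (nat (k^2)) = of_int (k^2)" by (rule of_nat_nat) simp
      finally show ?thesis by (simp add: mult_ac)
    qed
    have "\<bar>C e h k\<bar> \<le> ?p powi (k^2) * 1 powi k"
    proof (cases "k \<in> {-int h..<int h}")
      case True
      let ?x = "pi * of_int (2 * k + int e) / of_nat (4 * h)"
      have "\<bar>2 * k + int e\<bar> \<le> 2 * int h" using True e by auto
      then have "real_of_int \<bar>2 * k + int e\<bar> \<le> of_int (2 * int h)" by (simp only: of_int_le_iff)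
      then have "pi * \<bar>real_of_int (2 * k + int e)\<bar> \<le> pi * (2 * real h)"
          by (intro mult_left_mono) auto
      then have "pi * \<bar>real_of_int (2 * k + int e)\<bar> / of_nat (4 * h) \<le> pi / 2"
        using h by (simp add: pos_divide_le_eq)
      then have "\<bar>?x\<bar> \<le> pi / 2" by (simp only: abs_mult abs_divide abs_of_nat abs_of_nonneg[OF
          pi_ge_zero])
      then have 1: "cos ?x ^ (2 * ?a h) \<le> exp (- real (?a h) * ?x^2 / 16)" by (rule cos_power_le)
      have "\<bar>k\<bar> \<le> \<bar>2 * k + int e\<bar>" using e by auto
      then have "\<bar>k\<bar>^2 \<le> \<bar>2 * k + int e\<bar>^2" by (intro power_mono) auto
      then have k2: "real_of_int (k^2) \<le> of_int ((2 * k + int e)^2)"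
          by (simp only: power2_abs of_int_le_iff)
      have "pi / (128 * y) * of_int (k^2) = 2 / (pi * y) * (pi^2 * of_int (k^2) / 256)"
        using y by (simp add: power2_eq_square field_simps)
      also have "\<dots> \<le> real (?a h) / (real h)^2 * (pi^2 * of_int ((2 * k + int e)^2) / 256)"
        using N0[OF h(2)] k2 by (intro mult_mono divide_right_mono mult_left_mono) auto
      also have "\<dots> = real (?a h) * ?x^2 / 16"
        using h by (simp add: power2_eq_square field_simps)
      finally have "exp (- real (?a h) * ?x^2 / 16) \<le> exp (- (pi / (128 * y) * of_int (k^2)))"
        by (simp only: exp_le_cancel_iff minus_mult_left[symmetric] minus_divide_left[symmetric]
            neg_le_iff_le)
      from order_trans[OF 1 this]
      have "\<bar>cos ?x ^ (2 * ?a h)\<bar> \<le> exp (- (pi / (128 * y) * of_int (k^2)))"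
        by (subst abs_of_nonneg) (auto simp: power_mult)
      then show ?thesis using True unfolding p by (simp add: C_def)
    qed (auto simp: C_def)
    then show "norm (C e (i + N) k) \<le> ?p powi (k^2) * 1 powi k" by (simp add: h_def)
  next
    show "(\<lambda>k. exp (- (pi / (128 * y))) powi (k^2) * 1 powi k) summable_on UNIV"
      by (rule summable_on_gauss) (use y in auto)
  qed
  have "(\<Sum>\<^sub>\<infinity>j::int. (-1) ^ (1 * nat \<bar>j\<bar>) * q powi (j^2)) * (\<Sum>\<^sub>\<infinity>k. exp (- (pi / (4 * y) * of_int ((2
      * k + int 0)^2)))) =
     (\<Sum>\<^sub>\<infinity>j::int. (-1) ^ (0 * nat \<bar>j\<bar>) * q powi (j^2)) * (\<Sum>\<^sub>\<infinity>k. exp (- (pi / (4 * y) * of_int ((2 *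
         k + int 1)^2))))"
  proof (rule LIMSEQ_unique)
    show "(\<lambda>i. (\<Sum>\<^sub>\<infinity>j. (-1) ^ (1 * nat \<bar>j\<bar>) * B (i + N) j) * (\<Sum>\<^sub>\<infinity>k. C 0 (i + N) k)) \<longlonglongrightarrow>
      (\<Sum>\<^sub>\<infinity>j::int. (-1) ^ (1 * nat \<bar>j\<bar>) * q powi (j^2)) * (\<Sum>\<^sub>\<infinity>k. exp (- (pi / (4 * y) * of_int ((2 *
          k + int 0)^2))))"
      by (intro tendsto_mult B_lim C_lim) simp
    have "1 \<le> i + N" for i by (simp add: N_def)
    from cross[OF this]
    show "(\<lambda>i. (\<Sum>\<^sub>\<infinity>j. (-1) ^ (1 * nat \<bar>j\<bar>) * B (i + N) j) * (\<Sum>\<^sub>\<infinity>k. C 0 (i + N) k)) \<longlonglongrightarrow>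
      (\<Sum>\<^sub>\<infinity>j::int. (-1) ^ (0 * nat \<bar>j\<bar>) * q powi (j^2)) * (\<Sum>\<^sub>\<infinity>k. exp (- (pi / (4 * y) * of_int ((2 *
          k + int 1)^2))))"
      unfolding cross[OF \<open>1 \<le> _ + N\<close>] by (intro tendsto_mult B_lim C_lim) simp
  qed
  moreover have "(\<Sum>\<^sub>\<infinity>j::int. (-1) ^ (0 * nat \<bar>j\<bar>) * q powi (j^2)) = theta q 1"
      by (simp add: theta_def)
  moreover have "(-1) ^ (1 * nat \<bar>j\<bar>) = (-1 :: real) powi j" for j :: int
    by (cases "j \<ge> 0") (auto simp: power_int_def)
  then have "(\<Sum>\<^sub>\<infinity>j::int. (-1) ^ (1 * nat \<bar>j\<bar>) * q powi (j^2)) = theta q (-1)"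
      by (simp add: theta_def mult.commute)
  moreover have q'p: "q' powi n = exp (- (pi / y * of_int n))" if "n \<ge> 0" for n
  proof -
    have "q' powi n = q' ^ nat n" using that by (simp add: power_int_nonneg_exp)
    also have "\<dots> = exp (real (nat n) * (- (pi / y)))" by (simp only: q'_def exp_of_nat_mult)
    finally show ?thesis using that by (simp add: mult_ac)
  qed
  then have "(\<Sum>\<^sub>\<infinity>k. exp (- (pi / (4 * y) * of_int ((2 * k + int 0)^2)))) = theta q' 1"
    by (simp add: theta_def power_mult_distrib mult_ac)
  moreover have "(\<Sum>\<^sub>\<infinity>k. exp (- (pi / (4 * y) * of_int ((2 * k + int 1)^2)))) =
      exp (- (pi / (4 * y))) * theta q' q'"
    unfolding theta_def infsum_cmult_right'[symmetric]
  proof (rule infsum_cong)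
    fix k :: int
    have k: "0 \<le> k^2 + k"
    proof -
      have "0 \<le> k * (k + 1)" by (cases "k \<ge> 0") (auto intro: mult_nonneg_nonneg mult_nonpos_nonpos)
      then show ?thesis by (simp add: power2_eq_square algebra_simps)
    qed
    have "q' powi k^2 * q' powi k = q' powi (k^2 + k)" using q by (simp add: power_int_add)
    also have "\<dots> = exp (- (pi / y * of_int (k^2 + k)))" by (rule q'p[OF k])
    finally have "exp (- (pi / (4 * y))) * (q' powi k^2 * q' powi k) =
        exp (- (pi / (4 * y)) + - (pi / y * of_int (k^2 + k)))"
      by (simp only: exp_add)
    also have "- (pi / (4 * y)) + - (pi / y * of_int (k^2 + k)) =
        - (pi / (4 * y) * of_int ((2 * k + int 1)^2))"
      using y by (simp add: power2_eq_square field_simps)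
    finally show "exp (- (pi / (4 * y) * of_int ((2 * k + int 1)^2))) =
        exp (- (pi / (4 * y))) * (q' powi k^2 * q' powi k)" ..
  qed
  ultimately show ?thesis by (simp add: q_def q'_def)
qed

end

subsection \<open>Modular equations of degree 3, 7 and 15\<close>

text \<open>Theta series of a s^2 + s t + c t^2 restricted to congruence classes. The discriminant 1
  - 4 a c is -3 for (a, c) = (1, 1), -7 for (1, 2), and -15 for both (1, 4) and (2, 2).\<close>

definition form_sum :: "real \<Rightarrow> int \<Rightarrow> int \<Rightarrow> (int \<Rightarrow> int \<Rightarrow> bool) \<Rightarrow> real" where
  "form_sum q a c P = (\<Sum>\<^sub>\<infinity>(s,t)\<in>{(s,t). P s t}. q powi (a * s^2 + s * t + c * t^2))"

lemma minus_one_powi: "(-1 :: real) powi n = (if even n then 1 else -1)"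
  by (cases "n \<ge> 0") (auto simp: power_int_def even_nat_iff)

context
  fixes q :: real
  assumes q: "q \<noteq> 0" "\<bar>q\<bar> < 1"
begin

lemma has_sum_theta_pair:
  assumes "A > 0" "C > 0" "e \<noteq> 0"
  shows "((\<lambda>(m,n). e powi (m + n) * q powi (int A * m^2 + int B * m + int C * n^2 + int D * n))
     has_sum theta (q^A) (e * q^B) * theta (q^C) (e * q^D)) UNIV"
proof -
  have "((\<lambda>(m,n). (q^A) powi (m^2) * (e * q^B) powi m * ((q^C) powi (n^2) * (e * q^D) powi n))
     has_sum theta (q^A) (e * q^B) * theta (q^C) (e * q^D)) UNIV"
    by (rule has_sum_theta_mult) (use q assms in \<open>auto simp: power_abs power_less_one_iff\<close>)
  moreover have "(q^A) powi (m^2) * (e * q^B) powi m * ((q^C) powi (n^2) * (e * q^D) powi n) =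
      e powi (m + n) * q powi (int A * m^2 + int B * m + int C * n^2 + int D * n)" for m n
    using q assms by (simp add: power_int_add power_int_power power_int_mult_distrib)
  ultimately show ?thesis by simp
qed

context
  fixes a c :: int
  assumes ac: "a \<ge> 1" "c \<ge> 1"
begin

text \<open>2 Q - s^2 - t^2 = (s + t)^2 + 2 (a - 1) s^2 + 2 (c - 1) t^2 is nonnegative, so with the
  square root of |q| as nome a product of two theta series is a majorant.\<close>

lemma summable_form: "(\<lambda>(s,t). q powi (a * s^2 + s * t + c * t^2)) summable_on X"
proof -
  define r where "r = sqrt \<bar>q\<bar>"
  have r: "r > 0" "r < 1" "\<bar>q\<bar> = r^2" using q by (auto simp: r_def)
  have "((\<lambda>(m,n). r powi (m^2) * 1 powi m * (r powi (n^2) * 1 powi n)) has_sum theta r 1 * theta r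
      1) (UNIV :: (int \<times> int) set)"
    by (rule has_sum_theta_mult) (use r in auto)
  then have "(\<lambda>(m,n). r powi (m^2) * 1 powi m * (r powi (n^2) * 1 powi n)) summable_on (UNIV ::
      (int \<times> int) set)"
    by (rule has_sum_imp_summable)
  then have "(\<lambda>x. norm (case x of (s,t) \<Rightarrow> q powi (a * s^2 + s * t + c * t^2))) summable_on UNIV"
  proof (rule summable_on_comparison_test)
    fix x :: "int \<times> int"
    obtain s t where x: "x = (s, t)" by (cases x)
    have "norm (q powi (a * s^2 + s * t + c * t^2)) = r powi (2 * (a * s^2 + s * t + c * t^2))"
      by (simp only: norm_power_int) (simp only: real_norm_def r(3) power_int_power of_nat_numeral)
    also have "\<dots> \<le> r powi (s^2 + t^2)"
    proof (rule power_int_decreasing)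
      have "0 \<le> (s + t)^2 + 2 * (a - 1) * s^2 + 2 * (c - 1) * t^2" using ac by simp
      also have "\<dots> = 2 * (a * s^2 + s * t + c * t^2) - (s^2 + t^2)"
          by (simp add: power2_eq_square algebra_simps)
      finally show "s^2 + t^2 \<le> 2 * (a * s^2 + s * t + c * t^2)" by simp
    qed (use r in auto)
    finally show "norm (case x of (s,t) \<Rightarrow> q powi (a * s^2 + s * t + c * t^2)) \<le>
        (case x of (m,n) \<Rightarrow> r powi (m^2) * 1 powi m * (r powi (n^2) * 1 powi n))"
      using r by (simp add: x power_int_add)
  qed simp
  then have "(\<lambda>(s,t). q powi (a * s^2 + s * t + c * t^2)) summable_on UNIV"
      by (rule abs_summable_summable)
  then show ?thesis by (rule summable_on_subset_banach) simp
qed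

lemma form_sum_split:
  "form_sum q a c P = form_sum q a c (\<lambda>s t. P s t \<and> R s t) + form_sum q a c (\<lambda>s t. P s t \<and> \<not> R s t)"
  unfolding form_sum_def
  by (subst infsum_Un_disjoint[symmetric]) (auto intro!: summable_form infsum_cong_neutral)

lemma form_sum_bij:
  assumes "\<And>s t. P s t \<Longrightarrow> R (i1 s t) (i2 s t) \<and> j1 (i1 s t) (i2 s t) = s \<and> j2 (i1 s t) (i2 s t) = t"
    and "\<And>s t. R s t \<Longrightarrow> P (j1 s t) (j2 s t) \<and> i1 (j1 s t) (j2 s t) = s \<and> i2 (j1 s t) (j2 s t) = t"
    and "\<And>s t. P s t \<Longrightarrow> a * (i1 s t)^2 + i1 s t * i2 s t + c * (i2 s t)^2 =
        a * s^2 + s * t + c * t^2"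
  shows "form_sum q a c P = form_sum q a c R"
  unfolding form_sum_def
  by (rule infsum_reindex_bij_witness[where i = "\<lambda>(s,t). (j1 s t, j2 s t)" and j =
      "\<lambda>(s,t). (i1 s t, i2 s t)"])
     (use assms in auto)

text \<open>The integral substitution (i1, i2) diagonalises the form. Its image is the class P, and
  its affine part produces the linear terms and the constant k.\<close>

lemma form_sum_theta_pair:
  assumes "A > 0" "C > 0"
    and i: "\<And>s t. P s t \<Longrightarrow> i1 (j1 s t) (j2 s t) = s" "\<And>s t. P s t \<Longrightarrow> i2 (j1 s t) (j2 s t) = t"
    and P: "\<And>m n. P (i1 m n) (i2 m n)"
    and j: "\<And>m n. j1 (i1 m n) (i2 m n) = m" "\<And>m n. j2 (i1 m n) (i2 m n) = n"
    and E: "\<And>m n. a * (i1 m n)^2 + i1 m n * i2 m n + c * (i2 m n)^2 =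
        int A * m^2 + int B * m + int C * n^2 + int D * n + int k"
  shows "q^k * (theta (q^A) (q^B) * theta (q^C) (q^D)) = form_sum q a c P"
proof -
  have "((\<lambda>x. q^k * (case x of (m,n) \<Rightarrow> 1 powi (m + n) * q powi (int A * m^2 + int B * m + int C *
      n^2 + int D * n)))
     has_sum q^k * (theta (q^A) (1 * q^B) * theta (q^C) (1 * q^D))) UNIV"
    by (intro has_sum_cmult_right has_sum_theta_pair) (use assms(1,2) in auto)
  then have "((\<lambda>(s,t). q powi (a * s^2 + s * t + c * t^2)) has_sum q^k * (theta (q^A) (1 * q^B) *
      theta (q^C) (1 * q^D))) {(s,t). P s t}"
  proof (rule has_sum_reindexI[where j = "\<lambda>(s,t). (j1 s t, j2 s t)" and i =
      "\<lambda>(m,n). (i1 m n, i2 m n)"])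
    fix x assume "x \<in> {(s,t). P s t}"
    then obtain s t where x: "x = (s, t)" "P s t" by auto
    then show "(case (case x of (s,t) \<Rightarrow> (j1 s t, j2 s t)) of (m,n) \<Rightarrow> (i1 m n, i2 m n)) = x"
        by (simp add: i)
    show "q^k * (case (case x of (s,t) \<Rightarrow> (j1 s t, j2 s t)) of (m,n) \<Rightarrow> 1 powi (m + n) * q powi (int
        A * m^2 + int B * m + int C * n^2 + int D * n))
       = (case x of (s,t) \<Rightarrow> q powi (a * s^2 + s * t + c * t^2))"
    proof -
      have "q^k * q powi N = q powi (N + int k)" for N using q by (simp add: power_int_add)
      then show ?thesis using E[of "j1 s t" "j2 s t"] by (simp add: x i)
    qed
  qed (auto simp: P j)
  then show ?thesis by (simp add: form_sum_def infsumI)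
qed

text \<open>At w = -1 the sign (-1)^(m+n) appears; expressed in s and t it is the condition R, which
  splits the class.\<close>

lemma form_sum_theta_pair_minus:
  assumes "A > 0" "C > 0"
    and i: "\<And>s t. P s t \<Longrightarrow> i1 (j1 s t) (j2 s t) = s" "\<And>s t. P s t \<Longrightarrow> i2 (j1 s t) (j2 s t) = t"
    and P: "\<And>m n. P (i1 m n) (i2 m n)"
    and j: "\<And>m n. j1 (i1 m n) (i2 m n) = m" "\<And>m n. j2 (i1 m n) (i2 m n) = n"
    and E: "\<And>m n. a * (i1 m n)^2 + i1 m n * i2 m n + c * (i2 m n)^2 = int A * m^2 + int C * n^2"
    and R: "\<And>m n. R (i1 m n) (i2 m n) \<longleftrightarrow> even (m + n)"
  shows "theta (q^A) (-1) * theta (q^C) (-1) = form_sum q a c (\<lambda>s t. P s t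
      \<and> R s t) - form_sum q a c (\<lambda>s t. P s t \<and> \<not> R s t)"
proof -
  let ?f = "\<lambda>(s,t). q powi (a * s^2 + s * t + c * t^2)"
  let ?g = "\<lambda>(s,t). (if R s t then 1 else -1) * q powi (a * s^2 + s * t + c * t^2)"
  have "((\<lambda>(m,n). (-1) powi (m + n) * q powi (int A * m^2 + int 0 * m + int C * n^2 + int 0 * n))
     has_sum (theta (q^A) (-1 * q^0) * theta (q^C) (-1 * q^0))) UNIV"
    by (intro has_sum_theta_pair) (use assms(1,2) in auto)
  then have "(?g has_sum theta (q^A) (-1 * q^0) * theta (q^C) (-1 * q^0)) {(s,t). P s t}"
  proof (rule has_sum_reindexI[where j = "\<lambda>(s,t). (j1 s t, j2 s t)" and i =
      "\<lambda>(m,n). (i1 m n, i2 m n)"])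
    fix x assume "x \<in> {(s,t). P s t}"
    then obtain s t where x: "x = (s, t)" "P s t" by auto
    then show "(case (case x of (s,t) \<Rightarrow> (j1 s t, j2 s t)) of (m,n) \<Rightarrow> (i1 m n, i2 m n)) = x"
        by (simp add: i)
    show "(case (case x of (s,t) \<Rightarrow> (j1 s t, j2 s t)) of (m,n) \<Rightarrow> (-1) powi (m + n) * q powi (int A *
        m^2 + int 0 * m + int C * n^2 + int 0 * n))
       = ?g x"
      using E[of "j1 s t" "j2 s t"] R[of "j1 s t" "j2 s t"] by (simp add: x i minus_one_powi)
  qed (auto simp: P j)
  moreover have "(?g has_sum
     form_sum q a c (\<lambda>s t. P s t \<and> R s t) + - form_sum q a c (\<lambda>s t. P s t
         \<and> \<not> R s t)) ({(s,t). P s t \<and> R s t} \<union> {(s,t). P s t \<and> \<not> R s t})"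
  proof (rule has_sum_Un_disjoint)
    have "(?f has_sum form_sum q a c (\<lambda>s t. P s t \<and> R s t)) {(s,t). P s t \<and> R s t}"
      unfolding form_sum_def by (rule has_sum_infsum[OF summable_form])
    then show "(?g has_sum form_sum q a c (\<lambda>s t. P s t \<and> R s t)) {(s,t). P s t \<and> R s t}"
      by (rule has_sum_cong[THEN iffD1, rotated]) auto
    have "(?f has_sum form_sum q a c (\<lambda>s t. P s t \<and> \<not> R s t)) {(s,t). P s t \<and> \<not> R s t}"
      unfolding form_sum_def by (rule has_sum_infsum[OF summable_form])
    then have "((\<lambda>x. - ?f x) has_sum - form_sum q a c (\<lambda>s t. P s t \<and> \<not> R s t)) {(s,t). P s t
        \<and> \<not> R s t}"
      by (rule has_sum_uminusI)
    then show "(?g has_sum - form_sum q a c (\<lambda>s t. P s t \<and> \<not> R s t)) {(s,t). P s t \<and> \<not> R s t}"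
      by (rule has_sum_cong[THEN iffD1, rotated]) auto
  qed auto
  moreover have "{(s,t). P s t \<and> R s t} \<union> {(s,t). P s t \<and> \<not> R s t} = {(s,t). P s t}" by auto
  ultimately show ?thesis using has_sum_unique by fastforce
qed

end


text \<open>In the following modular equations every product of two theta series is a sum of \<open>q ^ Q(s, t)\<close>
  over some congruence classes of \<open>(s, t)\<close>, for one binary quadratic form \<open>Q\<close>; the classes that do
  not cancel directly are exchanged by automorphisms of \<open>Q\<close>.\<close>

lemma theta_degree_3: "theta q 1 * theta (q^3) 1 = theta q (-1) * theta (q^3) (-1) + q * (theta q q
    * theta (q^3) (q^3))"
proof -
  let ?S = "form_sum q 1 1"
  have X: "q^0 * (theta (q^1) (q^0) * theta (q^3) (q^0)) = ?S (\<lambda>s t. even t)"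
    by (rule form_sum_theta_pair[where ?i1.0 = "\<lambda>m n. m - n" and ?i2.0 = "\<lambda>m n. 2 * n" and ?j1.0 =
        "\<lambda>s t. s + t div 2" and ?j2.0 = "\<lambda>s t. t div 2"])
       (auto simp: power2_eq_square algebra_simps)
  have Z: "q^1 * (theta (q^1) (q^1) * theta (q^3) (q^3)) = ?S (\<lambda>s t. odd t)"
    by (rule form_sum_theta_pair[where ?i1.0 = "\<lambda>m n. m - n" and ?i2.0 =
        "\<lambda>m n. 2 * n + 1" and ?j1.0 = "\<lambda>s t. s + t div 2" and ?j2.0 = "\<lambda>s t. t div 2"])
       (auto simp: power2_eq_square algebra_simps elim!: oddE)
  have Y: "theta (q^1) (-1) * theta (q^3) (-1) = ?S (\<lambda>s t. even t \<and> even s) - ?S (\<lambda>s t. even t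
      \<and> odd s)"
    by (rule form_sum_theta_pair_minus[where ?i1.0 = "\<lambda>m n. m - n" and ?i2.0 =
        "\<lambda>m n. 2 * n" and ?j1.0 = "\<lambda>s t. s + t div 2" and ?j2.0 = "\<lambda>s t. t div 2"])
       (auto simp: power2_eq_square algebra_simps)
  have "?S (\<lambda>s t. odd t \<and> even s) = ?S (\<lambda>s t. even t \<and> odd s)"
    by (rule form_sum_bij[where ?i1.0 = "\<lambda>s t. t" and ?i2.0 = "\<lambda>s t. s" and ?j1.0 =
        "\<lambda>s t. t" and ?j2.0 = "\<lambda>s t. s"]) auto
  \<comment> \<open>The automorphism (s, t) -> (s + t, -t) and the swap of s and t identify the sums
    over the three classes in which s and t are not both even.\<close>
  moreover have "?S (\<lambda>s t. odd t \<and> odd s) = ?S (\<lambda>s t. odd t \<and> even s)"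
    by (rule form_sum_bij[where ?i1.0 = "\<lambda>s t. s + t" and ?i2.0 = "\<lambda>s t. - t" and ?j1.0 =
        "\<lambda>s t. s + t" and ?j2.0 = "\<lambda>s t. - t"])
       (auto simp: power2_eq_square algebra_simps)
  moreover have "?S (\<lambda>s t. even t) = ?S (\<lambda>s t. even t \<and> even s) + ?S (\<lambda>s t. even t \<and> odd s)"
    by (rule form_sum_split) auto
  moreover have "?S (\<lambda>s t. odd t) = ?S (\<lambda>s t. odd t \<and> even s) + ?S (\<lambda>s t. odd t \<and> odd s)"
    by (rule form_sum_split) auto
  ultimately show ?thesis using X Y Z by simp
qed

lemma theta_degree_7: "theta q 1 * theta (q^7) 1 = theta (q^2) (-1) * theta (q^14) (-1) + 2 * (q *
    (theta (q^2) q * theta (q^14) (q^7)))"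
proof -
  let ?S = "form_sum q 1 2"
  have X: "q^0 * (theta (q^1) (q^0) * theta (q^7) (q^0)) = ?S (\<lambda>s t. even t)"
    by (rule form_sum_theta_pair[where ?i1.0 = "\<lambda>m n. m - n" and ?i2.0 = "\<lambda>m n. 2 * n" and ?j1.0 =
        "\<lambda>s t. s + t div 2" and ?j2.0 = "\<lambda>s t. t div 2"])
       (auto simp: power2_eq_square algebra_simps)
  have Z: "q^1 * (theta (q^2) (q^1) * theta (q^14) (q^7)) = ?S (\<lambda>s t. (s + t) mod 4 = 1)"
  proof (rule form_sum_theta_pair[where ?i1.0 = "\<lambda>m n. m + 3 * n + 1" and ?i2.0 =
      "\<lambda>m n. n - m" and ?j1.0 = "\<lambda>s t. (s + t) div 4 - t" and ?j2.0 = "\<lambda>s t. (s + t) div 4"])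
    show "((m + 3 * n + 1) + (n - m)) div 4 - (n - m) = m" for m n :: int by presburger
    show "(s + t) div 4 - t + 3 * ((s + t) div 4) + 1 = s" if "(s + t) mod 4 = 1"
        for s t :: int using that by presburger
    show "((m + 3 * n + 1) + (n - m)) mod 4 = 1" for m n :: int by presburger
    show "((m + 3 * n + 1) + (n - m)) div 4 = n" for m n :: int by presburger
  qed (auto simp: power2_eq_square algebra_simps)
  \<comment> \<open>Negation exchanges the residues 1 and 3 of s + t modulo 4, so this class carries
    half of the sum over odd s + t; hence the factor 2 in the identity.\<close>
  have Z2: "?S (\<lambda>s t. (s + t) mod 4 = 1) = ?S (\<lambda>s t. odd (s + t) \<and> \<not> (s + t) mod 4 = 1)"
  proof (rule form_sum_bij[where ?i1.0 = "\<lambda>s t. - s" and ?i2.0 = "\<lambda>s t. - t" and ?j1.0 =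
      "\<lambda>s t. - s" and ?j2.0 = "\<lambda>s t. - t"])
    show "(odd (- s + - t) \<and> \<not> (- s + - t) mod 4 = 1) \<and> - (- s) = s \<and> - (- t) = t"
        if "(s + t) mod 4 = 1" for s t :: int
      using that by presburger
    show "(- s + - t) mod 4 = 1 \<and> - (- s) = s \<and> - (- t) = t" if "odd (s + t) \<and> \<not> (s + t) mod 4 =
        1" for s t :: int
      using that by presburger
  qed auto
  have Z3: "?S (\<lambda>s t. odd (s + t)) = ?S (\<lambda>s t. odd (s + t) \<and> (s + t) mod 4 =
      1) + ?S (\<lambda>s t. odd (s + t) \<and> \<not> (s + t) mod 4 = 1)"
    by (rule form_sum_split) auto
  have Z4: "(\<lambda>s t. odd (s + t) \<and> (s + t) mod 4 = 1) = (\<lambda>s t :: int. (s + t) mod 4 = 1)"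
    by (intro ext) presburger
  have Y: "theta (q^2) (-1) * theta (q^14) (-1) = ?S (\<lambda>s t. s mod 4 = 0
      \<and> even t) - ?S (\<lambda>s t. s mod 4 = 0 \<and> odd t)"
    by (rule form_sum_theta_pair_minus[where ?i1.0 = "\<lambda>m n. - (4 * n)" and ?i2.0 =
        "\<lambda>m n. m + n" and ?j1.0 = "\<lambda>s t. t + s div 4" and ?j2.0 = "\<lambda>s t. - (s div 4)"])
       (auto simp: power2_eq_square algebra_simps)
  have 1: "?S (\<lambda>s t. even t) = ?S (\<lambda>s t. even t \<and> even s) + ?S (\<lambda>s t. even t \<and> odd s)"
    by (rule form_sum_split) auto
  have 2: "?S (\<lambda>s t. even t \<and> even s) = ?S (\<lambda>s t. (even t \<and> even s) \<and> s mod 4 =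
      0) + ?S (\<lambda>s t. (even t \<and> even s) \<and> \<not> s mod 4 = 0)"
    by (rule form_sum_split) auto
  have 3: "?S (\<lambda>s t. odd t \<and> even s) = ?S (\<lambda>s t. (odd t \<and> even s) \<and> s mod 4 =
      0) + ?S (\<lambda>s t. (odd t \<and> even s) \<and> \<not> s mod 4 = 0)"
    by (rule form_sum_split) auto
  have 4: "?S (\<lambda>s t. odd (s + t)) = ?S (\<lambda>s t. odd (s + t) \<and> odd t) + ?S (\<lambda>s t. odd (s + t)
      \<and> \<not> odd t)"
    by (rule form_sum_split) auto
  \<comment> \<open>For even s the map (s, t) -> (-s, t + s / 2) preserves s^2 + s t + 2 t^2; it
    changes the parity of t exactly if s is 2 modulo 4.\<close>
  have 5: "?S (\<lambda>s t. (even t \<and> even s) \<and> \<not> s mod 4 = 0) = ?S (\<lambda>s t. (odd t \<and> even s) \<and> \<not> s mod 4 =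
      0)"
  proof (rule form_sum_bij[where ?i1.0 = "\<lambda>s t. - s" and ?i2.0 = "\<lambda>s t. t + s div 2" and ?j1.0 =
      "\<lambda>s t. - s" and ?j2.0 = "\<lambda>s t. t + s div 2"])
    show "((odd (t + s div 2) \<and> even (- s)) \<and> \<not> - s mod 4 = 0) \<and> - (- s) = s
        \<and> t + s div 2 + (- s) div 2 = t"
      if "(even t \<and> even s) \<and> \<not> s mod 4 = 0" for s t :: int
      using that by presburger
    show "((even (t + s div 2) \<and> even (- s)) \<and> \<not> - s mod 4 = 0) \<and> - (- s) = s
        \<and> t + s div 2 + (- s) div 2 = t"
      if "(odd t \<and> even s) \<and> \<not> s mod 4 = 0" for s t :: int
      using that by presburger
  qed (auto simp: power2_eq_square algebra_simps elim!: evenE)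
  have 6: "(\<lambda>s t. odd (s + t) \<and> odd t) = (\<lambda>s t :: int. odd t \<and> even s)" "(\<lambda>s t. odd (s + t)
      \<and> \<not> odd t) = (\<lambda>s t :: int. even t \<and> odd s)"
    "(\<lambda>s t. (even t \<and> even s) \<and> s mod 4 = 0) = (\<lambda>s t. (s :: int) mod 4 = 0 \<and> even (t :: int))"
    "(\<lambda>s t. (odd t \<and> even s) \<and> s mod 4 = 0) = (\<lambda>s t. (s :: int) mod 4 = 0 \<and> odd (t :: int))"
    by (intro ext, presburger)+
  show ?thesis using X Y Z Z2 Z3 1 2 3 4 5 unfolding 6 Z4 power_0 power_one_right mult_1_left
      by linarith
qed


lemma theta_degree_15: "theta q 1 * theta (q^15) 1 =
    theta (q^6) (-1) * theta (q^10) (-1) + 2 * (q * (theta (q^6) (q^3) * theta (q^10) (q^5)))"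
proof -
  let ?S = "form_sum q 1 4"
  have X: "q^0 * (theta (q^1) (q^0) * theta (q^15) (q^0)) = ?S (\<lambda>s t. even t)"
    by (rule form_sum_theta_pair[where ?i1.0 = "\<lambda>m n. m - n" and ?i2.0 = "\<lambda>m n. 2 * n" and ?j1.0 =
        "\<lambda>s t. s + t div 2" and ?j2.0 = "\<lambda>s t. t div 2"])
       (auto simp: power2_eq_square algebra_simps)
  have Z: "q^1 * (theta (q^6) (q^3) * theta (q^10) (q^5)) = ?S (\<lambda>s t. (s - t) mod 4 = 1)"
  proof (rule form_sum_theta_pair[where ?i1.0 = "\<lambda>m n. m + 3 * n + 1" and ?i2.0 =
      "\<lambda>m n. m - n" and ?j1.0 = "\<lambda>s t. (s - t) div 4 + t" and ?j2.0 = "\<lambda>s t. (s - t) div 4"])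
    show "((m + 3 * n + 1) - (m - n)) div 4 + (m - n) = m" for m n :: int by presburger
    show "(s - t) div 4 + t + 3 * ((s - t) div 4) + 1 = s" if "(s - t) mod 4 = 1"
        for s t :: int using that by presburger
    show "((m + 3 * n + 1) - (m - n)) mod 4 = 1" for m n :: int by presburger
    show "((m + 3 * n + 1) - (m - n)) div 4 = n" for m n :: int by presburger
  qed (auto simp: power2_eq_square algebra_simps)
  have Z2: "?S (\<lambda>s t. (s - t) mod 4 = 1) = ?S (\<lambda>s t. odd (s - t) \<and> \<not> (s - t) mod 4 = 1)"
  proof (rule form_sum_bij[where ?i1.0 = "\<lambda>s t. - s" and ?i2.0 = "\<lambda>s t. - t" and ?j1.0 =
      "\<lambda>s t. - s" and ?j2.0 = "\<lambda>s t. - t"])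
    show "(odd (- s - - t) \<and> \<not> (- s - - t) mod 4 = 1) \<and> - (- s) = s \<and> - (- t) = t"
        if "(s - t) mod 4 = 1" for s t :: int
      using that by presburger
    show "(- s - - t) mod 4 = 1 \<and> - (- s) = s \<and> - (- t) = t" if "odd (s - t) \<and> \<not> (s - t) mod 4 =
        1" for s t :: int
      using that by presburger
  qed auto
  have Z3: "?S (\<lambda>s t. odd (s - t)) = ?S (\<lambda>s t. odd (s - t) \<and> (s - t) mod 4 =
      1) + ?S (\<lambda>s t. odd (s - t) \<and> \<not> (s - t) mod 4 = 1)"
    by (rule form_sum_split) auto
  have Z4: "(\<lambda>s t. odd (s - t) \<and> (s - t) mod 4 = 1) = (\<lambda>s t :: int. (s - t) mod 4 = 1)"
    by (intro ext) presburger
  have Y: "theta (q^6) (-1) * theta (q^10) (-1) = ?S (\<lambda>s t. (s - t) mod 4 = 0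
      \<and> even t) - ?S (\<lambda>s t. (s - t) mod 4 = 0 \<and> odd t)"
  proof (rule form_sum_theta_pair_minus[where ?i1.0 = "\<lambda>m n. m + 3 * n" and ?i2.0 =
      "\<lambda>m n. m - n" and ?j1.0 = "\<lambda>s t. (s - t) div 4 + t" and ?j2.0 = "\<lambda>s t. (s - t) div 4"])
    show "((m + 3 * n) - (m - n)) div 4 + (m - n) = m" for m n :: int by presburger
    show "(s - t) div 4 + t + 3 * ((s - t) div 4) = s" if "(s - t) mod 4 = 0" for s t :: int
        using that by presburger
    show "((m + 3 * n) - (m - n)) mod 4 = 0" for m n :: int by presburger
    show "((m + 3 * n) - (m - n)) div 4 = n" for m n :: int by presburger
  qed (auto simp: power2_eq_square algebra_simps)
  have 1: "?S (\<lambda>s t. even t) = ?S (\<lambda>s t. even t \<and> even s) + ?S (\<lambda>s t. even t \<and> odd s)"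
    by (rule form_sum_split) auto
  have 2: "?S (\<lambda>s t. even t \<and> even s) = ?S (\<lambda>s t. (even t \<and> even s) \<and> (s - t) mod 4 =
      0) + ?S (\<lambda>s t. (even t \<and> even s) \<and> \<not> (s - t) mod 4 = 0)"
    by (rule form_sum_split) auto
  have 3: "?S (\<lambda>s t. odd t \<and> odd s) = ?S (\<lambda>s t. (odd t \<and> odd s) \<and> (s - t) mod 4 =
      0) + ?S (\<lambda>s t. (odd t \<and> odd s) \<and> \<not> (s - t) mod 4 = 0)"
    by (rule form_sum_split) auto
  have 4: "?S (\<lambda>s t. odd (s - t)) = ?S (\<lambda>s t. odd (s - t) \<and> odd t) + ?S (\<lambda>s t. odd (s - t)
      \<and> \<not> odd t)"
    by (rule form_sum_split) auto
  \<comment> \<open>The involution is an automorphism of s^2 + s t + 4 t^2 with half-integral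
    coefficients, integral where s and t have equal parity; if s - t is 2 modulo 4, it exchanges the
    both-even and the both-odd pairs.\<close>
  have 5: "?S (\<lambda>s t. (even t \<and> even s) \<and> \<not> (s - t) mod 4 = 0) = ?S (\<lambda>s t. (odd t \<and> odd s)
      \<and> \<not> (s - t) mod 4 = 0)"
  proof (rule form_sum_bij[where ?i1.0 = "\<lambda>s t. (s - 3 * t) div 2" and ?i2.0 =
      "\<lambda>s t. - ((s + t) div 2)" and ?j1.0 = "\<lambda>s t. (s - 3 * t) div 2" and ?j2.0 =
      "\<lambda>s t. - ((s + t) div 2)"])
    fix s t :: int
    show "((odd (- ((s + t) div 2)) \<and> odd ((s - 3 * t) div 2))
        \<and> \<not> ((s - 3 * t) div 2 - - ((s + t) div 2)) mod 4 = 0) \<and>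
        ((s - 3 * t) div 2 - 3 * - ((s + t) div 2)) div 2 = s
            \<and> - (((s - 3 * t) div 2 + - ((s + t) div 2)) div 2) = t"
      if st: "(even t \<and> even s) \<and> \<not> (s - t) mod 4 = 0"
    proof -
      obtain v where v: "t = 2 * v" using st by (auto elim!: evenE)
      have "odd (s div 2 - v)" using st unfolding v by presburger
      then obtain w where "s div 2 - v = 2 * w + 1" by (elim oddE)
      then have w: "s = 2 * v + 4 * w + 2" using st by presburger
      have d: "(s - 3 * t) div 2 = - (2 * v) + 2 * w + 1" "(s + t) div 2 =
          2 * v + 2 * w + 1" unfolding v w by presburger+
      have "odd (- (2 * v + 2 * w + 1))" "odd (- (2 * v) + 2 * w + 1)" by simp_all
      moreover have "\<not> (- (2 * v) + 2 * w + 1 - - (2 * v + 2 * w + 1)) mod 4 = 0"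
        "(- (2 * v) + 2 * w + 1 - 3 * - (2 * v + 2 * w + 1)) div 2 =
            s" "- ((- (2 * v) + 2 * w + 1 + - (2 * v + 2 * w + 1)) div 2) = t"
        unfolding v w by (simp_all add: algebra_simps)
      ultimately show ?thesis unfolding d by blast
    qed
    show "((even (- ((s + t) div 2)) \<and> even ((s - 3 * t) div 2))
        \<and> \<not> ((s - 3 * t) div 2 - - ((s + t) div 2)) mod 4 = 0) \<and>
        ((s - 3 * t) div 2 - 3 * - ((s + t) div 2)) div 2 = s
            \<and> - (((s - 3 * t) div 2 + - ((s + t) div 2)) div 2) = t"
      if st: "(odd t \<and> odd s) \<and> \<not> (s - t) mod 4 = 0"
    proof -
      obtain v where v: "t = 2 * v + 1" using st by (auto elim!: oddE)
      have "odd (s div 2 - v)" using st unfolding v by presburger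
      then obtain w where "s div 2 - v = 2 * w + 1" by (elim oddE)
      then have w: "s = 2 * v + 4 * w + 3" using st by presburger
      have d: "(s - 3 * t) div 2 = - (2 * v) + 2 * w" "(s + t) div 2 = 2 * v + 2 * w + 2"
          unfolding v w by presburger+
      have "even (- (2 * v + 2 * w + 2))" "even (- (2 * v) + 2 * w)" by simp_all
      moreover have "\<not> (- (2 * v) + 2 * w - - (2 * v + 2 * w + 2)) mod 4 = 0"
        "(- (2 * v) + 2 * w - 3 * - (2 * v + 2 * w + 2)) div 2 =
            s" "- ((- (2 * v) + 2 * w + - (2 * v + 2 * w + 2)) div 2) = t"
        unfolding v w by (simp_all add: algebra_simps)
      ultimately show ?thesis unfolding d by blast
    qed
    assume "(even t \<and> even s) \<and> \<not> (s - t) mod 4 = 0"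
    then obtain u v where "s = 2 * u" "t = 2 * v" by (auto elim!: evenE)
    moreover have "(2 * u - 3 * (2 * v)) div 2 = u - 3 * v" "(2 * u + 2 * v) div 2 = u + v"
        by presburger+
    ultimately show "1 * ((s - 3 * t) div 2)^2 + (s - 3 * t) div 2 * - ((s + t) div 2) + 4 * (- ((s
        + t) div 2))^2 = 1 * s^2 + s * t + 4 * t^2"
      by (simp only:) (simp add: power2_eq_square algebra_simps)
  qed auto
  have 6: "?S (\<lambda>s t. odd t \<and> even s) = ?S (\<lambda>s t. odd t \<and> odd s)"
    by (rule form_sum_bij[where ?i1.0 = "\<lambda>s t. s + t" and ?i2.0 = "\<lambda>s t. - t" and ?j1.0 =
        "\<lambda>s t. s + t" and ?j2.0 = "\<lambda>s t. - t"])
       (auto simp: power2_eq_square algebra_simps)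
  have 7: "(\<lambda>s t. odd (s - t) \<and> odd t) = (\<lambda>s t :: int. odd t \<and> even s)" "(\<lambda>s t. odd (s - t)
      \<and> \<not> odd t) = (\<lambda>s t :: int. even t \<and> odd s)"
    "(\<lambda>s t. (even t \<and> even s) \<and> (s - t) mod 4 = 0) = (\<lambda>s t. (s - t :: int) mod 4 = 0 \<and> even t)"
    "(\<lambda>s t. (odd t \<and> odd s) \<and> (s - t) mod 4 = 0) = (\<lambda>s t. (s - t :: int) mod 4 = 0 \<and> odd t)"
    by (intro ext, presburger)+
  show ?thesis using X Y Z Z2 Z3 1 2 3 4 5 6 unfolding 7 Z4 power_0 power_one_right mult_1_left
      by linarith
qed

text \<open>The companion of the degree 15 equation, from the other reduced form of discriminant
  -15; it is applied with -q in place of q.\<close>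

lemma theta_degree_3_5: "theta (q^5) 1 * theta (q^3) 1 =
    theta (q^2) (-1) * theta (q^30) (-1) + 2 * (q^2 * (theta (q^2) q * theta (q^30) (q^15)))"
proof -
  let ?S = "form_sum q 2 2"
  have X: "q^0 * (theta (q^5) (q^0) * theta (q^3) (q^0)) = ?S (\<lambda>s t. even (s + t))"
  proof (rule form_sum_theta_pair[where ?i1.0 = "\<lambda>m n. m + n" and ?i2.0 = "\<lambda>m n. m - n" and ?j1.0 =
      "\<lambda>s t. (s + t) div 2" and ?j2.0 = "\<lambda>s t. (s - t) div 2"])
    show "(s + t) div 2 + (s - t) div 2 = s" "(s + t) div 2 - (s - t) div 2 = t"
        if "even (s + t)" for s t :: int
      using that by presburger+
    show "(m + n + (m - n)) div 2 = m" "(m + n - (m - n)) div 2 = n" for m n :: int by presburger+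
  qed (auto simp: power2_eq_square algebra_simps)
  have Z: "q^2 * (theta (q^2) (q^1) * theta (q^30) (q^15)) = ?S (\<lambda>s t. t mod 4 = 1)"
  proof (rule form_sum_theta_pair[where ?i1.0 = "\<lambda>m n. m - n" and ?i2.0 =
      "\<lambda>m n. 4 * n + 1" and ?j1.0 = "\<lambda>s t. s + t div 4" and ?j2.0 = "\<lambda>s t. t div 4"])
    show "(m - n) + (4 * n + 1) div 4 = m" for m n :: int by presburger
    show "4 * (t div 4) + 1 = t" if "t mod 4 = 1" for s t :: int using that by presburger
    show "(4 * n + 1) mod 4 = 1" for m n :: int by presburger
    show "(4 * n + 1) div 4 = n" for m n :: int by presburger
  qed (auto simp: power2_eq_square algebra_simps)
  have Z2: "?S (\<lambda>s t. t mod 4 = 1) = ?S (\<lambda>s t. odd t \<and> \<not> t mod 4 = 1)"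
  proof (rule form_sum_bij[where ?i1.0 = "\<lambda>s t. - s" and ?i2.0 = "\<lambda>s t. - t" and ?j1.0 =
      "\<lambda>s t. - s" and ?j2.0 = "\<lambda>s t. - t"])
    show "(odd (- t) \<and> \<not> (- t) mod 4 = 1) \<and> - (- s) = s \<and> - (- t) = t" if "t mod 4 = 1"
        for s t :: int
      using that by presburger
    show "(- t) mod 4 = 1 \<and> - (- s) = s \<and> - (- t) = t" if "odd t \<and> \<not> t mod 4 = 1" for s t :: int
      using that by presburger
  qed auto
  have Z3: "?S (\<lambda>s t. odd t) = ?S (\<lambda>s t. odd t \<and> t mod 4 = 1) + ?S (\<lambda>s t. odd t \<and> \<not> t mod 4 = 1)"
    by (rule form_sum_split) auto
  have Z4: "(\<lambda>s t. odd t \<and> t mod 4 = 1) = (\<lambda>(s :: int) t :: int. t mod 4 = 1)"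
    by (intro ext) presburger
  have Y: "theta (q^2) (-1) * theta (q^30) (-1) = ?S (\<lambda>s t. t mod 4 = 0
      \<and> even s) - ?S (\<lambda>s t. t mod 4 = 0 \<and> odd s)"
    by (rule form_sum_theta_pair_minus[where ?i1.0 = "\<lambda>m n. m - n" and ?i2.0 =
        "\<lambda>m n. 4 * n" and ?j1.0 = "\<lambda>s t. s + t div 4" and ?j2.0 = "\<lambda>s t. t div 4"])
       (auto simp: power2_eq_square algebra_simps)
  have 1: "?S (\<lambda>s t. even (s + t)) = ?S (\<lambda>s t. even (s + t) \<and> even t) + ?S (\<lambda>s t. even (s + t)
      \<and> odd t)"
    by (rule form_sum_split) auto
  have 2: "?S (\<lambda>s t. even t \<and> even s) = ?S (\<lambda>s t. (even t \<and> even s) \<and> t mod 4 =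
      0) + ?S (\<lambda>s t. (even t \<and> even s) \<and> \<not> t mod 4 = 0)"
    by (rule form_sum_split) auto
  have 3: "?S (\<lambda>s t. even t \<and> odd s) = ?S (\<lambda>s t. (even t \<and> odd s) \<and> t mod 4 =
      0) + ?S (\<lambda>s t. (even t \<and> odd s) \<and> \<not> t mod 4 = 0)"
    by (rule form_sum_split) auto
  have 4: "?S (\<lambda>s t. odd t) = ?S (\<lambda>s t. odd t \<and> odd s) + ?S (\<lambda>s t. odd t \<and> \<not> odd s)"
    by (rule form_sum_split) auto
  \<comment> \<open>For even t the reflection (s, t) -> (-s - t / 2, t) preserves 2 s^2 + s t + 2
    t^2; it changes the parity of s if t is 2 modulo 4.\<close>
  have 5: "?S (\<lambda>s t. (even t \<and> even s) \<and> \<not> t mod 4 = 0) = ?S (\<lambda>s t. (even t \<and> odd s) \<and> \<not> t mod 4 =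
      0)"
  proof (rule form_sum_bij[where ?i1.0 = "\<lambda>s t. - s - t div 2" and ?i2.0 = "\<lambda>s t. t" and ?j1.0 =
      "\<lambda>s t. - s - t div 2" and ?j2.0 = "\<lambda>s t. t"])
    fix s t :: int
    show "((even t \<and> odd (- s - t div 2)) \<and> \<not> t mod 4 = 0) \<and> - (- s - t div 2) - t div 2 = s \<and> t =
        t"
      if "(even t \<and> even s) \<and> \<not> t mod 4 = 0"
      using that by presburger
    show "((even t \<and> even (- s - t div 2)) \<and> \<not> t mod 4 = 0) \<and> - (- s - t div 2) - t div 2 = s \<and> t =
        t"
      if "(even t \<and> odd s) \<and> \<not> t mod 4 = 0"
      using that by presburger
  qed (auto simp: power2_eq_square algebra_simps elim!: evenE)
  have 6: "?S (\<lambda>s t. odd t \<and> even s) = ?S (\<lambda>s t. even t \<and> odd s)"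
    by (rule form_sum_bij[where ?i1.0 = "\<lambda>s t. t" and ?i2.0 = "\<lambda>s t. s" and ?j1.0 =
        "\<lambda>s t. t" and ?j2.0 = "\<lambda>s t. s"]) auto
  have 7: "(\<lambda>s t. even (s + t) \<and> even t) = (\<lambda>s t :: int. even t \<and> even s)" "(\<lambda>s t. even (s + t)
      \<and> odd t) = (\<lambda>s t :: int. odd t \<and> odd s)"
    "(\<lambda>s t. odd t \<and> \<not> odd s) = (\<lambda>s t :: int. odd t \<and> even (s :: int))"
    "(\<lambda>s t. (even t \<and> even s) \<and> t mod 4 = 0) = (\<lambda>(s :: int) t. (t :: int) mod 4 = 0 \<and> even s)"
    "(\<lambda>s t. (even t \<and> odd s) \<and> t mod 4 = 0) = (\<lambda>(s :: int) t. (t :: int) mod 4 = 0 \<and> odd s)"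
    by (intro ext, presburger)+
  show ?thesis using X Y Z Z2 Z3 1 2 3 4 5 6 unfolding 7 Z4 power_0 power_one_right mult_1_left
      by linarith
qed

end

subsection \<open>Special values\<close>

text \<open>n^2 and n have the same parity. Hence modular equations at -q are relations between
  alternating series.\<close>

lemma theta_uminus:
  fixes q w :: real
  shows "theta (- q) w = theta q (- w)"
proof -
  have "(- q) powi (n^2) * w powi n = q powi (n^2) * (- w) powi n" for n :: int
    using power_int_mult_distrib[of "-1" q "n^2"] power_int_mult_distrib[of "-1" w n]
    by (auto simp: minus_one_powi)
  then show ?thesis by (simp add: theta_def)
qed

text \<open>In \<open>ln_modulus_ratio\<close> the Lambert series have terms increasing in q, and ln
  q increases strictly. With the value 1 at r = 1 this decides between kappa and 1 / kappa.\<close>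

lemma modulus_ratio_strict_antimono:
  assumes p: "0 < p" and pq: "p < q" and q: "q < 1"
  shows "modulus_ratio q < modulus_ratio p"
proof -
  have LS: "LS (p^k) (p^(2*k)) \<le> LS (q^k) (q^(2*k))" if "k > 0" for k
    unfolding LS_def
  proof (rule suminf_le)
    show "summable (\<lambda>n. (p^k)^n / (real n * (1 - (p^(2*k))^n)))" "summable (\<lambda>n. (q^k)^n / (real n *
        (1 - (q^(2*k))^n)))"
      by (rule summable_LS; use that assms in \<open>auto simp: power_less_one_iff\<close>)+
    fix n :: nat
    show "(p^k)^n / (real n * (1 - (p^(2*k))^n)) \<le> (q^k)^n / (real n * (1 - (q^(2*k))^n))"
    proof (cases "n = 0")
      case False
      have "(q^(2*k))^n < 1" using that False p pq q by (simp add: power_less_one_iff)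
      then show ?thesis using False that p pq
        by (intro frac_le mult_pos_pos mult_left_mono diff_left_mono power_mono) auto
    qed simp
  qed
  have "ln p < ln q" using assms by simp
  moreover have "LS p (p^2) \<le> LS q (q^2)" "LS (p^2) (p^4) \<le> LS (q^2) (q^4)"
      using LS[of 1] LS[of 2] by simp_all
  ultimately have "ln (4 * modulus_ratio q) < ln (4 * modulus_ratio p)"
    using ln_modulus_ratio[of p] ln_modulus_ratio[of q] assms by linarith
  then show ?thesis using modulus_ratio_pos[of p] modulus_ratio_pos[of q] assms by simp
qed

definition theta2 :: "real \<Rightarrow> real" where
  "theta2 y = exp (- (pi * y / 4)) * theta (exp (- (pi * y))) (exp (- (pi * y)))"

definition theta3 :: "real \<Rightarrow> real" where
  "theta3 y = theta (exp (- (pi * y))) 1"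

definition theta4 :: "real \<Rightarrow> real" where
  "theta4 y = theta (exp (- (pi * y))) (-1)"

text \<open>Normalised so that the squares of \<open>psi_plus\<close> and \<open>psi_minus\<close>
  are theta2 theta3 and theta2 theta4; the prefactor absorbs the powers of q and the factors 2 in
  the equations of degree 7 and 15.\<close>

definition psi_plus :: "real \<Rightarrow> real" where
  "psi_plus y = sqrt 2 * exp (- (pi * y / 8)) * theta (exp (- (pi * y)) ^ 2) (exp (- (pi * y)))"

definition psi_minus :: "real \<Rightarrow> real" where
  "psi_minus y = sqrt 2 * exp (- (pi * y / 8)) * theta (exp (- (pi * y)) ^ 2) (- exp (- (pi * y)))"

context
  fixes y :: real
  assumes y: "y > 0"
begin

private abbreviation "q \<equiv> exp (- (pi * y))"

lemma q_bounds: "0 < q" "q < 1" "q \<noteq> 0" "norm q < 1" "\<bar>q\<bar> < 1" using y by auto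

lemma q_power: "exp (- (pi * (real n * y))) = q ^ n"
  by (simp add: mult_ac flip: exp_of_nat_mult)

lemma theta234_pos: "theta2 y > 0" "theta3 y > 0" "theta4 y > 0"
  using theta_q_pos[of q] theta_minus_one_pos[of q] theta_pos[of q 1] q_bounds
  by (auto simp: theta2_def theta3_def theta4_def)

lemma theta2_double: "theta2 (2 * y) = exp (- (pi * y / 2)) * theta (q^2) (q^2)"
  unfolding theta2_def using q_power[of 2] by simp

lemma theta34_double: "theta3 (2 * y) = theta (q^2) 1" "theta4 (2 * y) = theta (q^2) (-1)"
  unfolding theta3_def theta4_def using q_power[of 2] by simp_all

lemma landen:
  "theta3 y ^ 2 = theta3 (2 * y) ^ 2 + theta2 (2 * y) ^ 2"
  "theta4 y ^ 2 = theta3 (2 * y) ^ 2 - theta2 (2 * y) ^ 2"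
  "theta2 y ^ 2 = 2 * theta2 (2 * y) * theta3 (2 * y)"
  "theta4 (2 * y) ^ 2 = theta3 y * theta4 y"
proof -
  have e: "exp (- (pi * y / 2)) ^ 2 = q" "exp (- (pi * y / 4)) ^ 2 = exp (- (pi * y / 2))"
    by (simp_all flip: exp_of_nat_mult)
  show "theta3 y ^ 2 = theta3 (2 * y) ^ 2 + theta2 (2 * y) ^ 2"
    using theta_mult_theta[of q 1 1] q_bounds
    by (simp add: theta34_double theta2_double theta3_def[of y] power_mult_distrib e
        power2_eq_square[of "theta _ _"])
  show "theta4 y ^ 2 = theta3 (2 * y) ^ 2 - theta2 (2 * y) ^ 2"
    using theta_minus_mult[of q 1] q_bounds
    by (simp add: theta34_double theta2_double theta4_def[of y] power_mult_distrib e
        power2_eq_square[of "theta q _"])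
  show "theta2 y ^ 2 = 2 * theta2 (2 * y) * theta3 (2 * y)"
    using theta_q_mult[of q 1] q_bounds
    by (simp add: theta34_double theta2_double power_mult_distrib e theta2_def[of y]
        power2_eq_square[of "theta q _"])
  show "theta4 (2 * y) ^ 2 = theta3 y * theta4 y"
    using theta_one_mult_minus_one[of q] q_bounds by (simp add: theta34_double theta3_def[of y]
        theta4_def[of y])
qed

text \<open>(X^2 + Y^2)^2 = (2 X Y)^2 + (X^2 - Y^2)^2, where X and Y are the values of
  \<open>theta3\<close> and \<open>theta2\<close> at 2 y.\<close>

lemma jacobi_quartic: "theta3 y ^ 4 = theta2 y ^ 4 + theta4 y ^ 4"
proof -
  have "(theta3 y ^ 2)^2 = (theta2 y ^ 2)^2 + (theta4 y ^ 2)^2"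
    unfolding landen by (simp add: power2_eq_square algebra_simps)
  then show ?thesis by (simp flip: power_mult)
qed

lemma theta4_mult_theta3_inverse: "theta4 y * theta3 (1 / y) = theta3 y * theta2 (1 / y)"
  using theta_inversion[OF y] by (simp add: theta2_def theta3_def theta4_def mult.commute)

lemma modulus_ratio_eq_theta: "modulus_ratio q = theta4 y ^ 2 / theta2 y ^ 2"
proof -
  have "sqrt q = exp (- (pi * y / 4)) ^ 2" by (rule real_sqrt_unique) (auto simp flip:
      exp_of_nat_mult exp_add)
  then show ?thesis by (simp add: modulus_ratio_def theta2_def theta4_def power_mult_distrib)
qed

lemma psi_plus_pos: "psi_plus y > 0"
  unfolding psi_plus_def using theta_pos[of "q^2" q] q_bounds by (simp add: power_less_one_iff)

lemma psi_minus_pos: "psi_minus y > 0"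
proof -
  have "theta (q^2) (-q) > 0"
  proof (subst theta_eq_exp_real)
    have "q^2 * - q = - (q^3)" "q^2 / - q = - q" by (simp_all add: power2_eq_square power3_eq_cube)
    then show "\<bar>q^2 * - q\<bar> < 1" "\<bar>q^2 / - q\<bar> < 1" using q_bounds
        by (simp_all add: power_less_one_iff)
  qed (use q_bounds in \<open>auto simp: power_less_one_iff\<close>)
  then show ?thesis unfolding psi_minus_def by simp
qed

lemma psi_square: "psi_plus y ^ 2 = theta2 y * theta3 y" "psi_minus y ^ 2 = theta2 y * theta4 y"
proof -
  have e: "exp (- (pi * y / 8)) ^ 2 = exp (- (pi * y / 4))" by (simp flip: exp_of_nat_mult)
  show "psi_plus y ^ 2 = theta2 y * theta3 y"
    using theta_mult_q[of q "-1"] q_bounds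
    by (simp add: psi_plus_def theta2_def[of y] theta3_def[of y] power_mult_distrib e
        power2_eq_square[of "theta _ _"])
  show "psi_minus y ^ 2 = theta2 y * theta4 y"
    using theta_mult_q[of q 1] q_bounds
    by (simp add: psi_minus_def theta2_def[of y] theta4_def[of y] power_mult_distrib e
        power2_eq_square[of "theta _ _"])
qed

end

text \<open>The inversion formula at y and at 1 / y gives the ratios to \<open>theta3\<close>. One
  factor c, classically sqrt y, is common to the three equations and cancels from homogeneous
  relations.\<close>

lemma theta_reciprocal:
  assumes "y > 0"
  obtains c where "c > 0" "theta3 (1 / y) = c * theta3 y" "theta4 (1 / y) =
      c * theta2 y" "theta2 (1 / y) = c * theta4 y"
proof
  have y': "1 / y > 0" using assms by simp
  note pos = theta234_pos[OF assms] theta234_pos[OF y']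
  show "theta3 (1 / y) / theta3 y > 0" using pos by simp
  show "theta3 (1 / y) = theta3 (1 / y) / theta3 y * theta3 y" using pos by simp
  show "theta4 (1 / y) = theta3 (1 / y) / theta3 y * theta2 y"
    using theta4_mult_theta3_inverse[OF y'] pos by (simp add: field_simps)
  show "theta2 (1 / y) = theta3 (1 / y) / theta3 y * theta4 y"
    using theta4_mult_theta3_inverse[OF assms] pos by (simp add: field_simps)
qed

lemma theta24_one: "theta4 1 = theta2 1"
  using theta4_mult_theta3_inverse[of 1] theta234_pos[of 1] by simp

lemma modulus_ratio_nome: "r \<ge> 1 \<Longrightarrow> modulus_ratio (nome r) =
    theta4 (sqrt r) ^ 2 / theta2 (sqrt r) ^ 2"
  using modulus_ratio_eq_theta[of "sqrt r"] by (simp add: nome_def)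

lemma modulus_ratio_nome_1: "modulus_ratio (nome 1) = 1"
  using theta24_one theta234_pos[of 1] by (simp add: modulus_ratio_nome)

lemma modulus_ratio_nome_gt_1:
  assumes "r > 1"
  shows "modulus_ratio (nome r) > 1"
proof -
  have "sqrt (real 1) < sqrt (real r)" using assms by (simp only: real_sqrt_less_iff
      of_nat_less_iff)
  then have "nome r < nome 1" by (simp add: nome_def)
  from modulus_ratio_strict_antimono[OF _ this, unfolded modulus_ratio_nome_1]
  show ?thesis using nome_bounds[of r] nome_bounds[of 1] assms by simp
qed

context
  fixes y :: real
  assumes y: "y > 0"
begin

private abbreviation "p \<equiv> exp (- (pi * y))"

lemma theta34_scale: "theta3 (real n * y) = theta (p^n) 1" "theta4 (real n * y) = theta (p^n) (-1)"
  unfolding theta3_def theta4_def by (simp_all add: q_power[OF y, simplified])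

lemma psi_scale:
  "psi_plus (real n * y) = sqrt 2 * exp (- (pi * (real n * y) / 8)) * theta (p^(2*n)) (p^n)"
  "psi_minus (real n * y) = sqrt 2 * exp (- (pi * (real n * y) / 8)) * theta (p^(2*n)) (- (p^n))"
  unfolding psi_plus_def psi_minus_def q_power[OF y]
  by (simp_all add: mult.commute[of n 2] flip: power_mult)

lemma exp_mult_eq_power:
  assumes "a + b = 8 * k"
  shows "(sqrt 2 * exp (- (pi * (real a * y) / 8)) * u) * (sqrt 2 * exp (- (pi * (real b * y) / 8))
      * v) = 2 * (p^k * (u * v))"
proof -
  have e: "real a + real b = 8 * real k" using assms
      by (metis of_nat_add of_nat_mult of_nat_numeral)
  have "exp (- (pi * (real a * y) / 8)) * exp (- (pi * (real b * y) / 8)) =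
      exp (- (pi * ((real a + real b) * y) / 8))"
    by (simp add: field_simps flip: exp_add)
  also have "\<dots> = p^k" unfolding e by (simp add: mult_ac flip: exp_of_nat_mult)
  finally show ?thesis by (simp add: field_simps)
qed

lemma psi_mult:
  assumes "a + b = 8 * k"
  shows "psi_plus (real a * y) * psi_plus (real b * y) =
      2 * (p^k * (theta (p^(2*a)) (p^a) * theta (p^(2*b)) (p^b)))"
    "psi_minus (real a * y) * psi_minus (real b * y) = 2 * (p^k * (theta (p^(2*a)) (- (p^a)) *
        theta (p^(2*b)) (- (p^b))))"
  unfolding psi_scale by (rule exp_mult_eq_power[OF assms])+

lemma theta3_degree_3: "theta3 y * theta3 (3 * y) = theta4 y * theta4 (3 * y) + theta2 y * theta2
    (3 * y)"
proof -
  have "theta2 y * theta2 (3 * y) = p * (theta p p * theta (p^3) (p^3))"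
  proof -
    have "exp (- (pi * y / 4)) * exp (- (pi * (3 * y) / 4)) = p"
        by (simp add: field_simps flip: exp_add)
    then show ?thesis using q_power[OF y, of 3] by (simp add: theta2_def mult_ac)
  qed
  then show ?thesis
    using theta_degree_3[of p] theta34_scale[of 1] theta34_scale[of 3] y by simp
qed

lemma theta3_degree_7: "theta3 y * theta3 (7 * y) = theta4 (2 * y) * theta4 (14 * y) + psi_plus y *
    psi_plus (7 * y)"
  using theta_degree_7[of p] theta34_scale[of 1] theta34_scale[of 7] theta34_scale[of 2]
      theta34_scale[of 14]
    psi_mult(1)[of 1 7 1] y by simp

lemma theta3_degree_15: "theta3 y * theta3 (15 * y) =
    theta4 (6 * y) * theta4 (10 * y) + psi_plus (3 * y) * psi_plus (5 * y)"
  using theta_degree_15[of p] theta34_scale[of 1] theta34_scale[of 15] theta34_scale[of 6]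
      theta34_scale[of 10]
    psi_mult(1)[of 3 5 1] y by simp

lemma theta4_degree_15: "theta4 y * theta4 (15 * y) =
    theta4 (6 * y) * theta4 (10 * y) - psi_minus (3 * y) * psi_minus (5 * y)"
  using theta_degree_15[of "-p"] theta34_scale[of 1] theta34_scale[of 15] theta34_scale[of 6]
      theta34_scale[of 10]
    psi_mult(2)[of 3 5 1] y by (simp add: theta_uminus power_minus_odd)

lemma theta4_degree_3_5: "theta4 (5 * y) * theta4 (3 * y) =
    theta4 (2 * y) * theta4 (30 * y) + psi_minus y * psi_minus (15 * y)"
  using theta_degree_3_5[of "-p"] theta34_scale[of 5] theta34_scale[of 3] theta34_scale[of 2]
      theta34_scale[of 30]
    psi_mult(2)[of 1 15 2] y by (simp add: theta_uminus power_minus_odd)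

end

text \<open>The hypothesis makes \<open>modulus_ratio (nome r)\<close> and its inverse the two roots of
  \<open>x + 1 / x = A^2\<close>, by the quartic identity of Jacobi.\<close>

lemma modulus_ratio_nome_eqI:
  assumes r: "r > 1" and A: "theta3 (sqrt r) ^ 2 = A * (theta2 (sqrt r) * theta4 (sqrt r))"
    and L: "L \<ge> 1" "L + L' = A^2" "L * L' = 1"
  shows "modulus_ratio (nome r) = L"
proof -
  define k where "k = modulus_ratio (nome r)"
  have s: "sqrt (real r) > 0" using r by simp
  define a b where "a = theta2 (sqrt r)" and "b = theta4 (sqrt r)"
  have pos: "a > 0" "b > 0" using theta234_pos[OF s] by (auto simp: a_def b_def)
  have "k > 1" unfolding k_def by (rule modulus_ratio_nome_gt_1[OF r])
  have k: "k = b^2 / a^2" using r by (simp add: k_def a_def b_def modulus_ratio_nome)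
  have "(A * (a * b))^2 = a^4 + b^4"
    using jacobi_quartic[OF s] unfolding a_def b_def A[symmetric] by (simp flip: power_mult)
  then have "(a^4 + b^4) / (a^4) = A^2 * (a^2 * b^2) / a^4" by (simp add: power_mult_distrib)
  moreover have "k * k + 1 = (a^4 + b^4) / a^4" "A^2 * (a^2 * b^2) / a^4 = A^2 * k"
    unfolding k using pos by (simp_all add: field_simps power2_eq_square power4_eq_xxxx)
  ultimately have "k * k + 1 = A^2 * k" by simp
  also have "\<dots> = (L + L') * k" by (simp only: L(2))
  finally have "(k - L) * (k - L') = 0" using L(3) by (simp add: algebra_simps)
  moreover have "k \<noteq> L'"
  proof
    assume "k = L'"
    then have "L * k > 1 * 1" using \<open>k > 1\<close> L(1) by (intro mult_le_less_imp_less) auto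
    then show False using L(3) \<open>k = L'\<close> by simp
  qed
  ultimately show ?thesis by (simp add: k_def)
qed

text \<open>At 1 / sqrt r a modular equation of degree r pairs 1 / sqrt r with sqrt r. Each such
  product is written here through c theta3^2, c theta2 theta4 or their geometric mean, so that the
  equation becomes algebraic.\<close>

lemma theta_square_at_fixed_point:
  assumes z: "z > 0" and c: "c > 0" "theta3 (1 / z) = c * theta3 z" "theta4 (1 / z) =
      c * theta2 z" "theta2 (1 / z) = c * theta4 z"
  shows "theta3 (1 / z) * theta3 z = c * theta3 z ^ 2" "theta4 (1 / z) * theta4 z =
      c * (theta2 z * theta4 z)"
    "theta2 (1 / z) * theta2 z = c * (theta2 z * theta4 z)"
    "theta4 (2 * (1 / z)) * theta4 (2 * z) = sqrt ((c * theta3 z ^ 2) * (c * (theta2 z * theta4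
        z)))"
    "psi_plus (1 / z) * psi_plus z = sqrt ((c * theta3 z ^ 2) * (c * (theta2 z * theta4 z)))"
    "psi_minus (1 / z) * psi_minus z = c * (theta2 z * theta4 z)"
proof -
  have z': "1 / z > 0" using z by simp
  show "theta3 (1 / z) * theta3 z = c * theta3 z ^ 2" "theta4 (1 / z) * theta4 z =
      c * (theta2 z * theta4 z)"
    "theta2 (1 / z) * theta2 z = c * (theta2 z * theta4 z)"
    unfolding c by (simp_all add: power2_eq_square mult_ac)
  note pos = theta234_pos[OF z] psi_plus_pos[OF z] psi_plus_pos[OF z'] psi_minus_pos[OF z]
      psi_minus_pos[OF z']
    theta234_pos(3)[of "2 * z"] theta234_pos(3)[of "2 * (1 / z)"]
  have "(theta4 (2 * (1 / z)) * theta4 (2 * z))^2 = (c * theta3 z ^ 2) * (c * (theta2 z * theta4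
      z))"
    unfolding power_mult_distrib landen(4)[OF z] landen(4)[OF z'] c
        by (simp add: power2_eq_square mult_ac)
  then show "theta4 (2 * (1 / z)) * theta4 (2 * z) = sqrt ((c * theta3 z ^ 2) * (c * (theta2 z *
      theta4 z)))"
    using pos z by (intro real_sqrt_unique[symmetric]) auto
  have "(psi_plus (1 / z) * psi_plus z)^2 = (c * theta3 z ^ 2) * (c * (theta2 z * theta4 z))"
    unfolding power_mult_distrib psi_square[OF z] psi_square[OF z'] c
        by (simp add: power2_eq_square mult_ac)
  then show "psi_plus (1 / z) * psi_plus z = sqrt ((c * theta3 z ^ 2) * (c * (theta2 z * theta4
      z)))"
    using pos by (intro real_sqrt_unique[symmetric]) auto
  have "(psi_minus (1 / z) * psi_minus z)^2 = (c * (theta2 z * theta4 z))^2"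
    unfolding power_mult_distrib psi_square[OF z] psi_square[OF z'] c
        by (simp add: power2_eq_square mult_ac)
  then show "psi_minus (1 / z) * psi_minus z = c * (theta2 z * theta4 z)"
    by (rule power_eq_imp_eq_base) (use pos c(1) in auto)
qed

lemma sqrt_reciprocal: "r > 0 \<Longrightarrow> real r * (1 / sqrt r) = sqrt r"
  by (simp add: real_div_sqrt)

text \<open>Landen's transformation serves as the modular equation: it relates 1 / sqrt 2 to sqrt 2,
  and eliminating c gives s + 1 = s (s - 1) for s = theta3^2 / theta2^2.\<close>

lemma modulus_ratio_nome_2: "modulus_ratio (nome 2) = sqrt (2 + 2 * sqrt 2)"
proof -
  have z: "sqrt 2 > (0::real)" by simp
  have y: "1 / sqrt 2 > (0::real)" by simp
  obtain c where c: "c > 0" "theta3 (1 / sqrt 2) = c * theta3 (sqrt 2)" "theta4 (1 / sqrt 2) =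
      c * theta2 (sqrt 2)" "theta2 (1 / sqrt 2) = c * theta4 (sqrt 2)"
    by (rule theta_reciprocal[OF z])
  define a b d where "a = theta2 (sqrt 2)" and "b = theta4 (sqrt 2)" and "d = theta3 (sqrt 2)"
  have pos: "a > 0" "b > 0" "d > 0" using theta234_pos[OF z] by (auto simp: a_def b_def d_def)
  have e: "2 * (1 / sqrt 2) = sqrt 2" by (simp add: real_div_sqrt)
  have 1: "c^2 * d^2 = d^2 + a^2" and 2: "c^2 * a^2 = d^2 - a^2"
    using landen(1,2)[OF y] unfolding c e by (simp_all add: a_def b_def d_def power_mult_distrib)
  define s where "s = d^2 / a^2"
  have s: "s > 0" "d^2 = s * a^2" using pos by (auto simp: s_def)
  have "a^2 * (c^2 * d^2) = d^2 * (c^2 * a^2)" by (simp add: mult_ac)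
  then have "a^2 * (d^2 + a^2) = d^2 * (d^2 - a^2)" unfolding 1 2 .
  then have "(a^2)^2 * (s + 1) = (a^2)^2 * (s * (s - 1))" unfolding s
      by (simp add: power2_eq_square algebra_simps)
  then have "s + 1 = s * (s - 1)" using pos by simp
  then have "(s - 1)^2 = 2" by (simp add: power2_eq_square algebra_simps)
  moreover have "s - 1 > 0" using \<open>s + 1 = s * (s - 1)\<close> s(1)
      by (metis add_pos_pos zero_less_mult_pos zero_less_one)
  ultimately have s': "s = 1 + sqrt 2" using real_sqrt_unique[of "s - 1" 2] by simp
  have "b^4 = (d^2)^2 - (a^2)^2" using jacobi_quartic[OF z]
      by (simp add: a_def b_def d_def flip: power_mult)
  also have "\<dots> = (s^2 - 1) * a^4" unfolding s(2) by (simp add: power2_eq_square power4_eq_xxxx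
      algebra_simps)
  finally have "(b^2 / a^2)^2 = s^2 - 1" using pos by (simp add: power_divide flip: power_mult)
  also have "\<dots> = 2 + 2 * sqrt 2" unfolding s' by (simp add: power2_eq_square algebra_simps)
  finally have "sqrt (2 + 2 * sqrt 2) = b^2 / a^2" by (rule real_sqrt_unique) simp
  then show ?thesis by (simp add: modulus_ratio_nome a_def b_def)
qed

lemma modulus_ratio_nome_3: "modulus_ratio (nome 3) = 2 + sqrt 3"
proof (rule modulus_ratio_nome_eqI)
  let ?z = "sqrt (real 3)"
  have z: "?z > 0" by simp
  obtain c where c: "c > 0" "theta3 (1 / ?z) = c * theta3 ?z" "theta4 (1 / ?z) =
      c * theta2 ?z" "theta2 (1 / ?z) = c * theta4 ?z"
    by (rule theta_reciprocal[OF z])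
  have e: "3 * (1 / ?z) = ?z" using sqrt_reciprocal[of 3] by simp
  have "theta3 (1 / ?z) * theta3 ?z = theta4 (1 / ?z) * theta4 ?z + theta2 (1 / ?z) * theta2 ?z"
    using theta3_degree_3[of "1 / ?z"] unfolding e by simp
  then have "c * theta3 ?z ^ 2 = c * (2 * (theta2 ?z * theta4 ?z))"
    unfolding theta_square_at_fixed_point[OF z c] by simp
  then show "theta3 ?z ^ 2 = 2 * (theta2 ?z * theta4 ?z)" using c(1) by simp
  show "2 + sqrt 3 + (2 - sqrt 3) = 2^2" by simp
  show "(2 + sqrt 3) * (2 - sqrt 3) = 1" by (simp add: algebra_simps)
  show "2 + sqrt 3 \<ge> (1::real)" by (simp add: add_increasing2)
qed simp

text \<open>Both products on the right are the geometric mean of x = c theta3^2 and y = c theta2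
  theta4, so x = 2 sqrt (x y), that is x = 4 y.\<close>

lemma modulus_ratio_nome_7: "modulus_ratio (nome 7) = 8 + 3 * sqrt 7"
proof (rule modulus_ratio_nome_eqI)
  let ?z = "sqrt (real 7)"
  have z: "?z > 0" by simp
  obtain c where c: "c > 0" "theta3 (1 / ?z) = c * theta3 ?z" "theta4 (1 / ?z) =
      c * theta2 ?z" "theta2 (1 / ?z) = c * theta4 ?z"
    by (rule theta_reciprocal[OF z])
  have e: "7 * (1 / ?z) = ?z" "14 * (1 / ?z) = 2 * ?z" using sqrt_reciprocal[of 7] by simp_all
  have "theta3 (1 / ?z) * theta3 ?z = theta4 (2 * (1 / ?z)) * theta4 (2 * ?z) + psi_plus (1 / ?z) *
      psi_plus ?z"
    using theta3_degree_7[of "1 / ?z"] unfolding e by simp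
  then have *: "c * theta3 ?z ^ 2 = 2 * sqrt ((c * theta3 ?z ^ 2) * (c * (theta2 ?z * theta4 ?z)))"
    unfolding theta_square_at_fixed_point[OF z c] by simp
  have gen: "x = 4 * y" if "x = 2 * sqrt (x * y)" "x > 0" "y > 0" for x y :: real
  proof -
    have "x^2 = 4 * (x * y)" using that(2,3) by (subst that(1)) (simp add: power_mult_distrib)
    then show ?thesis using that(2) by (simp add: power2_eq_square)
  qed
  have "c * theta3 ?z ^ 2 = 4 * (c * (theta2 ?z * theta4 ?z))"
    by (rule gen[OF *]) (use c(1) theta234_pos[OF z] in auto)
  then show "theta3 ?z ^ 2 = 4 * (theta2 ?z * theta4 ?z)" using c(1) by simp
  show "8 + 3 * sqrt 7 + (8 - 3 * sqrt 7) = 4^2" by simp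
  show "(8 + 3 * sqrt 7) * (8 - 3 * sqrt 7) = 1" by (simp add: algebra_simps)
  show "8 + 3 * sqrt 7 \<ge> (1::real)" by (simp add: add_increasing2)
qed simp

text \<open>The inversion acts on two pairs, 1 / sqrt 15 with sqrt 15 and sqrt 15 / 5 with sqrt 15 /
  3. Three modular equations at 1 / sqrt 15 connect T, W', V and W; eliminating V and W leaves h^2 =
  2 h W' + 4 W'^2 for h = sqrt (T W').\<close>

lemma modulus_ratio_nome_15: "modulus_ratio (nome 15) =
    28 + 16 * sqrt 3 + 12 * sqrt 5 + 7 * sqrt 15"
proof (rule modulus_ratio_nome_eqI)
  let ?z = "sqrt (real 15)" and ?x = "sqrt (real 15) / 3"
  have z: "?z > 0" and x: "?x > 0" by simp_all
  obtain c where c: "c > 0" "theta3 (1 / ?z) = c * theta3 ?z" "theta4 (1 / ?z) =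
      c * theta2 ?z" "theta2 (1 / ?z) = c * theta4 ?z"
    by (rule theta_reciprocal[OF z])
  obtain d where d: "d > 0" "theta3 (1 / ?x) = d * theta3 ?x" "theta4 (1 / ?x) =
      d * theta2 ?x" "theta2 (1 / ?x) = d * theta4 ?x"
    by (rule theta_reciprocal[OF x])
  have e: "15 * (1 / ?z) = ?z" "30 * (1 / ?z) = 2 * ?z" "3 * (1 / ?z) = 1 / ?x" "5 * (1 / ?z) = ?x"
     "6 * (1 / ?z) = 2 * (1 / ?x)" "10 * (1 / ?z) = 2 * ?x" using sqrt_reciprocal[of 15] by simp_all
  have y: "1 / ?z > 0" using z by simp
  define T where "T = c * theta3 ?z ^ 2"
  define W' where "W' = c * (theta2 ?z * theta4 ?z)"
  define V where "V = theta4 (2 * (1 / ?x)) * theta4 (2 * ?x)"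
  define W where "W = d * (theta2 ?x * theta4 ?x)"
  have pos: "T > 0" "W' > 0" using c(1) theta234_pos[OF z] by (auto simp: T_def W'_def)
  have "psi_plus (1 / ?x) * psi_plus ?x = V"
    unfolding V_def theta_square_at_fixed_point[OF x d] ..
  then have 1: "T = 2 * V"
    using theta3_degree_15[OF y] unfolding e theta_square_at_fixed_point[OF z c] V_def[symmetric]
        T_def[symmetric] by simp
  have 2: "W' = V - W"
    using theta4_degree_15[OF y] unfolding e theta_square_at_fixed_point(2,6)[OF z c]
        theta_square_at_fixed_point(6)[OF x d]
      V_def[symmetric] W'_def[symmetric] W_def[symmetric] .
  have 3: "W = sqrt (T * W') + W'"
    using theta4_degree_3_5[OF y] theta_square_at_fixed_point(2)[OF x d]
    unfolding e theta_square_at_fixed_point(4,6)[OF z c] T_def[symmetric] W'_def[symmetric]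
        W_def[symmetric] by (simp add: mult.commute)
  define h where "h = sqrt (T * W')"
  have h: "h > 0" "h^2 = T * W'" using pos by (auto simp: h_def)
  have T: "T = 2 * h + 4 * W'" using 1 2 3 unfolding h_def by linarith
  then have "(h - W')^2 = 5 * W'^2" using h(2) by (simp add: power2_eq_square algebra_simps)
  then have "\<bar>h - W'\<bar> = sqrt 5 * W'" using pos by (metis abs_of_pos real_sqrt_abs real_sqrt_mult)
  moreover have "sqrt 5 * W' > 1 * W'" using pos by (intro mult_strict_right_mono) auto
  ultimately have "h - W' = sqrt 5 * W'" using h(1) by linarith
  then have "h = (1 + sqrt 5) * W'" by (simp add: algebra_simps)
  then have "T = (6 + 2 * sqrt 5) * W'" unfolding T by (simp add: algebra_simps)
  then show "theta3 ?z ^ 2 = (6 + 2 * sqrt 5) * (theta2 ?z * theta4 ?z)" using c(1)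
      unfolding T_def W'_def by simp
  show "28 + 16 * sqrt 3 + 12 * sqrt 5 + 7 * sqrt 15 + (28 - 16 * sqrt 3 + 12 * sqrt 5 - 7 * sqrt
      15) = (6 + 2 * sqrt 5)^2"
    by (simp add: power2_eq_square algebra_simps)
  have s15: "sqrt 15 = sqrt 3 * sqrt (5::real)" by (simp flip: real_sqrt_mult)
  have "(28 + 16 * a + 12 * b + 7 * (a * b)) * (28 - 16 * a + 12 * b - 7 * (a * b)) =
     784 + 672 * b + 144 * b^2 - a^2 * (256 + 224 * b + 49 * b^2)" for a b :: real
         by (simp add: power2_eq_square algebra_simps)
  then show "(28 + 16 * sqrt 3 + 12 * sqrt 5 + 7 * sqrt 15) * (28 - 16 * sqrt 3 + 12 * sqrt 5 - 7 *
      sqrt 15) = 1"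
    unfolding s15 by simp
  show "28 + 16 * sqrt 3 + 12 * sqrt 5 + 7 * sqrt 15 \<ge> (1::real)" by (simp add: add_increasing2)
qed simp

text \<open>The degree 3 equation links 1 and 3, and at the fixed point 1 of the inversion theta2 =
  theta4 and theta3^4 = 2 theta2^4. The resulting quartic relation is symmetric in a and b, hence
  quadratic in u = (a^2 + b^2) / (a b).\<close>

lemma modulus_ratio_nome_9: "modulus_ratio (nome 9) =
    7 + 4 * root 4 12 + 2 * root 4 (12 ^ 2) + root 4 (12 ^ 3)"
proof (rule modulus_ratio_nome_eqI)
  let ?z = "sqrt (real 9)"
  have z3: "?z = 3" by (rule real_sqrt_unique) auto
  define a b d where "a = theta2 3" and "b = theta4 3" and "d = theta3 3"
  have pos: "a > 0" "b > 0" "d > 0" using theta234_pos[of 3] by (auto simp: a_def b_def d_def)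
  have pos1: "theta2 1 > 0" "theta3 1 > 0" using theta234_pos[of 1] by auto
  have j1: "theta3 1 ^ 4 = 2 * theta2 1 ^ 4" using jacobi_quartic[of 1] theta24_one by simp
  have "theta3 1 * d = theta2 1 * (a + b)"
    using theta3_degree_3[of 1] theta24_one by (simp add: a_def b_def d_def algebra_simps)
  then have "(theta3 1 * d)^4 = (theta2 1 * (a + b))^4" by simp
  then have "theta2 1 ^ 4 * (2 * d^4) = theta2 1 ^ 4 * (a + b)^4"
      unfolding power_mult_distrib j1 by simp
  then have "2 * d^4 = (a + b)^4" using pos1 by simp
  moreover have jq: "d^4 = a^4 + b^4" using jacobi_quartic[of 3] by (simp add: a_def b_def d_def)
  ultimately have eq: "2 * (a^4 + b^4) = (a + b)^4" by simp
  define u where "u = (a^2 + b^2) / (a * b)"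
  have u: "a^2 + b^2 = u * (a * b)" "u > 0" using pos by (auto simp: u_def add_pos_pos)
  have "2 * (u^2 - 2) * (a * b)^2 = 2 * (a^4 + b^4)"
  proof -
    have "a^4 + b^4 = (a^2 + b^2)^2 - 2 * (a * b)^2" by (simp add: power2_eq_square power4_eq_xxxx
        algebra_simps)
    then show ?thesis unfolding u by (simp add: power_mult_distrib algebra_simps)
  qed
  moreover have "(u + 2)^2 * (a * b)^2 = (a + b)^4"
  proof -
    have "(a + b)^4 = ((a^2 + b^2) + 2 * (a * b))^2" by (simp add: power2_eq_square power4_eq_xxxx
        algebra_simps)
    then show ?thesis unfolding u by (simp add: power2_eq_square algebra_simps)
  qed
  ultimately have "(u + 2)^2 * (a * b)^2 = 2 * (u^2 - 2) * (a * b)^2" using eq by simp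
  then have "(u + 2)^2 = 2 * (u^2 - 2)" using pos by simp
  then have "(u - 2)^2 = 12" by (simp add: power2_eq_square algebra_simps)
  moreover have "(2 * sqrt 3)^2 = (12::real)" by (simp add: power_mult_distrib)
  ultimately have "\<bar>u - 2\<bar> = 2 * sqrt 3"
    by (metis abs_mult abs_numeral abs_of_nonneg power2_eq_iff_nonneg abs_ge_zero power2_abs
        real_sqrt_ge_zero zero_le_numeral mult_nonneg_nonneg)
  moreover have "2 * sqrt 3 > (2::real)" by simp
  ultimately have u': "u = 2 + 2 * sqrt 3" using u(2) by linarith
  have u2: "u^2 = 16 + 8 * sqrt 3" unfolding u' by (simp add: power2_eq_square algebra_simps)
  have "(d^2)^2 = (u^2 - 2) * (a * b)^2" using \<open>2 * (u^2 - 2) * (a * b)^2 = _\<close> jq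
      by (simp flip: power_mult) (simp add: algebra_simps)
  also have "\<dots> = (sqrt (14 + 8 * sqrt 3) * (a * b))^2" unfolding u2
      by (simp add: power_mult_distrib)
  finally have "d^2 = sqrt (14 + 8 * sqrt 3) * (a * b)"
    by (rule power_eq_imp_eq_base) (use pos in auto)
  then show "theta3 ?z ^ 2 = sqrt (14 + 8 * sqrt 3) * (theta2 ?z * theta4 ?z)"
      unfolding z3 a_def b_def d_def .
  define t where "t = root 4 (12::real)"
  have t: "t > 0" "t^4 = 12" by (auto simp: t_def)
  have "(t^2)^2 = (2 * sqrt 3)^2" using t(2) by (simp add: power_mult_distrib flip: power_mult)
  then have t2: "t^2 = 2 * sqrt 3" by (rule power_eq_imp_eq_base) auto
  have r: "root 4 (12^2) = t^2" "root 4 (12^3) = t^3" unfolding t_def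
      by (rule real_root_power; simp)+
  \<comment> \<open>The other root is the conjugate under t -> -t; the sum and the product of the
    two are even in t and thus expressible by t^2 = 2 sqrt 3.\<close>
  let ?L = "7 + 4 * t + 2 * t^2 + t^3" and ?L' = "7 - 4 * t + 2 * t^2 - t^3"
  show "7 + 4 * root 4 12 + 2 * root 4 (12 ^ 2) + root 4 (12 ^ 3) + ?L' =
      (sqrt (14 + 8 * sqrt 3))^2"
    unfolding r t_def[symmetric] using t2 by simp
  have "?L * ?L' = (7 + 2 * t^2)^2 - t^2 * (4 + t^2)^2"
    by (simp add: power2_eq_square power3_eq_cube algebra_simps)
  also have "\<dots> = 1" unfolding t2 by (simp add: power2_eq_square algebra_simps)
  finally show "(7 + 4 * root 4 12 + 2 * root 4 (12 ^ 2) + root 4 (12 ^ 3)) * ?L' = 1"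
      unfolding r t_def[symmetric] .
  show "7 + 4 * root 4 12 + 2 * root 4 (12 ^ 2) + root 4 (12 ^ 3) \<ge> 1"
      unfolding r t_def[symmetric] using t by (simp add: add_increasing2)
qed simp

subsection \<open>Gaussian integers\<close>

text \<open>Rounding to the nearest integer quotient, for the Euclidean division of Gaussian
  integers.\<close>

lemma nearest_int_multiple:
  fixes X N :: int
  assumes "N > 0"
  obtains e where "2 * \<bar>X - e * N\<bar> \<le> N"
proof
  have gen: "2 * \<bar>X - M\<bar> \<le> N" if "2 * X + N = 2 * M + r" "0 \<le> r" "r < 2 * N" for M r
    using that by (auto simp: abs_if)
  have "2 * X + N = 2 * ((2 * X + N) div (2 * N) * N) + (2 * X + N) mod (2 * N)"
    using div_mult_mod_eq[of "2 * X + N" "2 * N"] by (simp only: mult.left_commute)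
  then show "2 * \<bar>X - (2 * X + N) div (2 * N) * N\<bar> \<le> N"
    by (rule gen) (use assms in simp_all)
qed

text \<open>The factor \<open>c + d i\<close> is an element of least norm in the ideal of the Gaussian integers generated by \<open>a + b i\<close> and \<open>m\<close>.\<close>

lemma gaussian_coprime_factorization:
  fixes a b m n :: int
  assumes m: "m > 0" and n: "n > 0" and coprime: "coprime m n" and ab: "a^2 + b^2 = m * n"
  obtains c d e f where "c^2 + d^2 = m" "e^2 + f^2 = n" "a = c * e - d * f" "b = c * f + d * e"
proof -
  define L where "L = {(x * a - y * b + m * u, x * b + y * a + m * v) | x y u v. True}"
  have LI: "(p, q) \<in> L" if "p = x * a - y * b + m * u" "q = x * b + y * a + m * v" for p q x y u v
    unfolding L_def using that by blast
  define P where "P = (\<lambda>z. z \<in> L \<and> z \<noteq> (0, 0))"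
  have "P (m, 0)" unfolding P_def using m by (auto intro: LI[of _ 0 0 1 _ 0])
  then obtain z where z: "P z" "\<And>w. P w \<Longrightarrow> nat (fst z ^ 2 + snd z ^ 2) \<le> nat (fst w ^ 2 + snd w ^ 2)"
    using ex_has_least_nat[of P _ "\<lambda>w. nat (fst w ^ 2 + snd w ^ 2)"] by blast
  obtain c d where cd: "z = (c, d)" by (cases z)
  define N where "N = c^2 + d^2"
  have N: "N > 0" using z(1) unfolding P_def cd N_def by (auto simp: sum_power2_gt_zero_iff)
  from z(1) obtain x y u v where xy: "c = x * a - y * b + m * u" "d = x * b + y * a + m * v"
    unfolding P_def cd L_def by auto
  \<comment> \<open>Rounding both coordinates of (p + q i) / (c + d i) gives a remainder that lies
    in the ideal and has norm below N, so it is 0 by minimality.\<close>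
  have div: "\<exists>e f. p = c * e - d * f \<and> q = c * f + d * e" if pq: "(p, q) \<in> L" for p q
  proof -
    from pq obtain x' y' u' v' where xy': "p = x' * a - y' * b + m * u'" "q =
        x' * b + y' * a + m * v'"
      unfolding L_def by auto
    obtain e where e: "2 * \<bar>p * c + q * d - e * N\<bar> \<le> N" by (rule nearest_int_multiple[OF N])
    obtain f where f: "2 * \<bar>q * c - p * d - f * N\<bar> \<le> N" by (rule nearest_int_multiple[OF N])
    define r s where "r = p - (c * e - d * f)" and "s = q - (c * f + d * e)"
    have "(r, s) \<in> L"
      by (rule LI[of _ "x' - (x * e - y * f)" "y' - (x * f + y * e)" "u' - (u * e - v * f)" _ "v' -
          (u * f + v * e)"])
         (simp_all add: r_def s_def xy xy' algebra_simps)
    have "4 * ((r^2 + s^2) * N) = (2 * \<bar>p * c + q * d - e * N\<bar>)^2 + (2 * \<bar>q * c - p * d - f * N\<bar>)^2"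
      unfolding power_mult_distrib power2_abs r_def s_def N_def by algebra
    also have "\<dots> \<le> N^2 + N^2" using e f by (intro add_mono power_mono) auto
    also have "\<dots> < 4 * (N * N)" using N by (simp add: power2_eq_square)
    finally have lt: "r^2 + s^2 < N" using N by simp
    have "(r, s) = (0, 0)"
    proof (rule ccontr)
      assume "(r, s) \<noteq> (0, 0)"
      then have "nat N \<le> nat (r^2 + s^2)" using z(2)[of "(r, s)"] \<open>(r, s) \<in> L\<close>
          by (simp add: P_def cd N_def)
      then show False using lt N by simp
    qed
    then show ?thesis unfolding r_def s_def by auto
  qed
  obtain e f where ef: "a = c * e - d * f" "b = c * f + d * e"
    using div[of a b] LI[of a 1 0 0 b 0] by auto
  obtain g h where gh: "m = c * g - d * h" "0 = c * h + d * g"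
    using div[of m 0] LI[of m 0 0 1 0 0] by auto
  have Nef: "m * n = N * (e^2 + f^2)" unfolding ab[symmetric] ef N_def by algebra
  have Ngh: "m * m = N * (g^2 + h^2)"
  proof -
    have "m * m = (c * g - d * h)^2 + (c * h + d * g)^2" using gh by (simp add: power2_eq_square)
    then show ?thesis unfolding N_def by algebra
  qed
  \<comment> \<open>The norm of an element of the ideal, expanded: every term contains m or a^2 +
    b^2 = m n.\<close>
  have "N = (x^2 + y^2) * (a^2 + b^2) + m * (2 * u * (x * a - y * b) + 2 * v * (x * b + y * a) + m
      * (u^2 + v^2))"
    unfolding N_def xy by algebra
  then have "m dvd N" unfolding ab by simp
  then obtain k where k: "N = m * k" by (elim dvdE)
  have "k > 0" using N m unfolding k by (simp add: zero_less_mult_iff)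
  \<comment> \<open>The generator divides a + b i and m, so its norm N = m k divides m n and
    m^2.\<close>
  have "k dvd n" "k dvd m" using Nef Ngh m unfolding k by (auto simp: mult.assoc)
  then have "k dvd 1" using coprime by (meson coprime_common_divisor)
  then have "N = m" using \<open>k > 0\<close> k by simp
  moreover have "e^2 + f^2 = n" using Nef m \<open>N = m\<close> by simp
  ultimately show ?thesis using that ef unfolding N_def by blast
qed

text \<open>The congruences say that a + b i is 1 modulo 2 + 2 i, which singles out one of the four
  associates of every Gaussian integer of odd norm.\<close>

definition primary_gaussian :: "int \<Rightarrow> (int \<times> int) set" where
  "primary_gaussian n = {(a, b). a^2 + b^2 = n \<and> even b \<and> (a + b) mod 4 = 1}"

text \<open>The pair \<open>(j, m)\<close> corresponds to the primary element among the associates of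
  \<open>2 j + 1 + 2 m i\<close>, whose real part is the weight of \<open>(j, m)\<close>.\<close>

lemma b_coeff_1_eq: "b_coeff 1 n = (\<Sum>(a,b)\<in>primary_gaussian (int n). real_of_int a)"
proof -
  have "b_coeff 1 n = sum lattice_weight (lattice_points 1 n)" by (rule b_coeff_eq) simp
  also have "\<dots> = (\<Sum>(a,b)\<in>primary_gaussian (int n). real_of_int a)"
  proof (rule sum.reindex_bij_witness[where i = "\<lambda>(a,b). (nat ((\<bar>a\<bar> - 1) div 2), b div 2)" and
        j = "\<lambda>(j,m). ((-1)^(j + nat \<bar>m\<bar>) * (2 * int j + 1), 2 * m)"])
    fix x assume x: "x \<in> lattice_points 1 n"
    obtain j m where jm: "x = (j, m)" by (cases x)
    show "(case (case x of (j,m) \<Rightarrow> ((-1)^(j + nat \<bar>m\<bar>) * (2 * int j + 1), 2 * m)) of (a,b) \<Rightarrow> (nat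
        ((\<bar>a\<bar> - 1) div 2), b div 2)) = x"
      by (simp add: jm abs_mult power_abs)
    have e: "even (j + nat \<bar>m\<bar>) \<longleftrightarrow> even (int j + m)" by (simp add: even_nat_iff)
    have "((-1)^(j + nat \<bar>m\<bar>) * (2 * int j + 1) + 2 * m) mod 4 = 1"
      unfolding minus_one_power_iff e by presburger
    then show "(case x of (j,m) \<Rightarrow> ((-1)^(j + nat \<bar>m\<bar>) * (2 * int j + 1), 2 * m)) \<in> primary_gaussian
        (int n)"
      using x by (simp add: jm primary_gaussian_def lattice_points_def power_mult_distrib flip:
          power_mult)
    show "(case (case x of (j,m) \<Rightarrow> ((-1)^(j + nat \<bar>m\<bar>) * (2 * int j + 1), 2 * m)) of (a,b) \<Rightarrow>
        real_of_int a) = lattice_weight x"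
      by (simp add: jm lattice_weight_def)
  next
    fix x assume x: "x \<in> primary_gaussian (int n)"
    then obtain a b where ab: "x = (a, b)" "a^2 + b^2 = int n" "even b" "(a + b) mod 4 = 1"
      by (auto simp: primary_gaussian_def)
    define j where "j = nat ((\<bar>a\<bar> - 1) div 2)"
    obtain m where m: "b = 2 * m" using ab(3) by (elim evenE)
    have "odd a" using ab(3,4) by presburger
    then have "2 * ((\<bar>a\<bar> - 1) div 2) + 1 = \<bar>a\<bar>" "0 \<le> (\<bar>a\<bar> - 1) div 2" by presburger+
    then have j: "2 * int j + 1 = \<bar>a\<bar>" by (simp add: j_def)
    have e: "even (j + nat \<bar>m\<bar>) \<longleftrightarrow> even (int j + m)" by (simp add: even_nat_iff)
    have "(-1)^(j + nat \<bar>m\<bar>) * (2 * int j + 1) = a"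
      using ab(4) j unfolding minus_one_power_iff e m by presburger
    then show "(case (case x of (a,b) \<Rightarrow> (nat ((\<bar>a\<bar> - 1) div 2), b div 2)) of (j,m) \<Rightarrow> ((-1)^(j + nat
        \<bar>m\<bar>) * (2 * int j + 1), 2 * m)) = x"
      by (simp add: ab(1) m j_def[symmetric])
    have "(2 * int j + 1)^2 + 4 * m^2 = int n" using ab(2) unfolding j m
        by (simp add: power_mult_distrib)
    then show "(case x of (a,b) \<Rightarrow> (nat ((\<bar>a\<bar> - 1) div 2), b div 2)) \<in> lattice_points 1 n"
      by (simp add: ab(1) m j_def[symmetric] lattice_points_def)
  qed
  finally show ?thesis .
qed

text \<open>Conjugation preserves being primary, as b is even.\<close>

lemma sum_snd_primary_gaussian: "(\<Sum>(a,b)\<in>primary_gaussian n. real_of_int b) = 0"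
proof -
  have "(\<Sum>(a,b)\<in>primary_gaussian n. real_of_int b) = (\<Sum>(a,b)\<in>primary_gaussian n. - real_of_int b)"
    by (rule sum.reindex_bij_witness[where i = "\<lambda>(a,b). (a, -b)" and j = "\<lambda>(a,b). (a, -b)"])
       (auto simp: primary_gaussian_def, presburger+)
  also have "\<dots> = - (\<Sum>(a,b)\<in>primary_gaussian n. real_of_int b)"
    by (simp add: case_prod_unfold sum_negf)
  finally show ?thesis by simp
qed

text \<open>Being primary is a congruence modulo 2 + 2 i, and a primary first factor is 1
  there.\<close>

lemma primary_product_iff:
  fixes c d e f :: int
  assumes "even d" "(c + d) mod 4 = 1"
  shows "even (c * f + d * e) \<and> (c * e - d * f + (c * f + d * e)) mod 4 = 1 \<longleftrightarrow>
    even f \<and> (e + f) mod 4 = 1"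
proof -
  have "odd c" using assms by presburger
  then have f: "even (c * f + d * e) \<longleftrightarrow> even f" using assms(1) by auto
  have "(c * e - d * f + (c * f + d * e)) mod 4 = (e + f) mod 4" if "even f"
  proof -
    obtain d' where d: "d = 2 * d'" using assms(1) by (elim evenE)
    obtain f' where f: "f = 2 * f'" using \<open>even f\<close> by (elim evenE)
    obtain k where k: "c + d = 4 * k + 1" using assms(2) by (metis mult_div_mod_eq)
    have "c * e - d * f + (c * f + d * e) = (c + d) * (e + f) - 8 * (d' * f')"
      unfolding d f by (simp add: algebra_simps)
    also have "\<dots> = (e + f) + 4 * (k * (e + f) - 2 * (d' * f'))"
      unfolding k by (simp add: algebra_simps)
    finally show ?thesis by (simp only: mod_mult_self2)
  qed
  then show ?thesis using f by auto
qed

lemma bij_betw_primary_gaussian: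
  assumes m: "m > 0" and n: "n > 0" and coprime: "coprime m n"
  shows "bij_betw (\<lambda>((c,d),(e,f)). (c * e - d * f, c * f + d * e)) (primary_gaussian m \<times>
      primary_gaussian n) (primary_gaussian (m * n))"
proof (rule bij_betw_imageI)
  show "inj_on (\<lambda>((c,d),(e,f)). (c * e - d * f, c * f + d * e)) (primary_gaussian m \<times>
      primary_gaussian n)"
  proof (rule inj_onI)
    fix x x' assume x: "x \<in> primary_gaussian m \<times> primary_gaussian n" and x': "x' \<in> primary_gaussian
        m \<times> primary_gaussian n"
      and xx': "(\<lambda>((c,d),(e,f)). (c * e - d * f, c * f + d * e)) x =
          (\<lambda>((c,d),(e,f)). (c * e - d * f, c * f + d * e)) x'"
    obtain c d e f where X: "x = ((c, d), (e, f))" by (metis surj_pair)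
    obtain c' d' e' f' where X': "x' = ((c', d'), (e', f'))" by (metis surj_pair)
    have cd: "(c, d) \<in> primary_gaussian m" and cd': "(c', d') \<in> primary_gaussian m"
      and ef: "(e, f) \<in> primary_gaussian n" and ef': "(e', f') \<in> primary_gaussian n"
      and eqs: "c * e - d * f = c' * e' - d' * f'" "c * f + d * e = c' * f' + d' * e'"
      using x x' xx' unfolding X X' by simp_all
    note P = cd cd' ef ef' primary_gaussian_def
    have N: "c^2 + d^2 = m" "c'^2 + d'^2 = m" "e^2 + f^2 = n" using P by auto
    \<comment> \<open>With z = c + d i and w = e + f i, multiply z w = z' w' by the conjugates of z'
      and w: n z conj(z') = m w' conj(w). Coprimality then makes z conj(z') equal to m (s + t
      i).\<close>
    have "n * (c * c' + d * d') = m * (e' * e + f' * f)" "n * (d * c' - c * d') =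
        m * (f' * e - e' * f)"
      using eqs N by algebra+
    then have "m dvd n * (c * c' + d * d')" "m dvd n * (d * c' - c * d')" by simp_all
    then have "m dvd c * c' + d * d'" "m dvd d * c' - c * d'"
      using coprime by (simp_all add: coprime_dvd_mult_right_iff)
    then obtain s t where st: "c * c' + d * d' = m * s" "d * c' - c * d' = m * t"
        by (auto elim!: dvdE)
    \<comment> \<open>Both z and z' have norm m, so s + t i is a unit; among the four units only 1
      relates two primary numbers.\<close>
    have "m^2 * (s^2 + t^2) = m^2 * 1"
    proof -
      have "(c * c' + d * d')^2 + (d * c' - c * d')^2 = (c^2 + d^2) * (c'^2 + d'^2)" by algebra
      then show ?thesis unfolding N st by (simp add: power2_eq_square algebra_simps)
    qed
    then have "s^2 + t^2 = 1" using m by simp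
    have "m * c = m * (s * c' - t * d')" "m * d = m * (t * c' + s * d')" using st N by algebra+
    then have u: "c = s * c' - t * d'" "d = t * c' + s * d'" using m by simp_all
    have "\<bar>s\<bar> \<le> 1" "\<bar>t\<bar> \<le> 1" using \<open>s^2 + t^2 = 1\<close> abs_square_le_1[of s] abs_square_le_1[of t]
      by (smt (verit) zero_le_power2)+
    then have "s \<in> {-1, 0, 1}" "t \<in> {-1, 0, 1}" by auto
    moreover have "even d" "(c + d) mod 4 = 1" "even d'" "(c' + d') mod 4 = 1" using P by auto
    ultimately have "s = 1 \<and> t = 0" using \<open>s^2 + t^2 = 1\<close> unfolding u by (auto; presburger)
    then have cc: "c = c'" "d = d'" using u by auto
    have "m * e = m * e'" "m * f = m * f'" using eqs N(1) unfolding cc by algebra+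
    then have "e = e'" "f = f'" using m by simp_all
    then show "x = x'" using cc unfolding X X' by simp
  qed
  show "(\<lambda>((c,d),(e,f)). (c * e - d * f, c * f + d * e)) ` (primary_gaussian m \<times> primary_gaussian
      n) = primary_gaussian (m * n)"
  proof (intro equalityI subsetI)
    fix x assume "x \<in> (\<lambda>((c,d),(e,f)). (c * e - d * f, c * f + d * e)) ` (primary_gaussian m \<times>
        primary_gaussian n)"
    then obtain c d e f where x: "x = (c * e - d * f, c * f + d * e)" "(c, d) \<in> primary_gaussian m"
        "(e, f) \<in> primary_gaussian n"
      by auto
    then have "c^2 + d^2 = m" "e^2 + f^2 = n" by (auto simp: primary_gaussian_def)
    moreover have "(c * e - d * f)^2 + (c * f + d * e)^2 = (c^2 + d^2) * (e^2 + f^2)" by algebra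
    ultimately have "(c * e - d * f)^2 + (c * f + d * e)^2 = m * n" by simp
    then show "x \<in> primary_gaussian (m * n)"
      using primary_product_iff[of d c f e] x by (simp add: primary_gaussian_def)
  next
    fix x assume "x \<in> primary_gaussian (m * n)"
    then obtain a b where x: "x = (a, b)" "a^2 + b^2 = m * n" "even b" "(a + b) mod 4 = 1"
      by (auto simp: primary_gaussian_def)
    obtain c d e f where cd: "c^2 + d^2 = m" "e^2 + f^2 = n" "a = c * e - d * f" "b = c * f + d * e"
      by (rule gaussian_coprime_factorization[OF m n coprime x(2)])
    have "odd a" using x by presburger
    then have "odd (m * n)" using x(2,3) by (metis even_add even_power zero_less_numeral)
    then have "odd (c + d)" using cd(1) by auto
    have img: "x \<in> (\<lambda>((c,d),(e,f)). (c * e - d * f, c * f + d * e)) ` (primary_gaussian m \<times>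
        primary_gaussian n)"
      if "c^2 + d^2 = m" "e^2 + f^2 = n" "a = c * e - d * f" "b =
          c * f + d * e" "even d" "(c + d) mod 4 = 1" for c d e f
    proof -
      have "even f \<and> (e + f) mod 4 = 1"
        using primary_product_iff[OF that(5,6), of f e] x that by auto
      then have "((c, d), (e, f)) \<in> primary_gaussian m \<times> primary_gaussian n" using that
          by (simp add: primary_gaussian_def)
      then show ?thesis by (rule rev_image_eqI) (simp add: x that)
    qed
    \<comment> \<open>Units may be moved between the factors: here -1 makes the first factor
      primary, and in the last case i against -i makes its imaginary part even.\<close>
    have img': "x \<in> (\<lambda>((c,d),(e,f)). (c * e - d * f, c * f + d * e)) ` (primary_gaussian m \<times>
        primary_gaussian n)"
      if "c^2 + d^2 = m" "e^2 + f^2 = n" "a = c * e - d * f" "b =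
          c * f + d * e" "even d" "odd c" for c d e f
    proof (cases "(c + d) mod 4 = 1")
      case False
      then have "(- c + - d) mod 4 = 1" using that(5,6) by presburger
      then show ?thesis using that by (intro img[of "-c" "-d" "-e" "-f"]) auto
    qed (rule img[OF that(1-5)])
    show "x \<in> (\<lambda>((c,d),(e,f)). (c * e - d * f, c * f + d * e)) ` (primary_gaussian m \<times>
        primary_gaussian n)"
    proof (cases "even d")
      case True
      then have "odd c" using \<open>odd (c + d)\<close> by simp
      then show ?thesis using img'[of c d e f] cd True by blast
    next
      case False
      then show ?thesis using cd \<open>odd (c + d)\<close>
        by (intro img'[of "-d" c f "-e"]) (auto simp: add.commute)
    qed
  qed
qed

text \<open>The real part of a product is c e - d f, and the sum of d f splits into two sums of
  imaginary parts, which vanish.\<close>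

lemma multiplicative_b_coeff_1: "multiplicative_seq (b_coeff 1)"
  unfolding multiplicative_seq_def
proof (intro allI impI)
  fix m n :: nat
  assume mn: "m \<ge> 1" "n \<ge> 1" "coprime m n"
  let ?M = "primary_gaussian (int m)" and ?N = "primary_gaussian (int n)"
  have "b_coeff 1 (m * n) = (\<Sum>(a,b)\<in>primary_gaussian (int m * int n). real_of_int a)"
    unfolding b_coeff_1_eq of_nat_mult ..
  also have "\<dots> = (\<Sum>x\<in>?M \<times> ?N. (\<lambda>(a,b). real_of_int a) ((\<lambda>((c,d),(e,f)). (c * e - d * f, c * f + d *
      e)) x))"
    using sum.reindex_bij_betw[OF bij_betw_primary_gaussian[of "int m" "int n"], of "\<lambda>(a,b).
        real_of_int a", symmetric] mn
    by (simp only: of_nat_0_less_iff coprime_int_iff)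
  also have "\<dots> = (\<Sum>(c,d)\<in>?M. \<Sum>(e,f)\<in>?N. real_of_int (c * e - d * f))"
    by (simp add: sum.cartesian_product case_prod_unfold)
  also have "\<dots> = (\<Sum>(a,b)\<in>?M. real_of_int a) * (\<Sum>(a,b)\<in>?N. real_of_int a) - (\<Sum>(a,b)\<in>?M. real_of_int
      b) * (\<Sum>(a,b)\<in>?N. real_of_int b)"
    by (simp add: case_prod_unfold sum_product sum_subtractf)
  finally show "b_coeff 1 (m * n) = b_coeff 1 m * b_coeff 1 n"
    unfolding sum_snd_primary_gaussian b_coeff_1_eq by simp
qed

theorem theorem7:
  shows "(\<forall>r::nat. r \<ge> 1 \<longrightarrow>
            summable (\<lambda>n. b_coeff r (Suc n) / real (Suc n) ^ 2) \<and>
            mahler_m (8 * \<i> * of_real (class_g r ^ 8 * class_G r ^ 4)) =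
              16 * sqrt (real r) / pi ^ 2 * (\<Sum>n. b_coeff r (Suc n) / real (Suc n) ^ 2)) \<and>
         (8 * class_g 1 ^ 8 * class_G 1 ^ 4 = 4 \<and> multiplicative_seq (b_coeff 1)) \<and>
         (8 * class_g 2 ^ 8 * class_G 2 ^ 4 = 4 * sqrt (2 + 2 * sqrt 2) \<and>
            \<not> multiplicative_seq (b_coeff 2)) \<and>
         (8 * class_g 3 ^ 8 * class_G 3 ^ 4 = 4 * (2 + sqrt 3) \<and>
            \<not> multiplicative_seq (b_coeff 3)) \<and>
         (8 * class_g 7 ^ 8 * class_G 7 ^ 4 = 4 * (8 + 3 * sqrt 7) \<and>
            \<not> multiplicative_seq (b_coeff 7)) \<and>
         (8 * class_g 9 ^ 8 * class_G 9 ^ 4 =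
              4 * (7 + 4 * root 4 12 + 2 * root 4 (12 ^ 2) + root 4 (12 ^ 3)) \<and>
            \<not> multiplicative_seq (b_coeff 9)) \<and>
         (8 * class_g 15 ^ 8 * class_G 15 ^ 4 =
              4 * (28 + 16 * sqrt 3 + 12 * sqrt 5 + 7 * sqrt 15) \<and>
            \<not> multiplicative_seq (b_coeff 15))"
proof (intro conjI allI impI)
  fix r :: nat
  assume "r \<ge> 1"
  from mahler_m_eq_b_coeff_sum[OF this]
  show "summable (\<lambda>n. b_coeff r (Suc n) / real (Suc n) ^ 2)"
    "mahler_m (8 * \<i> * of_real (class_g r ^ 8 * class_G r ^ 4)) =
       16 * sqrt (real r) / pi ^ 2 * (\<Sum>n. b_coeff r (Suc n) / real (Suc n) ^ 2)" .
qed (simp_all only: class_invariants_eq_modulus_ratio one_le_numeral order_refl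
       modulus_ratio_nome_1 modulus_ratio_nome_2 modulus_ratio_nome_3 modulus_ratio_nome_7
       modulus_ratio_nome_9 modulus_ratio_nome_15 mult_1_right multiplicative_b_coeff_1
       not_multiplicative_b_coeff_2 not_multiplicative_b_coeff_3 not_multiplicative_b_coeff_7
       not_multiplicative_b_coeff_9 not_multiplicative_b_coeff_15 not_False_eq_True)

end
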